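(* (i) If $f\in L^s(G(n,j))$ with $1\le s<(n-j)/l$, then $(R_{p,q}^k f)(\zeta)$ exists for almost all $\zeta\in G(n,k)$. (ii) If $g\in L^r(G(n,k))$ with $1\le r<(n-k)/q$, then $(R_{p,l}^j g)(\tau)$ exists for almost all $\tau\in G(n,j)$. Moreover, the bounds $s<(n-j)/l$ and $r<(n-k)/q$ are sharp: for every finite $s\ge (n-j)/l$ (respectively $r\ge (n-k)/q$) there is a function $f\in L^s(G(n,j))$ (respectively $g\in L^r(G(n,k))$) for which the conclusion of (i) (respectively (ii)) fails.
   Context: Standing assumptions: $n,p,q,l$ are integers with $p>0$, $q>0$, $l>0$, $p+q+l<n$; set $j=p+q$ and $k=p+l$. For a linear subspace $X\subset\mathbb{R}^n$, $G_m(X)$ is the set of $m$-dimensional linear subspaces of $X$ with its rotation-invariant probability measure; $G_{n,m}=G_m(\mathbb{R}^n)$. $G(n,m)$ is the set of all affine $m$-planes in $\mathbb{R}^n$; each $\tau\in G(n,j)$ is written $\tau=(\xi,u)=\xi+u$ with $\xi\in G_{n,j}$, $u\in\xi^\perp$, and each $\zeta\in G(n,k)$ is written $\zeta=(\eta,v)=\eta+v$ with $\eta\in G_{n,k}$, $v\in\eta^\perp$. The measures are $d\tau=d\xi\,du$, $d\zeta=d\eta\,dv$, where $d\xi,d\eta$ are the $O(n)$-invariant probability measures and $du,dv$ are Lebesgue measure on $\xi^\perp,\eta^\perp$; $L^s(G(n,j))$ and $L^r(G(n,k))$ are taken with respect to these measures. For mutually orthogonal subspaces $P,Q$, $[P,Q]=P\oplus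 Q$. The Strichartz transform of a function $f$ on $G(n,j)$ and the dual transform of a function $g$ on $G(n,k)$ are $$(R_{p,q}^k f)(\eta,v)=\int_{G_q(\eta^\perp)}dQ\int_{G_p(\eta)}dP\int_{P^\perp\cap\eta} f([P,Q]+u+v)\,du,$$ $$(R_{p,l}^j g)(\xi,u)=\int_{G_l(\xi^\perp)}dL\int_{G_p(\xi)}dP\int_{P^\perp\cap\xi} g([P,L]+u+v)\,dv,$$ with $dQ,dP,dL$ the invariant probability measures. "Exists" means that the integral converges absolutely (exists in the Lebesgue sense). *)

theory Defs
  imports "HOL-Probability.Probability"
begin

definition grass :: "'a::euclidean_space set \<Rightarrow> nat \<Rightarrow> 'a set set" where
  "grass X m = {S. subspace S \<and> S \<subseteq> X \<and> dim S = m}"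

definition affine_grass :: "nat \<Rightarrow> 'a::euclidean_space set set" where
  "affine_grass m = {A. affine A \<and> aff_dim A = int m}"

(* For a family G of (linear or affine) planes of one fixed dimension, the sets of members that
   meet a given open set form a subbasis of the usual topology of G.  This topology is second
   countable, so these sets also generate its Borel sigma-algebra. *)
definition plane_algebra :: "'a::euclidean_space set set \<Rightarrow> 'a set measure" where
  "plane_algebra G = sigma G {{A \<in> G. A \<inter> U \<noteq> {}} | U. open U}"

(* Every linear isometry of X extends to an orthogonal transformation of the whole space, so the
   last condition is invariance under the orthogonal group of X. *)
definition rotation_invariant_prob ::
    "'a::euclidean_space set \<Rightarrow> nat \<Rightarrow> 'a set measure \<Rightarrow> bool" where
  "rotation_invariant_prob X m M \<longleftrightarrow>
     space M = grass X m \<and> sets M = sets (plane_algebra (grass X m)) \<and> prob_space M \<and>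
     (\<forall>T. orthogonal_transformation T \<and> T ` X = X \<longrightarrow> distr M M (\<lambda>S. T ` S) = M)"

definition grass_measure :: "'a::euclidean_space set \<Rightarrow> nat \<Rightarrow> 'a set measure" where
  "grass_measure X m = (THE M. rotation_invariant_prob X m M)"

(* Lebesgue measure on a linear subspace X, as a Borel measure on the ambient space that is
   concentrated on X: the image of the product Lebesgue measure under coordinates in an
   orthonormal basis.  It does not depend on the basis, and for X = UNIV it is lborel. *)
definition lborel_on :: "'a::euclidean_space set \<Rightarrow> 'a measure" where
  "lborel_on X =
     (let B = (SOME B. pairwise orthogonal B \<and> (\<forall>b\<in>B. norm b = 1) \<and> span B = X)
      in distr (\<Pi>\<^sub>M b\<in>B. (lborel :: real measure)) borel (\<lambda>c. \<Sum>b\<in>B. c b *\<^sub>R b))"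

(* The measure dM(x) dK_x(y) on pairs, for a measurable family of measures K x on the
   measurable space N. *)
definition fibred_measure :: "'b measure \<Rightarrow> 'c measure \<Rightarrow> ('b \<Rightarrow> 'c measure) \<Rightarrow> ('b \<times> 'c) measure" where
  "fibred_measure M N K =
     measure_of (space M \<times> space N) (sets (M \<Otimes>\<^sub>M N))
       (\<lambda>E. \<integral>\<^sup>+x. (\<integral>\<^sup>+y. indicator E (x, y) \<partial>K x) \<partial>M)"

(* The measure d\<xi> du on affine m-planes \<xi> + u, with u orthogonal to \<xi>. *)
definition affine_grass_measure :: "nat \<Rightarrow> 'a::euclidean_space set measure" where
  "affine_grass_measure m =
     distr (fibred_measure (grass_measure UNIV m) borel (\<lambda>\<xi>. lborel_on (\<xi>\<^sup>\<bottom>)))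
       (plane_algebra (affine_grass m)) (\<lambda>(\<xi>, u). (+) u ` \<xi>)"

(* Functions rather than almost-everywhere classes; the completion allows Lebesgue measurable
   representatives. *)
definition Lp_funs :: "real \<Rightarrow> 'b measure \<Rightarrow> ('b \<Rightarrow> real) set" where
  "Lp_funs s M = {f \<in> borel_measurable (completion M).
     integrable (completion M) (\<lambda>x. \<bar>f x\<bar> powr s)}"

(* A plane \<zeta> is \<eta> + v with \<eta> = dir_space \<zeta> and v = foot \<zeta> orthogonal to \<eta>. *)
definition dir_space :: "'a::euclidean_space set \<Rightarrow> 'a set" where
  "dir_space \<zeta> = {x - y | x y. x \<in> \<zeta> \<and> y \<in> \<zeta>}"

definition foot :: "'a::euclidean_space set \<Rightarrow> 'a" where
  "foot \<zeta> = (THE v. v \<in> \<zeta> \<and> v \<in> (dir_space \<zeta>)\<^sup>\<bottom>)"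

(* The measure dQ dP du on triples (Q, P, u), where Q is an m-dimensional subspace of the
   orthogonal complement of \<eta>, P is a p-dimensional subspace of \<eta>, and u lies in \<eta> and is
   orthogonal to P. *)
definition strichartz_measure ::
    "nat \<Rightarrow> nat \<Rightarrow> 'a::euclidean_space set \<Rightarrow> ('a set \<times> 'a set \<times> 'a) measure" where
  "strichartz_measure p m \<eta> =
     grass_measure (\<eta>\<^sup>\<bottom>) m \<Otimes>\<^sub>M
     fibred_measure (grass_measure \<eta> p) borel (\<lambda>P. lborel_on (P\<^sup>\<bottom> \<inter> \<eta>))"

(* f ([P,Q] + u + v) *)
definition strichartz_integrand ::
    "('a::euclidean_space set \<Rightarrow> real) \<Rightarrow> 'a \<Rightarrow> 'a set \<times> 'a set \<times> 'a \<Rightarrow> real" where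
  "strichartz_integrand f v = (\<lambda>(Q, P, u). f {x + y + u + v | x y. x \<in> P \<and> y \<in> Q})"

(* The Strichartz transform R_{p,m} f at the plane \<zeta>, whose dimension is read off from \<zeta>.
   The dual transform has the same formula: m = q for functions on (p+q)-planes evaluated
   at (p+l)-planes, and m = l for functions on (p+l)-planes evaluated at (p+q)-planes. *)
definition strichartz ::
    "nat \<Rightarrow> nat \<Rightarrow> ('a::euclidean_space set \<Rightarrow> real) \<Rightarrow> 'a set \<Rightarrow> real" where
  "strichartz p m f \<zeta> =
     integral\<^sup>L (completion (strichartz_measure p m (dir_space \<zeta>))) (strichartz_integrand f (foot \<zeta>))"

definition strichartz_exists ::
    "nat \<Rightarrow> nat \<Rightarrow> ('a::euclidean_space set \<Rightarrow> real) \<Rightarrow> 'a set \<Rightarrow> bool" where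
  "strichartz_exists p m f \<zeta> \<longleftrightarrow>
     integrable (completion (strichartz_measure p m (dir_space \<zeta>))) (strichartz_integrand f (foot \<zeta>))"

end

theory Submission
  imports Defs
begin

text \<open>
  Write \<rho> = n - p - q - l, so that n - j = l + \<rho>. Parts (i) and (ii) are the same assertion with q
  and l exchanged, so it suffices to treat part (i), together with the counterexample that belongs
  to it.

  \<^bold>\<open>Existence.\<close> The transform of f \<ge> 0 is finite almost everywhere as soon as its integral over
  all k-planes at distance at most a from the origin is finite for each a. Everything is put in
  coordinates: \<real>^n is split into coordinate subspaces E_p \<oplus> E_q \<oplus> E_l \<oplus> E_\<rho>, a random k-direction
  is \<gamma>(E_p \<oplus> E_l) and a random j-direction is \<gamma>(E_p \<oplus> E_q) with \<gamma> distributed by Haar measure on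
  O(n). The inner integrations over Q and P only rotate the flag (\<gamma> E_p, \<gamma> E_q) inside
  \<gamma>(E_p \<oplus> E_l) and its complement, so they are absorbed by the right invariance of Haar measure
  (\<open>weighted_integral_of_transform\<close>). What remains is an integral of f(\<gamma>(E_p \<oplus> E_q + y)) over \<gamma>
  and over the slab of those y \<in> E_l \<oplus> E_\<rho> whose E_\<rho>-component has length at most a. Averaging
  this slab over the rotations that preserve E_p \<oplus> E_q replaces its indicator by a radial weight
  W(y) \<le> 1, the probability that a randomly rotated copy of y lies in the slab
  (\<open>transform_on_ball_le\<close>). Since W decreases in |y|, comparing its mean over the ball of radius
  |y| with the volume of the slab inside this ball gives W(y) = O(|y|^(-\<rho>)) (\<open>slab_weight_decay\<close>).
  For s > 1 and 1/s + 1/s' = 1 the function W^(s') is integrable on E_l \<oplus> E_\<rho> when \<rho> s' > l + \<rho>,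
  that is when s < (l + \<rho>)/l; then W f \<le> f^s + W^(s') is integrable. For s = 1 the bound W \<le> 1
  suffices.

  \<^bold>\<open>Null sets.\<close> Applied to the indicator of a null set of j-planes, the same inequality shows that
  for almost every k-plane almost none of the j-planes over which the transform integrates belongs
  to this null set. Hence representatives that are only Lebesgue measurable cause no harm
  (\<open>strichartz_exists_AE\<close>).

  \<^bold>\<open>Sharpness.\<close> For s \<ge> (l + \<rho>)/l take f(\<tau>) = (1+|\<tau>|)^(-(l+\<rho>)/s) / (1 + log (1+|\<tau>|)), with |\<tau>| the
  distance to the origin. The integral of f^s is comparable to the sum of (1+i)^(-s) over all i,
  which is finite, whereas at every k-plane the transform dominates an l-dimensional integral that
  is bounded below by a multiple of the harmonic series (\<open>strichartz_exists_sharp\<close>).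

  \<^bold>\<open>Foundations.\<close> The invariant measures are obtained from Gram-Schmidt frames of independent
  random vectors: these give a left invariant probability measure on O(n) and on its subgroups
  O(X) \<times> O(X^\<bottom>), right invariance follows from a Fubini argument, and averaging over such a
  subgroup shows that the invariant measure on a Grassmannian exists and is unique
  (\<open>rotation_invariant_prob_iff\<close>).
\<close>

section \<open>Coordinate subspaces and rotations\<close>

text \<open>
  Inverse rotations are written as products with the transposed matrix, a form that this rewrite
  rule would destroy.
\<close>

declare transpose_matrix_vector [simp del]

definition coord_space :: "'n set \<Rightarrow> (real^'n) set" where
  "coord_space I = {x. \<forall>i. i \<notin> I \<longrightarrow> x $ i = 0}"

definition coord_proj :: "'n set \<Rightarrow> real^'n \<Rightarrow> real^'n" where
  "coord_proj I x = (\<chi> i. if i \<in> I then x $ i else 0)"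

lemma coord_proj_nth [simp]: "coord_proj I x $ i = (if i \<in> I then x $ i else 0)"
  by (simp add: coord_proj_def)

lemma card_Compl_eq: "card (- (I :: 'n::finite set)) = CARD('n) - card I"
  by (metis Compl_eq_Diff_UNIV card_Diff_subset finite_code subset_UNIV)

lemma subspace_coord_space [simp]: "subspace (coord_space I)"
  by (auto simp: subspace_def coord_space_def)

lemma coord_proj_mem [simp]: "coord_proj I x \<in> coord_space I"
  by (simp add: coord_space_def)

lemma coord_proj_ident: "x \<in> coord_space I \<Longrightarrow> coord_proj I x = x"
  by (auto simp: coord_space_def vec_eq_iff)

lemma linear_coord_proj: "linear (coord_proj I :: real^'n::finite \<Rightarrow> _)"
  by (auto intro!: linearI simp: vec_eq_iff)

lemma coord_proj_add: "coord_proj I (x + y) = coord_proj I x + coord_proj I y"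
  by (auto simp: vec_eq_iff)

lemma coord_proj_compl: "x - coord_proj I x = coord_proj (- I) x"
  by (auto simp: vec_eq_iff)

lemma coord_space_UNIV [simp]: "coord_space UNIV = UNIV"
  by (simp add: coord_space_def)

lemma coord_space_mono: "I \<subseteq> J \<Longrightarrow> coord_space I \<subseteq> coord_space J"
  by (auto simp: coord_space_def)

lemma axis_mem_coord_space: "i \<in> I \<Longrightarrow> axis i 1 \<in> coord_space I"
  by (auto simp: coord_space_def axis_def)

lemma norm_coord_proj_le: "norm (coord_proj I (x::real^'n::finite)) \<le> norm x"
  unfolding norm_vec_def by (intro L2_set_mono) auto

lemma coord_space_orthogonal_comp: "(coord_space I)\<^sup>\<bottom> = coord_space (- I :: 'n::finite set)"
proof (intro set_eqI iffI)
  fix x :: "real^'n" assume x: "x \<in> (coord_space I)\<^sup>\<bottom>"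
  have "x $ i = 0" if "i \<in> I" for i
  proof -
    have "axis i 1 \<bullet> x = 0"
      using x axis_mem_coord_space[OF that] by (auto simp: orthogonal_comp_def orthogonal_def)
    then show ?thesis by (simp add: inner_axis')
  qed
  then show "x \<in> coord_space (- I)" by (auto simp: coord_space_def)
next
  fix x :: "real^'n" assume x: "x \<in> coord_space (- I)"
  show "x \<in> (coord_space I)\<^sup>\<bottom>"
    unfolding orthogonal_comp_def orthogonal_def inner_vec_def
    using x by (fastforce simp: coord_space_def intro!: sum.neutral) 
qed

lemma span_axis_eq_coord_space: "span ((\<lambda>i. axis i (1::real)) ` I) = coord_space (I :: 'n::finite set)"
proof
  show "span ((\<lambda>i. axis i (1::real)) ` I) \<subseteq> coord_space I"
    by (rule span_minimal) (auto simp: axis_mem_coord_space)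
  show "coord_space I \<subseteq> span ((\<lambda>i. axis i (1::real)) ` I)"
  proof
    fix x :: "real^'n" assume "x \<in> coord_space I"
    then have "x = (\<Sum>i\<in>I. x $ i *\<^sub>R axis i 1)"
      by (auto simp: vec_eq_iff coord_space_def axis_def if_distrib cong: if_cong)
    also have "\<dots> \<in> span ((\<lambda>i. axis i (1::real)) ` I)"
      by (intro span_sum span_scale span_base) auto
    finally show "x \<in> span ((\<lambda>i. axis i (1::real)) ` I)" .
  qed
qed

lemma dim_coord_space [simp]: "dim (coord_space (I::'n::finite set)) = card I"
proof -
  have ind: "independent ((\<lambda>i. axis i (1::real)) ` I)"
    by (rule independent_mono[OF independent_Basis]) (auto simp: Basis_vec_def)
  have "inj_on (\<lambda>i. axis i (1::real)) I"
    by (auto simp: inj_on_def axis_eq_axis)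
  then show ?thesis
    using dim_span_eq_card_independent[OF ind] by (simp add: span_axis_eq_coord_space card_image)
qed

context
  fixes A :: "real^'n::finite^'n"
  assumes A: "orthogonal_matrix A"
begin

lemma orthogonal_matrix_transpose_mult: "transpose A *v (A *v x) = x"
  and orthogonal_matrix_mult_transpose: "A *v (transpose A *v x) = x"
  using A by (simp_all add: matrix_vector_mul_assoc orthogonal_matrix_def)

lemma orthogonal_matrix_inner: "(A *v x) \<bullet> (A *v y) = x \<bullet> y"
  by (metis dot_lmul_matrix vector_transpose_matrix orthogonal_matrix_transpose_mult)

lemma orthogonal_matrix_norm: "norm (A *v x) = norm x"
  by (simp add: norm_eq_sqrt_inner orthogonal_matrix_inner)

lemma orthogonal_matrix_dist: "dist (A *v x) (A *v y) = dist x y"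
  unfolding dist_norm by (metis matrix_vector_mult_diff_distrib orthogonal_matrix_norm)

lemma orthogonal_matrix_inj: "inj ((*v) A)"
  by (metis injI orthogonal_matrix_transpose_mult)

lemma orthogonal_matrix_surj: "surj ((*v) A)"
  by (metis surjI orthogonal_matrix_mult_transpose)

lemma orthogonal_matrix_mem_image: "x \<in> (*v) A ` S \<longleftrightarrow> transpose A *v x \<in> S"
  by (metis image_iff orthogonal_matrix_mult_transpose orthogonal_matrix_transpose_mult)

lemma orthogonal_matrix_orthogonal_transformation: "orthogonal_transformation ((*v) A)"
  by (simp add: orthogonal_transformation_def orthogonal_matrix_inner)

lemma orthogonal_matrix_orthogonal_comp: "((*v) A ` S)\<^sup>\<bottom> = (*v) A ` (S\<^sup>\<bottom>)"
proof -
  have *: "transpose A *v x \<in> S\<^sup>\<bottom> \<longleftrightarrow> (\<forall>y\<in>S. (A *v y) \<bullet> x = 0)" for x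
    using orthogonal_matrix_inner[of _ "transpose A *v x"]
    by (simp add: orthogonal_comp_def orthogonal_def orthogonal_matrix_mult_transpose)
  have "x \<in> ((*v) A ` S)\<^sup>\<bottom> \<longleftrightarrow> (\<forall>y\<in>S. (A *v y) \<bullet> x = 0)" for x
    unfolding orthogonal_comp_def orthogonal_def by simp
  then show ?thesis
    using * by (intro set_eqI) (simp add: orthogonal_matrix_mem_image)
qed

lemma orthogonal_matrix_subspace: "subspace S \<Longrightarrow> subspace ((*v) A ` S)"
  by (simp add: linear_subspace_image)

lemma orthogonal_matrix_dim: "dim ((*v) A ` S) = dim S"
  using orthogonal_matrix_inj by (intro dim_image_eq) (auto simp: inj_on_def)

lemma orthogonal_matrix_infdist: "infdist x ((*v) A ` S) = infdist (transpose A *v x) S"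
proof -
  have "dist x (A *v y) = dist (transpose A *v x) y" for y
    by (metis orthogonal_matrix_dist orthogonal_matrix_mult_transpose)
  then show ?thesis by (simp add: infdist_def image_image)
qed

end

lemma image_matrix_mul: "(*v) (A ** B) ` S = (*v) A ` ((*v) B ` S)" for A B :: "real^'n::finite^'n"
  by (simp add: image_image matrix_vector_mul_assoc)

text \<open>
  The subgroup O(X) \<times> O(X^\<bottom>) for the coordinate subspace X of the index set: a rotation that
  preserves X also preserves its complement. For the full index set it is O(n).
\<close>

definition rot_stab :: "'n set \<Rightarrow> (real^'n::finite^'n) set" where
  "rot_stab I = {A. orthogonal_matrix A \<and> (*v) A ` coord_space I = coord_space I}"

lemma rot_stab_orthogonal: "A \<in> rot_stab I \<Longrightarrow> orthogonal_matrix A"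
  by (simp add: rot_stab_def)

lemma rot_stab_UNIV: "rot_stab UNIV = {A. orthogonal_matrix A}"
  using orthogonal_matrix_surj by (auto simp: rot_stab_def)

lemma rot_stab_mult: "A \<in> rot_stab I \<Longrightarrow> B \<in> rot_stab I \<Longrightarrow> A ** B \<in> rot_stab I"
  by (simp add: rot_stab_def orthogonal_matrix_mul image_matrix_mul)

lemma rot_stab_id: "mat 1 \<in> rot_stab I"
  by (simp add: rot_stab_def orthogonal_matrix_id)

lemma rot_stab_transpose: "A \<in> rot_stab I \<Longrightarrow> transpose A \<in> rot_stab I"
  unfolding rot_stab_def mem_Collect_eq
  by (metis image_matrix_mul orthogonal_matrix orthogonal_matrix_transpose image_ident matrix_vector_mul_lid image_cong)

lemma rot_stab_compl: "rot_stab (- I) = rot_stab I"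
proof -
  have "rot_stab I \<subseteq> rot_stab (- I)" for I :: "'a set"
  proof
    fix A assume "A \<in> rot_stab I"
    then have A: "orthogonal_matrix A" "(*v) A ` coord_space I = coord_space I"
      by (auto simp: rot_stab_def)
    show "A \<in> rot_stab (- I)"
      using A orthogonal_matrix_orthogonal_comp[OF A(1), of "coord_space I"]
      by (simp add: rot_stab_def coord_space_orthogonal_comp)
  qed
  from this[of I] this[of "-I"] show ?thesis by auto
qed

lemma rot_stab_mem: "A \<in> rot_stab I \<Longrightarrow> A *v x \<in> coord_space I \<longleftrightarrow> x \<in> coord_space I"
  unfolding rot_stab_def
  by (metis (mono_tags, lifting) imageI mem_Collect_eq orthogonal_matrix_mem_image orthogonal_matrix_transpose_mult)

lemma rot_stab_proj:
  assumes "A \<in> rot_stab I" shows "coord_proj I (A *v x) = A *v coord_proj I x"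
proof -
  have 1: "A *v coord_proj I x \<in> coord_space I"
    using assms by (simp add: rot_stab_mem)
  have 2: "A *v coord_proj (- I) x \<in> coord_space (- I)"
    using assms by (subst rot_stab_mem) (simp_all add: rot_stab_compl)
  have "A *v x = A *v coord_proj I x + A *v coord_proj (- I) x"
    by (simp add: coord_proj_compl[symmetric] flip: matrix_vector_right_distrib)
  then have "coord_proj I (A *v x) = coord_proj I (A *v coord_proj I x) + coord_proj I (A *v coord_proj (- I) x)"
    by (simp add: coord_proj_add)
  also have "coord_proj I (A *v coord_proj (- I) x) = 0"
    using 2 by (auto simp: coord_space_def vec_eq_iff)
  finally show ?thesis using coord_proj_ident[OF 1] by simp
qed

text \<open>
  Complete the family to an orthonormal basis of the coordinate subspace over K and keep the
  remaining basis vectors; the matrix with these columns fixes the complement pointwise.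
\<close>

lemma extend_orthonormal_family:
  fixes g :: "'n::finite \<Rightarrow> real^'n"
  assumes JK: "J \<subseteq> K" and gK: "\<And>j. j \<in> J \<Longrightarrow> g j \<in> coord_space K"
    and g1: "\<And>j. j \<in> J \<Longrightarrow> norm (g j) = 1"
    and g2: "\<And>i j. i \<in> J \<Longrightarrow> j \<in> J \<Longrightarrow> i \<noteq> j \<Longrightarrow> orthogonal (g i) (g j)"
  obtains A where "orthogonal_matrix A" "\<And>j. j \<in> J \<Longrightarrow> A *v axis j 1 = g j"
    "\<And>x. x \<in> coord_space (- K) \<Longrightarrow> A *v x = x"
proof -
  define S where "S = span (g ` J)"
  have SK: "S \<subseteq> coord_space K"
    unfolding S_def using gK by (intro span_minimal) auto
  have gnz: "g j \<noteq> 0" if "j \<in> J" for j using g1[OF that] by auto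
  have ginj: "inj_on g J"
    by (rule inj_onI, rule ccontr) (metis g2 gnz orthogonal_self)
  have "pairwise orthogonal (g ` J)"
    using g2 by (auto simp: pairwise_def)
  then have "independent (g ` J)"
    by (rule pairwise_orthogonal_independent) (use gnz in auto)
  then have dS: "dim S = card J"
    unfolding S_def using dim_span_eq_card_independent card_image[OF ginj] by metis
  define V where "V = {y \<in> coord_space K. \<forall>x\<in>S. orthogonal x y}"
  have dV: "dim V = card (K - J)"
  proof -
    have "dim V + dim S = dim (coord_space K)"
      unfolding V_def by (rule dim_subspace_orthogonal_to_vectors) (auto simp: S_def SK[unfolded S_def])
    then show ?thesis
      using JK dS by (simp add: card_Diff_subset)
  qed
  have sV: "subspace V"
    unfolding V_def subspace_def by (auto simp: coord_space_def orthogonal_def inner_right_distrib)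
  obtain B where B: "B \<subseteq> V" "pairwise orthogonal B" "\<And>x. x \<in> B \<Longrightarrow> norm x = 1"
     "independent B" "card B = dim V"
    using orthonormal_basis_subspace[OF sV] by metis
  have "finite B" using B by (simp add: independent_imp_finite)
  then obtain h where h: "bij_betw h (K - J) B"
    using B dV by (metis bij_betw_iff_card finite)
  define f where "f j = (if j \<in> J then g j else if j \<in> K then h j else axis j 1)" for j
  have hB: "h j \<in> B" if "j \<in> K" "j \<notin> J" for j using h that by (auto simp: bij_betw_def)
  have fK: "f j \<in> coord_space K" if "j \<in> K" for j
    using gK hB[of j] B(1) that by (auto simp: f_def V_def)
  define A where "A = (\<chi> i j. f j $ i)"
  have col: "column j A = f j" for j by (simp add: A_def column_def)
  have axis: "A *v axis j 1 = f j" for j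
    by (metis col matrix_vector_mul_component matrix_vector_mult_basis)
  have orth1: "orthogonal (f i) (f j)" if "i \<noteq> j" "i \<in> K" "j \<in> K" for i j
  proof -
    consider "i \<in> J" "j \<in> J" | "i \<in> J" "j \<notin> J" | "i \<notin> J" "j \<in> J" | "i \<notin> J" "j \<notin> J" by auto
    then show ?thesis
    proof cases
      case 1 then show ?thesis using g2 that by (simp add: f_def)
    next
      case 2
      then have "g i \<in> S" by (simp add: S_def span_base)
      then show ?thesis using 2 hB[of j] B(1) that by (auto simp: f_def V_def)
    next
      case 3
      then have "g j \<in> S" by (simp add: S_def span_base)
      then show ?thesis using 3 hB[of i] B(1) that by (auto simp: f_def V_def orthogonal_commute)
    next
      case 4
      then have "h i \<noteq> h j" using h that by (auto simp: bij_betw_def inj_on_def)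
      then show ?thesis using 4 hB[of i] hB[of j] B(2) that by (auto simp: f_def pairwise_def)
    qed
  qed
  have orth2: "orthogonal (f i) (f j)" if "i \<in> K" "j \<notin> K" for i j
    using fK[OF that(1)] that JK by (auto simp: f_def orthogonal_def inner_axis coord_space_def)
  have orth: "orthogonal (f i) (f j)" if "i \<noteq> j" for i j
  proof (cases "i \<in> K \<or> j \<in> K")
    case True then show ?thesis using orth1[OF that] orth2[of i j] orth2[of j i] by (auto simp: orthogonal_commute)
  next
    case False then show ?thesis
      using that JK by (auto simp: f_def orthogonal_def inner_axis_axis)
  qed
  have "norm (f j) = 1" for j
    using g1 B(3) hB by (auto simp: f_def)
  then have "orthogonal_matrix A"
    using orth by (simp add: orthogonal_matrix_orthonormal_columns col)
  moreover have "A *v axis j 1 = g j" if "j \<in> J" for j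
    using that by (simp add: axis f_def)
  moreover have "A *v x = x" if "x \<in> coord_space (- K)" for x
  proof -
    have "x = (\<Sum>i\<in>UNIV. x $ i *\<^sub>R axis i 1)"
      by (simp add: vec_eq_iff axis_def if_distrib cong: if_cong)
    then have "A *v x = (\<Sum>i\<in>UNIV. x $ i *\<^sub>R (A *v axis i 1))"
      by (metis (no_types, lifting) linear_sum matrix_vector_mul_linear matrix_vector_mult_scaleR sum.cong)
    also have "\<dots> = (\<Sum>i\<in>UNIV. x $ i *\<^sub>R axis i 1)"
      using that JK by (intro sum.cong refl) (auto simp: axis f_def coord_space_def)
    finally show ?thesis using \<open>x = _\<close> by simp
  qed
  ultimately show ?thesis by (rule that)
qed

text \<open>
  Every subspace of a coordinate subspace is a rotated copy of a smaller coordinate subspace, and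
  the rotation can be chosen to fix the complement pointwise, so that rotations for two
  complementary coordinate subspaces do not interfere.
\<close>

lemma coord_space_moved_to_subspace:
  assumes JK: "J \<subseteq> (K :: 'n::finite set)" and S: "subspace S" "S \<subseteq> coord_space K" "dim S = card J"
  obtains A where "orthogonal_matrix A" "(*v) A ` coord_space J = S"
    "\<And>x. x \<in> coord_space (- K) \<Longrightarrow> A *v x = x"
proof -
  obtain B where B: "B \<subseteq> S" "pairwise orthogonal B" "\<And>x. x \<in> B \<Longrightarrow> norm x = 1"
     "independent B" "card B = dim S" "span B = S"
    using orthonormal_basis_subspace[OF S(1)] by metis
  have "finite B" using B by (simp add: independent_imp_finite)
  then obtain g where g: "bij_betw g J B"
    using B S(3) by (metis bij_betw_iff_card finite)
  have gB: "g j \<in> B" if "j \<in> J" for j using g that by (auto simp: bij_betw_def)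
  obtain A where A: "orthogonal_matrix A" "\<And>j. j \<in> J \<Longrightarrow> A *v axis j 1 = g j"
    "\<And>x. x \<in> coord_space (- K) \<Longrightarrow> A *v x = x"
  proof (rule extend_orthonormal_family[OF JK, of g])
    show "g j \<in> coord_space K" if "j \<in> J" for j using gB[OF that] B(1) S(2) by auto
    show "norm (g j) = 1" if "j \<in> J" for j using gB[OF that] B(3) by auto
    show "orthogonal (g i) (g j)" if "i \<in> J" "j \<in> J" "i \<noteq> j" for i j
      using gB[OF that(1)] gB[OF that(2)] B(2) g that by (auto simp: pairwise_def bij_betw_def inj_on_def)
  qed blast
  have "(*v) A ` coord_space J = span ((*v) A ` (\<lambda>i. axis i 1) ` J)"
    by (simp add: span_axis_eq_coord_space[symmetric] linear_span_image)
  also have "(*v) A ` (\<lambda>i. axis i 1) ` J = B"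
    using A(2) g by (simp add: image_image bij_betw_def cong: image_cong)
  finally show ?thesis using A B(6) that by simp
qed

lemma rot_stab_transitive_on_spheres:
  fixes x y :: "real^'n::finite"
  assumes "x \<in> coord_space I" "y \<in> coord_space I" "norm x = norm y"
  obtains A where "A \<in> rot_stab I" "A *v x = y"
proof (cases "x = 0")
  case True
  then show ?thesis using assms that[of "mat 1"] by (simp add: rot_stab_id)
next
  case False
  then obtain i where i: "i \<in> I" "x $ i \<noteq> 0"
    using assms by (auto simp: coord_space_def vec_eq_iff)
  have *: "\<exists>A\<in>rot_stab I. A *v axis i 1 = z /\<^sub>R norm z" if "z \<in> coord_space I" "z \<noteq> 0" for z :: "real^'n"
  proof -
    have z: "z /\<^sub>R norm z \<in> coord_space I" "norm (z /\<^sub>R norm z) = 1"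
      using that by (simp_all add: subspace_scale)
    obtain A where A: "orthogonal_matrix A" "A *v axis i 1 = z /\<^sub>R norm z"
      "\<And>x. x \<in> coord_space (- I) \<Longrightarrow> A *v x = x"
      using extend_orthonormal_family[of "{i}" I "\<lambda>_. z /\<^sub>R norm z"] i(1) z by auto
    then have "A \<in> rot_stab (- I)"
      by (auto simp: rot_stab_def cong: image_cong)
    then show ?thesis using A by (auto simp: rot_stab_compl)
  qed
  have "y \<noteq> 0" using False assms by auto
  from *[OF assms(1) False] *[OF assms(2) this] obtain A B where
    AB: "A \<in> rot_stab I" "A *v axis i 1 = x /\<^sub>R norm x" "B \<in> rot_stab I" "B *v axis i 1 = y /\<^sub>R norm y"
    by blast
  show ?thesis
  proof (rule that[of "B ** transpose A"])
    show "B ** transpose A \<in> rot_stab I"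
      using AB by (simp add: rot_stab_mult rot_stab_transpose)
    have "transpose A *v (x /\<^sub>R norm x) = axis i 1"
      using AB by (metis orthogonal_matrix_transpose_mult rot_stab_orthogonal)
    then have "(B ** transpose A) *v (x /\<^sub>R norm x) = y /\<^sub>R norm y"
      using AB by (simp flip: matrix_vector_mul_assoc)
    then have "(B ** transpose A) *v x /\<^sub>R norm x = y /\<^sub>R norm y"
      by (simp add: matrix_vector_mult_scaleR)
    then show "(B ** transpose A) *v x = y"
      using assms False \<open>y \<noteq> 0\<close> by simp
  qed
qed

section \<open>Lebesgue measure on coordinate subspaces\<close>

lemma measurable_matrix_vector_mult [measurable (raw)]:
  assumes [measurable]: "f \<in> borel_measurable M" "g \<in> borel_measurable M"
  shows "(\<lambda>x. (f x :: real^'n::finite^'m::finite) *v g x) \<in> borel_measurable M"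
proof -
  have "continuous_on UNIV (\<lambda>p. (fst p :: real^'n^'m) *v snd p)"
    unfolding matrix_vector_mult_def by (intro continuous_intros)
  then have "(\<lambda>p. (fst p :: real^'n^'m) *v snd p) \<in> borel_measurable borel"
    by (rule borel_measurable_continuous_onI)
  then have "(\<lambda>x. (\<lambda>p. (fst p :: real^'n^'m) *v snd p) (f x, g x)) \<in> borel_measurable M"
    by (rule measurable_compose[rotated]) (simp add: borel_prod[symmetric])
  then show ?thesis by simp
qed

lemma measurable_matrix_apply [measurable, simp]: "(*v) A \<in> borel_measurable borel"
  for A :: "real^'n::finite^'m::finite"
  by measurable

lemma measurable_matrix_mult [measurable (raw)]:
  fixes f :: "'b \<Rightarrow> real^'n::finite^'n" and g :: "'b \<Rightarrow> real^'n^'n"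
  assumes [measurable]: "f \<in> borel_measurable M" "g \<in> borel_measurable M"
  shows "(\<lambda>x. f x ** g x) \<in> borel_measurable M"
proof -
  have "continuous_on UNIV (\<lambda>p. (fst p :: real^'n^'n) ** (snd p :: real^'n^'n))"
    unfolding matrix_matrix_mult_def by (intro continuous_intros)
  then have "(\<lambda>p. (fst p :: real^'n^'n) ** (snd p :: real^'n^'n)) \<in> borel_measurable borel"
    by (rule borel_measurable_continuous_onI)
  then have "(\<lambda>x. (\<lambda>p. (fst p :: real^'n^'n) ** (snd p :: real^'n^'n)) (f x, g x)) \<in> borel_measurable M"
    by (rule measurable_compose[rotated]) (simp add: borel_prod[symmetric])
  then show ?thesis by simp
qed

lemma measurable_transpose [measurable (raw)]:
  fixes f :: "'b \<Rightarrow> real^'n::finite^'n"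
  assumes "f \<in> borel_measurable M"
  shows "(\<lambda>x. transpose (f x)) \<in> borel_measurable M"
proof -
  have "continuous_on UNIV (\<lambda>A::real^'n^'n. transpose A)"
    unfolding transpose_def by (intro continuous_intros)
  then show ?thesis by (rule measurable_compose[OF assms borel_measurable_continuous_onI])
qed

lemma measurable_coord_proj [measurable (raw)]:
  assumes [measurable]: "f \<in> borel_measurable M"
  shows "(\<lambda>x. coord_proj I (f x :: real^'n::finite)) \<in> borel_measurable M"
  by (rule measurable_compose[OF assms borel_measurable_continuous_onI])
     (simp add: linear_continuous_on linear_conv_bounded_linear[symmetric] linear_coord_proj)

lemma measurable_indicator_compose [measurable (raw)]:
  assumes "f \<in> M \<rightarrow>\<^sub>M N" "S \<in> sets N"
  shows "(\<lambda>x. indicator S (f x) :: ennreal) \<in> borel_measurable M"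
  by (rule measurable_compose[OF assms(1) borel_measurable_indicator[OF assms(2)]])

text \<open>
  The measure is carried by a coordinate subspace but lives on the ambient space, so that the
  measures for different index sets can be convolved and rotated.
\<close>

definition coord_lebesgue :: "'n set \<Rightarrow> (real^'n::finite) measure" where
  "coord_lebesgue I = distr (\<Pi>\<^sub>M i\<in>I. lborel) borel (\<lambda>c. \<Sum>i\<in>I. c i *\<^sub>R axis i 1)"

lemma sets_coord_lebesgue [simp, measurable_cong]: "sets (coord_lebesgue I) = sets borel"
  and space_coord_lebesgue [simp]: "space (coord_lebesgue I) = UNIV"
  by (simp_all add: coord_lebesgue_def)

lemma measurable_coord_lebesgue [simp]: "measurable (coord_lebesgue I) N = measurable borel N"
  by (rule measurable_cong_sets) simp_all

lemma sum_axis_nth: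
  fixes I :: "'n::finite set"
  shows "(\<Sum>i\<in>I. c i *\<^sub>R axis i (1::real)) $ j = (if j \<in> I then c j else 0)"
  and sum_axis_nth': "(\<Sum>i\<in>I. c i * axis i (1::real) $ j) = (if j \<in> I then c j else 0)"
  by (simp_all add: axis_def if_distrib cong: if_cong)

interpretation lborel_PiM: product_sigma_finite "\<lambda>_. lborel :: real measure" ..

lemma AE_coord_lebesgue: "AE x in coord_lebesgue I. x \<in> coord_space I"
proof -
  have "closed (coord_space I)" by (rule closed_subspace) simp
  then have "{x \<in> space borel. x \<in> coord_space I} \<in> sets borel" by simp
  then show ?thesis
    unfolding coord_lebesgue_def
    by (subst AE_distr_iff) (auto simp: coord_space_def axis_def if_distrib cong: if_cong)
qed

lemma emeasure_coord_lebesgue_box: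
  assumes S: "S \<in> sets borel"
  shows "emeasure (coord_lebesgue (I::'n::finite set)) {x. \<forall>i\<in>I. x $ i \<in> S} = emeasure lborel S ^ card I"
proof -
  have [measurable]: "S \<in> sets borel" by fact
  have m: "{x::real^'n. \<forall>i\<in>I. x $ i \<in> S} \<in> sets borel"
  proof -
    have "{x \<in> space borel. \<forall>i\<in>I. x $ i \<in> S} \<in> sets (borel :: (real^'n) measure)"
      by measurable
    then show ?thesis by simp
  qed
  have "emeasure (coord_lebesgue I) {x. \<forall>i\<in>I. x $ i \<in> S} = emeasure (\<Pi>\<^sub>M i\<in>I. lborel) (\<Pi>\<^sub>E i\<in>I. S)"
    unfolding coord_lebesgue_def
    by (subst emeasure_distr[OF _ m], simp) 
       (auto simp: space_PiM sum_axis_nth' PiE_def Pi_def intro!: arg_cong2[where f=emeasure])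
  also have "\<dots> = (\<Prod>i\<in>I. emeasure lborel S)"
    by (rule lborel_PiM.emeasure_PiM) (auto simp: S)
  finally show ?thesis by simp
qed

text \<open>
  A ball lies between two cubes. These crude bounds replace the exact volume of balls throughout:
  only the order of growth in the radius matters.
\<close>

lemma emeasure_coord_lebesgue_cball_le:
  assumes "t \<ge> 0"
  shows "emeasure (coord_lebesgue I) (cball 0 t) \<le> ennreal ((2 * t) ^ card (I::'n::finite set))"
proof -
  have "emeasure (coord_lebesgue I) (cball 0 t) \<le> emeasure (coord_lebesgue I) {x. \<forall>i\<in>I. x $ i \<in> {-t..t}}"
  proof (rule emeasure_mono)
    show "cball 0 t \<subseteq> {x::real^'n. \<forall>i\<in>I. x $ i \<in> {-t..t}}"
    proof safe
      fix x :: "real^'n" and i assume "x \<in> cball 0 t"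
      then show "x $ i \<in> {-t..t}" using component_le_norm_cart[of x i] by auto
    qed
    have "{x \<in> space borel. \<forall>i\<in>I. x $ i \<in> {-t..t}} \<in> sets (borel :: (real^'n) measure)"
      by measurable
    then show "{x. \<forall>i\<in>I. x $ i \<in> {-t..t}} \<in> sets (coord_lebesgue I)" by simp
  qed
  also have "\<dots> = ennreal ((2 * t) ^ card I)"
    using assms by (subst emeasure_coord_lebesgue_box) (simp_all add: ennreal_power)
  finally show ?thesis .
qed

lemma emeasure_coord_lebesgue_cball_ge:
  assumes "t \<ge> 0"
  shows "emeasure (coord_lebesgue I) (cball 0 t) \<ge> ennreal ((t / CARD('n)) ^ card (I::'n::finite set))"
proof -
  have "ennreal ((t / CARD('n)) ^ card I) = emeasure (coord_lebesgue I) {x. \<forall>i\<in>I. x $ i \<in> {0..t / CARD('n)}}"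
    using assms by (subst emeasure_coord_lebesgue_box) (simp_all add: ennreal_power)
  also have "\<dots> \<le> emeasure (coord_lebesgue I) (cball 0 t)"
  proof (rule emeasure_mono_AE)
    show "AE x in coord_lebesgue I. x \<in> {x. \<forall>i\<in>I. x $ i \<in> {0..t / CARD('n)}} \<longrightarrow> x \<in> cball 0 t"
      using AE_coord_lebesgue[of I]
    proof eventually_elim
      case (elim x)
      show ?case
      proof
        assume x: "x \<in> {x. \<forall>i\<in>I. x $ i \<in> {0..t / CARD('n)}}"
        have "norm x \<le> (\<Sum>i\<in>UNIV. \<bar>x $ i\<bar>)" by (rule norm_le_l1_cart)
        also have "\<dots> \<le> (\<Sum>i\<in>(UNIV::'n set). t / CARD('n))"
        proof (rule sum_mono)
          fix i show "\<bar>x $ i\<bar> \<le> t / CARD('n)"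
            using x elim assms by (cases "i \<in> I") (auto simp: coord_space_def)
        qed
        finally show "x \<in> cball 0 t" by simp
      qed
    qed
  qed simp
  finally show ?thesis .
qed

lemma emeasure_coord_lebesgue_cball_pos_finite:
  assumes "t > 0"
  shows "emeasure (coord_lebesgue (I::'n::finite set)) (cball 0 t) > 0" "emeasure (coord_lebesgue I) (cball 0 t) < \<infinity>"
proof -
  have "ennreal ((t / CARD('n)) ^ card I) > 0" using assms by simp
  then show "emeasure (coord_lebesgue I) (cball 0 t) > 0"
    using emeasure_coord_lebesgue_cball_ge[of t I] assms by (metis less_le_trans less_imp_le)
  show "emeasure (coord_lebesgue I) (cball 0 t) < \<infinity>"
    using emeasure_coord_lebesgue_cball_le[of t I] assms 
    by (metis ennreal_less_top infinity_ennreal_def le_less_trans less_imp_le)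
qed

interpretation coord_lebesgue: sigma_finite_measure "coord_lebesgue (I::'n::finite set)" for I
proof
  show "\<exists>A. countable A \<and> A \<subseteq> sets (coord_lebesgue I) \<and> \<Union> A = space (coord_lebesgue I) \<and>
        (\<forall>a\<in>A. emeasure (coord_lebesgue I) a \<noteq> \<infinity>)"
  proof (intro exI conjI ballI)
    show "countable (range (\<lambda>m::nat. cball (0::real^'n) (real (Suc m))))" by simp
    show "range (\<lambda>m::nat. cball (0::real^'n) (real (Suc m))) \<subseteq> sets (coord_lebesgue I)" by auto
    show "\<Union> (range (\<lambda>m::nat. cball (0::real^'n) (real (Suc m)))) = space (coord_lebesgue I)"
    proof safe
      fix x :: "real^'n"
      obtain m :: nat where "norm x \<le> real m" using real_arch_simple by blast
      then show "x \<in> (\<Union>m::nat. cball 0 (real (Suc m)))" by (intro UN_I[of m]) auto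
    qed simp
  next
    fix a assume "a \<in> range (\<lambda>m::nat. cball (0::real^'n) (real (Suc m)))"
    then show "emeasure (coord_lebesgue I) a \<noteq> \<infinity>"
      using emeasure_coord_lebesgue_cball_pos_finite(2)[of _ I] by (auto simp: less_top[symmetric] simp del: of_nat_Suc)
  qed
qed

lemma nn_integral_coord_lebesgue_Un:
  fixes I J :: "'n::finite set"
  assumes [measurable]: "f \<in> borel_measurable borel" and IJ: "I \<inter> J = {}"
  shows "(\<integral>\<^sup>+x. f x \<partial>coord_lebesgue (I \<union> J)) =
     (\<integral>\<^sup>+x. (\<integral>\<^sup>+y. f (x + y) \<partial>coord_lebesgue J) \<partial>coord_lebesgue I)"
proof -
  let ?s = "\<lambda>I c. \<Sum>i\<in>I. c i *\<^sub>R axis i (1::real) :: real^'n"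
  have s: "?s (I \<union> J) (merge I J (x, y)) = ?s I x + ?s J y" for x y
    using IJ by (subst sum.union_disjoint) (auto simp: merge_def intro!: arg_cong2[where f=plus] sum.cong)
  have "(\<integral>\<^sup>+x. f x \<partial>coord_lebesgue (I \<union> J)) = (\<integral>\<^sup>+c. f (?s (I \<union> J) c) \<partial>(\<Pi>\<^sub>M i\<in>I \<union> J. lborel))"
    unfolding coord_lebesgue_def by (subst nn_integral_distr) simp_all
  also have "\<dots> = (\<integral>\<^sup>+x. (\<integral>\<^sup>+y. f (?s I x + ?s J y) \<partial>(\<Pi>\<^sub>M i\<in>J. lborel)) \<partial>(\<Pi>\<^sub>M i\<in>I. lborel))"
    using IJ by (subst lborel_PiM.product_nn_integral_fold) (auto simp: s)
  also have "\<dots> = (\<integral>\<^sup>+x. (\<integral>\<^sup>+y. f (?s I x + y) \<partial>coord_lebesgue J) \<partial>(\<Pi>\<^sub>M i\<in>I. lborel))"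
    unfolding coord_lebesgue_def by (subst nn_integral_distr) simp_all
  also have "\<dots> = (\<integral>\<^sup>+x. (\<integral>\<^sup>+y. f (x + y) \<partial>coord_lebesgue J) \<partial>coord_lebesgue I)"
    unfolding coord_lebesgue_def[of I] by (subst nn_integral_distr) simp_all
  finally show ?thesis .
qed

lemma coord_lebesgue_UNIV: "coord_lebesgue (UNIV::'n::finite set) = lborel"
proof (rule lborel_eqI[symmetric])
  fix l u :: "real^'n" assume lu: "\<And>b. b \<in> Basis \<Longrightarrow> l \<bullet> b \<le> u \<bullet> b"
  have lu': "l $ i \<le> u $ i" for i using lu[of "axis i 1"] by (simp add: inner_axis axis_in_Basis_iff)
  have "emeasure (coord_lebesgue (UNIV::'n set)) (box l u) =
        emeasure (\<Pi>\<^sub>M i\<in>(UNIV::'n set). lborel) (\<Pi>\<^sub>E i\<in>UNIV. {l $ i <..< u $ i})"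
    unfolding coord_lebesgue_def
    by (subst emeasure_distr, simp, simp) 
       (auto simp: space_PiM sum_axis_nth' PiE_def Pi_def mem_box_cart intro!: arg_cong2[where f=emeasure])
  also have "\<dots> = (\<Prod>i\<in>(UNIV::'n set). emeasure lborel {l $ i <..< u $ i})"
    by (rule lborel_PiM.emeasure_PiM) auto
  also have "\<dots> = ennreal (\<Prod>i\<in>(UNIV::'n set). u $ i - l $ i)"
    using lu' by (simp add: prod_ennreal)
  also have "(\<Prod>i\<in>(UNIV::'n set). u $ i - l $ i) = (\<Prod>b\<in>Basis. (u - l) \<bullet> b)"
  proof -
    have "(\<Prod>b\<in>(\<lambda>i::'n. axis i (1::real)) ` UNIV. (u - l) \<bullet> b) = (\<Prod>i\<in>UNIV. (u - l) \<bullet> axis i 1)"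
      by (rule prod.reindex_cong[where l="\<lambda>i. axis i 1"]) (auto simp: inj_on_def axis_eq_axis)
    moreover have "Basis = (\<lambda>i::'n. axis i (1::real)) ` UNIV" by (auto simp: Basis_vec_def)
    ultimately show ?thesis by (simp add: inner_axis)
  qed
  finally show "emeasure (coord_lebesgue (UNIV::'n set)) (box l u) = ennreal (\<Prod>b\<in>Basis. (u - l) \<bullet> b)" .
qed simp

lemma nn_integral_lborel_translate:
  fixes c :: "'a::euclidean_space"
  assumes [measurable]: "f \<in> borel_measurable borel"
  shows "(\<integral>\<^sup>+x. f (c + x) \<partial>lborel) = (\<integral>\<^sup>+x. f x \<partial>lborel)"
  by (subst (2) lborel_distr_plus[of c, symmetric], subst nn_integral_distr) simp_all

lemma emeasure_ball_pos_finite: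
  "emeasure lborel (ball (0::real^'n::finite) 1) \<noteq> 0" "emeasure lborel (ball (0::real^'n) 1) \<noteq> \<infinity>"
proof -
  have "\<not> negligible (ball (0::real^'n) 1)" by (rule open_not_negligible) auto
  then show "emeasure lborel (ball (0::real^'n) 1) \<noteq> 0"
    by (simp add: negligible_iff_null_sets null_sets_completion_iff null_sets_def)
  show "emeasure lborel (ball (0::real^'n) 1) \<noteq> \<infinity>" using emeasure_bounded_finite[of "ball (0::real^'n) 1"] by simp
qed

text \<open>
  The image of Lebesgue measure is again translation invariant, and two translation invariant
  measures agree once they agree on one symmetric set of positive finite measure, here the unit
  ball: integrate the product of the indicators of the ball and of B and substitute y \<mapsto> x + y in
  both orders of integration.
\<close>

lemma lborel_rotation_invariant:
  fixes A :: "real^'n::finite^'n"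
  assumes A: "orthogonal_matrix A"
  shows "distr lborel borel ((*v) A) = lborel"
proof (rule measure_eqI)
  fix B assume "B \<in> sets (distr lborel borel ((*v) A))"
  then have [measurable]: "B \<in> sets borel" by simp
  let ?D = "ball (0::real^'n) 1"
  let ?b = "emeasure lborel ?D"
  note b = emeasure_ball_pos_finite[where ?'n = 'n]
  \<comment> \<open>the image measure is translation invariant\<close>
  have shift: "(\<integral>\<^sup>+z. g (A *v z) \<partial>lborel) = (\<integral>\<^sup>+z. g (x + A *v z) \<partial>lborel)"
    if [measurable]: "g \<in> borel_measurable borel" for g :: "real^'n \<Rightarrow> ennreal" and x
    using nn_integral_lborel_translate[of "\<lambda>z. g (A *v z)" "transpose A *v x", symmetric]
    by (simp add: matrix_vector_right_distrib orthogonal_matrix_mult_transpose[OF A])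
  have "?b * emeasure (distr lborel borel ((*v) A)) B =
        ?b * (\<integral>\<^sup>+z. indicator B (A *v z) \<partial>lborel)"
    by (subst nn_integral_indicator[symmetric], simp, subst nn_integral_distr) simp_all
  also have "\<dots> = (\<integral>\<^sup>+x. indicator ?D x * (\<integral>\<^sup>+z. indicator B (A *v z) \<partial>lborel) \<partial>lborel)"
    by (subst nn_integral_multc) simp_all
  also have "\<dots> = (\<integral>\<^sup>+x. indicator ?D x * (\<integral>\<^sup>+z. indicator B (x + A *v z) \<partial>lborel) \<partial>lborel)"
  proof (rule nn_integral_cong)
    fix x
    show "indicator ?D x * (\<integral>\<^sup>+z. indicator B (A *v z) \<partial>lborel) = indicator ?D x * (\<integral>\<^sup>+z. indicator B (x + A *v z) \<partial>lborel)"
      by (subst shift[of "indicator B" x]) simp_all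
  qed
  also have "\<dots> = (\<integral>\<^sup>+x. (\<integral>\<^sup>+z. indicator ?D x * indicator B (x + A *v z) \<partial>lborel) \<partial>lborel)"
    by (simp add: nn_integral_cmult)
  also have "\<dots> = (\<integral>\<^sup>+z. (\<integral>\<^sup>+x. indicator ?D x * indicator B (x + A *v z) \<partial>lborel) \<partial>lborel)"
    by (rule lborel_pair.Fubini') measurable
  also have "\<dots> = (\<integral>\<^sup>+z. (\<integral>\<^sup>+x. indicator ?D (x - A *v z) * indicator B x \<partial>lborel) \<partial>lborel)"
  proof (rule nn_integral_cong)
    fix z
    show "(\<integral>\<^sup>+x. indicator ?D x * indicator B (x + A *v z) \<partial>lborel) = (\<integral>\<^sup>+x. indicator ?D (x - A *v z) * indicator B x \<partial>lborel)"
      using nn_integral_lborel_translate[of "\<lambda>x. indicator ?D (x - A *v z) * indicator B x" "A *v z"]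
      by (simp add: add.commute[of "A *v z"])
  qed
  also have "\<dots> = (\<integral>\<^sup>+x. (\<integral>\<^sup>+z. indicator ?D (x - A *v z) * indicator B x \<partial>lborel) \<partial>lborel)"
    by (rule lborel_pair.Fubini') measurable
  also have "\<dots> = (\<integral>\<^sup>+x. (\<integral>\<^sup>+z. indicator ?D (x - A *v z) \<partial>lborel) * indicator B x \<partial>lborel)"
    by (intro nn_integral_cong nn_integral_multc) measurable
  also have "\<dots> = (\<integral>\<^sup>+x. ?b * indicator B x \<partial>lborel)"
  proof (rule nn_integral_cong)
    fix x
    have "(\<integral>\<^sup>+z. indicator ?D (x - A *v z) \<partial>lborel) = (\<integral>\<^sup>+z. indicator ?D (x - (x + A *v z)) \<partial>lborel)"
      using shift[of "\<lambda>y. indicator ?D (x - y)" x] by simp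
    also have "\<dots> = (\<integral>\<^sup>+z. indicator ?D z \<partial>lborel)"
      by (rule nn_integral_cong) (simp add: indicator_def orthogonal_matrix_norm[OF A])
    finally show "(\<integral>\<^sup>+z. indicator ?D (x - A *v z) \<partial>lborel) * indicator B x = ?b * indicator B x"
      by simp
  qed
  also have "\<dots> = ?b * emeasure lborel B" by (simp add: nn_integral_cmult)
  finally show "emeasure (distr lborel borel ((*v) A)) B = emeasure lborel B"
    using b by (simp add: ennreal_mult_cancel_left)
qed simp

text \<open>
  Integrating over the neighbourhood of radius 1 of a subspace expresses Lebesgue measure on the
  subspace through Lebesgue measure on the whole space and the orthogonal projection alone. This
  is how rotation invariance, independence of the basis, and measurability in the subspace are
  obtained.
\<close>

lemma coord_lebesgue_as_slab:
  fixes I :: "'n::finite set"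
  assumes [measurable]: "h \<in> borel_measurable borel"
  shows "(\<integral>\<^sup>+x. h (coord_proj I x) * indicator (cball 0 1) (coord_proj (- I) x) \<partial>lborel) =
    (\<integral>\<^sup>+x. h x \<partial>coord_lebesgue I) * emeasure (coord_lebesgue (- I)) (cball 0 1)"
proof -
  have "(\<integral>\<^sup>+x. h (coord_proj I x) * indicator (cball 0 1) (coord_proj (- I) x) \<partial>lborel) =
     (\<integral>\<^sup>+x. (\<integral>\<^sup>+y. h (coord_proj I (x + y)) * indicator (cball 0 1) (coord_proj (- I) (x + y)) 
        \<partial>coord_lebesgue (- I)) \<partial>coord_lebesgue I)"
    by (subst coord_lebesgue_UNIV[symmetric], subst nn_integral_coord_lebesgue_Un[symmetric]) (simp_all add: measurable_ident_sets)
  also have "\<dots> = (\<integral>\<^sup>+x. (\<integral>\<^sup>+y. h x * indicator (cball 0 1) y 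
        \<partial>coord_lebesgue (- I)) \<partial>coord_lebesgue I)"
  proof (rule nn_integral_cong_AE)
    show "AE x in coord_lebesgue I. (\<integral>\<^sup>+y. h (coord_proj I (x + y)) * indicator (cball 0 1) (coord_proj (- I) (x + y)) \<partial>coord_lebesgue (- I)) =
      (\<integral>\<^sup>+y. h x * indicator (cball 0 1) y \<partial>coord_lebesgue (- I))"
      using AE_coord_lebesgue[of I]
    proof eventually_elim
      case (elim x)
      show ?case
      proof (rule nn_integral_cong_AE)
        show "AE y in coord_lebesgue (- I). h (coord_proj I (x + y)) * indicator (cball 0 1) (coord_proj (- I) (x + y)) =
              h x * indicator (cball 0 1) y"
          using AE_coord_lebesgue[of "- I"]
        proof eventually_elim
          case (elim y)
          have "coord_proj I (x + y) = x" "coord_proj (- I) (x + y) = y"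
            using elim \<open>x \<in> coord_space I\<close> by (auto simp: vec_eq_iff coord_space_def)
          then show ?case by simp
        qed
      qed
    qed
  qed
  also have "\<dots> = (\<integral>\<^sup>+x. h x \<partial>coord_lebesgue I) * emeasure (coord_lebesgue (- I)) (cball 0 1)"
    by (subst nn_integral_cmult) (simp_all add: nn_integral_multc)
  finally show ?thesis .
qed

lemma coord_lebesgue_rotation_invariant:
  assumes A: "A \<in> rot_stab (I::'n::finite set)"
  shows "distr (coord_lebesgue I) borel ((*v) A) = coord_lebesgue I"
proof (rule measure_eqI)
  fix U assume "U \<in> sets (distr (coord_lebesgue I) borel ((*v) A))"
  then have [measurable]: "U \<in> sets borel" by simp
  define v where "v = emeasure (coord_lebesgue (- I)) (cball 0 1)"
  have v: "v \<noteq> 0" "v \<noteq> \<infinity>"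
    using emeasure_coord_lebesgue_cball_pos_finite[of 1 "- I"] by (auto simp: v_def)
  note orth = rot_stab_orthogonal[OF A]
  have "(\<integral>\<^sup>+x. indicator U (A *v x) \<partial>coord_lebesgue I) * v =
        (\<integral>\<^sup>+x. indicator U (A *v coord_proj I x) * indicator (cball 0 1) (coord_proj (- I) x) \<partial>lborel)"
    unfolding v_def by (subst coord_lebesgue_as_slab[symmetric]) simp_all
  also have "\<dots> = (\<integral>\<^sup>+x. indicator U (coord_proj I (A *v x)) * indicator (cball 0 1) (coord_proj (- I) (A *v x)) \<partial>lborel)"
  proof -
    have "indicator (cball 0 1) (coord_proj (- I) (A *v x)) = (indicator (cball 0 1) (coord_proj (- I) x) :: ennreal)" for x
      using A by (subst rot_stab_proj) (auto simp: rot_stab_compl orthogonal_matrix_norm[OF orth] indicator_def)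
    then show ?thesis by (simp add: rot_stab_proj[OF A])
  qed
  also have "\<dots> = (\<integral>\<^sup>+x. indicator U (coord_proj I x) * indicator (cball 0 1) (coord_proj (- I) x) \<partial>distr lborel borel ((*v) A))"
    by (subst nn_integral_distr) simp_all
  also have "\<dots> = (\<integral>\<^sup>+x. indicator U x \<partial>coord_lebesgue I) * v"
    by (simp add: lborel_rotation_invariant[OF orth] coord_lebesgue_as_slab v_def)
  finally have "(\<integral>\<^sup>+x. indicator U (A *v x) \<partial>coord_lebesgue I) * v = (\<integral>\<^sup>+x. indicator U x \<partial>coord_lebesgue I) * v" .
  then have "(\<integral>\<^sup>+x. indicator U (A *v x) \<partial>coord_lebesgue I) = (\<integral>\<^sup>+x. indicator U x \<partial>coord_lebesgue I)"
    using v by (metis ennreal_mult_cancel_left mult.commute infinity_ennreal_def)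
  moreover have "emeasure (distr (coord_lebesgue I) borel ((*v) A)) U = (\<integral>\<^sup>+x. indicator U (A *v x) \<partial>coord_lebesgue I)"
    by (subst nn_integral_indicator[symmetric], simp, subst nn_integral_distr) simp_all
  ultimately show "emeasure (distr (coord_lebesgue I) borel ((*v) A)) U = emeasure (coord_lebesgue I) U" by simp
qed simp

text \<open>
  The orthonormal basis chosen in the definition of the left-hand side is the image of the
  coordinate basis under some rotation C with the same image subspace as A; then A^(-1)C preserves
  the coordinate subspace and leaves its Lebesgue measure invariant.
\<close>

lemma lborel_on_rotated_coord_space:
  fixes A :: "real^'n::finite^'n"
  assumes A: "orthogonal_matrix A"
  shows "lborel_on ((*v) A ` coord_space I) = distr (coord_lebesgue I) borel ((*v) A)"
proof -
  define X where "X = (*v) A ` coord_space I"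
  have sX: "subspace X" unfolding X_def by (rule orthogonal_matrix_subspace[OF A]) simp
  define B where "B = (SOME B. pairwise orthogonal B \<and> (\<forall>b\<in>B. norm b = 1) \<and> span B = X)"
  have "\<exists>B. pairwise orthogonal B \<and> (\<forall>b\<in>B. norm b = 1) \<and> span B = X"
    using orthonormal_basis_subspace[OF sX] by metis
  from someI_ex[OF this] have B: "pairwise orthogonal B" "\<And>b. b \<in> B \<Longrightarrow> norm b = 1" "span B = X"
    by (auto simp: B_def)
  have iB: "independent B" by (rule pairwise_orthogonal_independent[OF B(1)]) (use B(2) in force)
  then have fB: "finite B" by (simp add: independent_imp_finite)
  have "card B = card I"
    using dim_span_eq_card_independent[OF iB] by (simp add: B(3) X_def orthogonal_matrix_dim[OF A])
  then obtain f where f: "bij_betw f I B"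
    using fB by (metis bij_betw_iff_card finite)
  then have fI: "inj_on f I" "f ` I = B" by (auto simp: bij_betw_def)
  obtain C where C: "orthogonal_matrix C" "\<And>i. i \<in> I \<Longrightarrow> C *v axis i 1 = f i"
  proof (rule extend_orthonormal_family[of I UNIV f])
    show "orthogonal (f i) (f j)" if "i \<in> I" "j \<in> I" "i \<noteq> j" for i j
      using B(1) fI that by (auto simp: pairwise_def inj_on_def)
  qed (use fI B in auto)
  have CX: "(*v) C ` coord_space I = X"
  proof -
    have "(*v) C ` coord_space I = span ((*v) C ` (\<lambda>i. axis i 1) ` I)"
      by (simp add: span_axis_eq_coord_space[symmetric] linear_span_image)
    also have "(*v) C ` (\<lambda>i. axis i 1) ` I = B"
      using C(2) fI by (simp add: image_image cong: image_cong)
    finally show ?thesis using B by simp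
  qed
  have reindex: "distr (\<Pi>\<^sub>M b\<in>B. (lborel::real measure)) (\<Pi>\<^sub>M i\<in>I. lborel) (\<lambda>c. \<lambda>i\<in>I. c (f i)) = (\<Pi>\<^sub>M i\<in>I. lborel)"
  proof (rule lborel_PiM.PiM_eqI)
    have m: "(\<lambda>c. \<lambda>i\<in>I. c (f i)) \<in> (\<Pi>\<^sub>M b\<in>B. (lborel::real measure)) \<rightarrow>\<^sub>M (\<Pi>\<^sub>M i\<in>I. lborel)"
      using fI by (intro measurable_restrict measurable_component_singleton) auto
    fix S :: "'n \<Rightarrow> real set" assume S: "\<And>i. i \<in> I \<Longrightarrow> S i \<in> sets lborel"
    have "emeasure (distr (\<Pi>\<^sub>M b\<in>B. (lborel::real measure)) (\<Pi>\<^sub>M i\<in>I. lborel) (\<lambda>c. \<lambda>i\<in>I. c (f i))) (Pi\<^sub>E I S) =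
          emeasure (\<Pi>\<^sub>M b\<in>B. (lborel::real measure)) (\<Pi>\<^sub>E b\<in>B. S (the_inv_into I f b))"
      using S fI the_inv_into_f_f[OF fI(1)]
      by (subst emeasure_distr[OF m]) (auto simp: space_PiM PiE_def Pi_def intro!: arg_cong2[where f=emeasure] sets_PiM_I_finite)
    also have "\<dots> = (\<Prod>b\<in>B. emeasure lborel (S (the_inv_into I f b)))"
      using S fI fB the_inv_into_f_f[OF fI(1)] by (intro lborel_PiM.emeasure_PiM) auto
    also have "\<dots> = (\<Prod>i\<in>I. emeasure lborel (S i))"
      using fI the_inv_into_f_f[OF fI(1)] by (intro prod.reindex_cong[of f]) auto
    finally show "emeasure (distr (\<Pi>\<^sub>M b\<in>B. (lborel::real measure)) (\<Pi>\<^sub>M i\<in>I. lborel) (\<lambda>c. \<lambda>i\<in>I. c (f i))) (Pi\<^sub>E I S) =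
      (\<Prod>i\<in>I. emeasure lborel (S i))" .
  qed auto
  have "lborel_on X = distr (\<Pi>\<^sub>M b\<in>B. (lborel :: real measure)) borel (\<lambda>c. \<Sum>b\<in>B. c b *\<^sub>R b)"
    unfolding lborel_on_def Let_def B_def ..
  also have "\<dots> = distr (\<Pi>\<^sub>M b\<in>B. lborel) borel ((\<lambda>c. C *v (\<Sum>i\<in>I. c i *\<^sub>R axis i 1)) \<circ> (\<lambda>c. \<lambda>i\<in>I. c (f i)))"
  proof (rule distr_cong, simp, simp)
    fix c :: "real^'n \<Rightarrow> real"
    have "(\<Sum>b\<in>B. c b *\<^sub>R b) = (\<Sum>i\<in>I. c (f i) *\<^sub>R f i)"
      using fI by (intro sum.reindex_cong[of f]) auto
    also have "\<dots> = C *v (\<Sum>i\<in>I. c (f i) *\<^sub>R axis i 1)"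
      using C(2) by (simp add: linear_sum matrix_vector_mult_scaleR)
    finally show "(\<Sum>b\<in>B. c b *\<^sub>R b) = ((\<lambda>c. C *v (\<Sum>i\<in>I. c i *\<^sub>R axis i 1)) \<circ> (\<lambda>c. \<lambda>i\<in>I. c (f i))) c"
      by simp
  qed
  also have "\<dots> = distr (distr (\<Pi>\<^sub>M b\<in>B. lborel) (\<Pi>\<^sub>M i\<in>I. lborel) (\<lambda>c. \<lambda>i\<in>I. c (f i))) borel
       (\<lambda>c. C *v (\<Sum>i\<in>I. c i *\<^sub>R axis i 1))"
    using fI by (subst distr_distr) (auto intro!: measurable_restrict measurable_component_singleton)
  also have "\<dots> = distr (\<Pi>\<^sub>M i\<in>I. lborel) borel (\<lambda>c. C *v (\<Sum>i\<in>I. c i *\<^sub>R axis i 1))"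
    by (simp add: reindex)
  also have "\<dots> = distr (coord_lebesgue I) borel ((*v) C)"
    unfolding coord_lebesgue_def by (subst distr_distr) (auto simp: o_def)
  also have "\<dots> = distr (distr (coord_lebesgue I) borel ((*v) (transpose A ** C))) borel ((*v) A)"
    by (subst distr_distr) (auto simp: o_def orthogonal_matrix_mult_transpose[OF A] simp flip: matrix_vector_mul_assoc)
  also have "distr (coord_lebesgue I) borel ((*v) (transpose A ** C)) = coord_lebesgue I"
  proof (rule coord_lebesgue_rotation_invariant)
    have "(*v) (transpose A ** C) ` coord_space I = (*v) (transpose A) ` ((*v) A ` coord_space I)"
      by (simp only: image_matrix_mul CX X_def)
    also have "\<dots> = coord_space I" by (simp add: image_image orthogonal_matrix_transpose_mult[OF A])
    finally show "transpose A ** C \<in> rot_stab I"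
      using A C(1) by (simp add: rot_stab_def orthogonal_matrix_mul)
  qed
  finally show ?thesis by (simp add: X_def)
qed

section \<open>Measurability of plane-valued maps\<close>

lemma space_plane_algebra [simp]: "space (plane_algebra G) = G"
  unfolding plane_algebra_def by (subst space_measure_of) auto

lemma sets_plane_algebra: "sets (plane_algebra G) = sigma_sets G {{A \<in> G. A \<inter> U \<noteq> {}} | U. open U}"
  unfolding plane_algebra_def by (subst sets_measure_of) auto

lemma infdist_less_iff:
  assumes "A \<noteq> {}" shows "infdist x A < r \<longleftrightarrow> A \<inter> ball x r \<noteq> {}"
proof
  assume "infdist x A < r"
  then obtain a where "a \<in> A" "dist x a < r"
    using cINF_greatest[OF assms, of r "dist x"] by (force simp: infdist_notempty[OF assms])
  then show "A \<inter> ball x r \<noteq> {}" by auto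
next
  assume "A \<inter> ball x r \<noteq> {}"
  then obtain a where "a \<in> A" "dist x a < r" by auto
  then show "infdist x A < r" using infdist_le[of a A x] by simp
qed

lemma measurable_infdist_plane:
  assumes "{} \<notin> G"
  shows "(\<lambda>A. infdist x A) \<in> borel_measurable (plane_algebra G)"
proof (rule borel_measurable_iff_less[THEN iffD2], rule allI)
  fix r
  have "{A \<in> space (plane_algebra G). infdist x A < r} = {A \<in> G. A \<inter> ball x r \<noteq> {}}"
    unfolding space_plane_algebra
    by (intro Collect_cong conj_cong refl infdist_less_iff) (use assms in auto)
  also have "\<dots> \<in> sets (plane_algebra G)"
    unfolding sets_plane_algebra by (rule sigma_sets.Basic) blast
  finally show "{A \<in> space (plane_algebra G). infdist x A < r} \<in> sets (plane_algebra G)" .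
qed

lemma countable_ball_cover:
  fixes U :: "'a::euclidean_space set"
  obtains D :: "('a \<times> real) set" where "countable D"
    "\<And>U. open U \<Longrightarrow> U = \<Union>{ball x r | x r. (x, r) \<in> D \<and> ball x r \<subseteq> U}"
proof -
  obtain D :: "'a set" where D: "countable D" "\<And>X. open X \<Longrightarrow> X \<noteq> {} \<Longrightarrow> \<exists>d\<in>D. d \<in> X"
    using countable_dense_exists by blast
  show ?thesis
  proof (rule that[of "D \<times> \<rat>"])
    show "countable (D \<times> \<rat>)" using D countable_rat by blast
    fix U :: "'a set" assume U: "open U"
    show "U = \<Union>{ball x r | x r. (x, r) \<in> D \<times> \<rat> \<and> ball x r \<subseteq> U}"
    proof (intro equalityI subsetI)
      fix y assume "y \<in> U"
      then obtain e where e: "e > 0" "ball y e \<subseteq> U" using U open_contains_ball by blast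
      obtain q where q: "q \<in> \<rat>" "0 < q" "q < e / 2" using Rats_dense_in_real[of 0 "e/2"] e by auto
      obtain d where d: "d \<in> D" "dist y d < q" using D(2)[of "ball y q"] q by auto
      have "ball d q \<subseteq> U"
      proof
        fix z assume "z \<in> ball d q"
        then have "dist y z < e" using d q dist_triangle[of y z d] by auto
        then show "z \<in> U" using e by auto
      qed
      then show "y \<in> \<Union>{ball x r | x r. (x, r) \<in> D \<times> \<rat> \<and> ball x r \<subseteq> U}"
        using d q by (auto simp: dist_commute intro!: exI[of _ "ball d q"])
    qed auto
  qed
qed

text \<open>
  By second countability, the sets of planes that meet an open set are countable unions of sets of
  planes at distance less than r from a point. So a map into planes is measurable as soon as all
  distance functions are; for planes given by a formula these are explicit.
\<close>

lemma measurable_into_planes: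
  fixes f :: "'b \<Rightarrow> 'a::euclidean_space set"
  assumes G: "{} \<notin> G" and fG: "\<And>w. w \<in> space M \<Longrightarrow> f w \<in> G"
    and f[measurable]: "\<And>x. (\<lambda>w. infdist x (f w)) \<in> borel_measurable M"
  shows "f \<in> M \<rightarrow>\<^sub>M plane_algebra G"
  unfolding plane_algebra_def
proof (rule measurable_measure_of)
  show "f \<in> space M \<rightarrow> G" using fG by auto
  fix Y assume "Y \<in> {{A \<in> G. A \<inter> U \<noteq> {}} | U. open U}"
  then obtain U where U: "open U" "Y = {A \<in> G. A \<inter> U \<noteq> {}}" by auto
  obtain D :: "('a \<times> real) set" where D: "countable D"
    "\<And>U. open U \<Longrightarrow> U = \<Union>{ball x r | x r. (x, r) \<in> D \<and> ball x r \<subseteq> U}"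
    using countable_ball_cover by blast
  have "f w \<inter> U \<noteq> {} \<longleftrightarrow> (\<exists>(x, r) \<in> {(x, r) \<in> D. ball x r \<subseteq> U}. infdist x (f w) < r)" if "w \<in> space M" for w
  proof -
    have ne: "f w \<noteq> {}" using fG[OF that] G by auto
    have "f w \<inter> U \<noteq> {} \<longleftrightarrow> (\<exists>(x, r) \<in> {(x, r) \<in> D. ball x r \<subseteq> U}. f w \<inter> ball x r \<noteq> {})"
    proof
      assume "f w \<inter> U \<noteq> {}"
      then obtain y where y: "y \<in> f w" "y \<in> U" by blast
      from y(2) have "y \<in> \<Union>{ball x r | x r. (x, r) \<in> D \<and> ball x r \<subseteq> U}"
        using D(2)[OF U(1)] by simp
      then obtain x r where "(x, r) \<in> D" "ball x r \<subseteq> U" "y \<in> ball x r" by blast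
      then show "\<exists>(x, r) \<in> {(x, r) \<in> D. ball x r \<subseteq> U}. f w \<inter> ball x r \<noteq> {}"
        using y(1) by blast
    qed blast
    then show ?thesis by (simp add: infdist_less_iff[OF ne])
  qed
  note key = this
  have "f -` Y \<inter> space M = {w \<in> space M. f w \<inter> U \<noteq> {}}"
    using fG U(2) by blast
  also have "\<dots> = {w \<in> space M. \<exists>(x, r) \<in> {(x, r) \<in> D. ball x r \<subseteq> U}. infdist x (f w) < r}"
    by (rule Collect_cong) (simp add: key cong: conj_cong)
  also have "\<dots> = (\<Union>(x, r) \<in> {(x, r) \<in> D. ball x r \<subseteq> U}. {w \<in> space M. infdist x (f w) < r})"
    by auto
  also have "\<dots> \<in> sets M"
    using D(1) by (intro sets.countable_UN'') (auto intro: countable_subset[of _ D])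
  finally show "f -` Y \<inter> space M \<in> sets M" .
qed auto

text \<open>
  Joint measurability in the point and the plane: the distance is continuous in the point, so it
  can be compared with the distances to the points of a countable dense set.
\<close>

lemma measurable_infdist_planes:
  fixes f :: "'b \<Rightarrow> 'a::euclidean_space set"
  assumes f: "f \<in> M \<rightarrow>\<^sub>M plane_algebra G" and [measurable]: "g \<in> borel_measurable M" and G: "{} \<notin> G"
  shows "(\<lambda>w. infdist (g w) (f w)) \<in> borel_measurable M"
proof (rule borel_measurable_iff_less[THEN iffD2], rule allI)
  fix r
  obtain D :: "'a set" where D: "countable D" "\<And>X. open X \<Longrightarrow> X \<noteq> {} \<Longrightarrow> \<exists>d\<in>D. d \<in> X"
    using countable_dense_exists by blast
  have [measurable]: "(\<lambda>w. infdist x (f w)) \<in> borel_measurable M" for x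
    using measurable_compose[OF f measurable_infdist_plane[OF G]] .
  have "infdist (g w) (f w) < r \<longleftrightarrow> (\<exists>(d, q) \<in> D \<times> \<rat>. dist (g w) d < r - q \<and> infdist d (f w) < q)" for w
  proof
    assume *: "infdist (g w) (f w) < r"
    obtain q where q: "q \<in> \<rat>" "infdist (g w) (f w) < q" "q < r" 
      using Rats_dense_in_real[OF *] by auto
    define e where "e = min (r - q) (q - infdist (g w) (f w))"
    have "e > 0" using q by (simp add: e_def)
    then obtain d where d: "d \<in> D" "dist (g w) d < e" using D(2)[of "ball (g w) e"] by auto
    have "infdist d (f w) < q"
      using infdist_triangle[of d "f w" "g w"] d by (simp add: e_def dist_commute)
    then show "\<exists>(d, q) \<in> D \<times> \<rat>. dist (g w) d < r - q \<and> infdist d (f w) < q"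
      using d q by (auto simp: e_def)
  next
    assume "\<exists>(d, q) \<in> D \<times> \<rat>. dist (g w) d < r - q \<and> infdist d (f w) < q"
    then obtain d q where "dist (g w) d < r - q" "infdist d (f w) < q" by auto
    then show "infdist (g w) (f w) < r" using infdist_triangle[of "g w" "f w" d] by simp
  qed
  then have "{w \<in> space M. infdist (g w) (f w) < r} =
     (\<Union>(d, q) \<in> D \<times> \<rat>. {w \<in> space M. dist (g w) d < r - q \<and> infdist d (f w) < q})"
    by auto
  also have "\<dots> \<in> sets M"
    using D(1) countable_rat by (intro sets.countable_UN'') (auto intro!: countable_SIGMA)
  finally show "{w \<in> space M. infdist (g w) (f w) < r} \<in> sets M" .
qed

section \<open>Orthogonal projections\<close>

definition orth_proj :: "'a::euclidean_space set \<Rightarrow> 'a \<Rightarrow> 'a" where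
  "orth_proj S x = (THE y. y \<in> S \<and> x - y \<in> S\<^sup>\<bottom>)"

lemma orthogonal_comp_iff: "x \<in> S\<^sup>\<bottom> \<longleftrightarrow> (\<forall>y\<in>S. y \<bullet> x = 0)"
  by (simp add: orthogonal_comp_def orthogonal_def)

lemma orth_proj_unique:
  assumes "subspace S" "y \<in> S" "x - y \<in> S\<^sup>\<bottom>"
  shows "orth_proj S x = y"
  unfolding orth_proj_def
proof (rule the_equality)
  fix z assume z: "z \<in> S \<and> x - z \<in> S\<^sup>\<bottom>"
  have "z - y \<in> S" using assms z by (simp add: subspace_diff)
  moreover have "(x - y) - (x - z) \<in> S\<^sup>\<bottom>"
    by (rule subspace_diff[OF subspace_orthogonal_comp assms(3)]) (use z in simp)
  then have "z - y \<in> S\<^sup>\<bottom>" by simp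
  ultimately have "z - y \<in> S \<inter> S\<^sup>\<bottom>" by simp
  then show "z = y" using orthogonal_Int_0[OF assms(1)] by auto
qed (use assms in auto)

context
  fixes S :: "'a::euclidean_space set"
  assumes S: "subspace S"
begin

lemma orth_proj_mem: "orth_proj S x \<in> S" and orth_proj_diff: "x - orth_proj S x \<in> S\<^sup>\<bottom>"
proof -
  have "x \<in> S + S\<^sup>\<bottom>" by (simp add: subspace_sum_orthogonal_comp[OF S])
  then obtain y z where "x = y + z" "y \<in> S" "z \<in> S\<^sup>\<bottom>" by (auto elim: set_plus_elim)
  then have y: "y \<in> S" "x - y \<in> S\<^sup>\<bottom>" by auto
  then show "orth_proj S x \<in> S" "x - orth_proj S x \<in> S\<^sup>\<bottom>"
    using orth_proj_unique[OF S y] by simp_all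
qed

lemma orth_proj_inner: "orth_proj S x \<bullet> y = orth_proj S x \<bullet> orth_proj S y"
  using orth_proj_mem[of x] orth_proj_diff[of y] by (auto simp: orthogonal_comp_iff inner_diff_right)

lemma orth_proj_add: "orth_proj S (x + y) = orth_proj S x + orth_proj S y"
proof (rule orth_proj_unique[OF S])
  show "orth_proj S x + orth_proj S y \<in> S" using S by (simp add: subspace_add orth_proj_mem)
  have "(x - orth_proj S x) + (y - orth_proj S y) \<in> S\<^sup>\<bottom>"
    by (intro subspace_add[OF subspace_orthogonal_comp] orth_proj_diff)
  then show "x + y - (orth_proj S x + orth_proj S y) \<in> S\<^sup>\<bottom>" by (simp add: algebra_simps)
qed

lemma orth_proj_minus: "orth_proj S (- x) = - orth_proj S x"
proof (rule orth_proj_unique[OF S])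
  show "- orth_proj S x \<in> S" using S by (simp add: subspace_neg orth_proj_mem)
  have "- (x - orth_proj S x) \<in> S\<^sup>\<bottom>"
    by (intro subspace_neg[OF subspace_orthogonal_comp] orth_proj_diff)
  then show "- x - - orth_proj S x \<in> S\<^sup>\<bottom>" by simp
qed

lemma orth_proj_ident: "x \<in> S \<Longrightarrow> orth_proj S x = x"
  by (rule orth_proj_unique[OF S]) (simp_all add: orthogonal_comp_iff)

lemma infdist_eq_orth_proj: "infdist x S = norm (x - orth_proj S x)"
proof (rule antisym)
  show "infdist x S \<le> norm (x - orth_proj S x)"
    using infdist_le[OF orth_proj_mem, of x] by (simp add: dist_norm)
  have "norm (x - orth_proj S x) \<le> dist x a" if "a \<in> S" for a
  proof -
    have "orthogonal (x - orth_proj S x) (orth_proj S x - a)"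
      using orth_proj_diff[of x] subspace_diff[OF S orth_proj_mem[of x] that]
      by (auto simp: orthogonal_comp_iff orthogonal_def inner_commute)
    then have "(norm (x - orth_proj S x + (orth_proj S x - a)))\<^sup>2 = (norm (x - orth_proj S x))\<^sup>2 + (norm (orth_proj S x - a))\<^sup>2"
      by (rule norm_add_Pythagorean)
    then have "(norm (x - orth_proj S x))\<^sup>2 \<le> (norm (x - a))\<^sup>2" by simp
    then show ?thesis by (simp add: dist_norm)
  qed
  then show "norm (x - orth_proj S x) \<le> infdist x S"
    using subspace_0[OF S] by (subst infdist_notempty) (auto intro!: cINF_greatest)
qed

lemma infdist_orth_proj_square: "(infdist x S)\<^sup>2 = (norm x)\<^sup>2 - (norm (orth_proj S x))\<^sup>2"
proof -
  have "orthogonal (orth_proj S x) (x - orth_proj S x)"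
    using orth_proj_diff[of x] orth_proj_mem[of x] by (auto simp: orthogonal_comp_iff orthogonal_def)
  from norm_add_Pythagorean[OF this] show ?thesis by (simp add: infdist_eq_orth_proj)
qed

text \<open>
  The quadratic form of the projection is |x|^2 - d(x,S)^2; polarization recovers the projection
  from the distance function, and with it measurability in the subspace.
\<close>

lemma orth_proj_polarization:
  "orth_proj S x \<bullet> y = (((norm (x + y))\<^sup>2 - (infdist (x + y) S)\<^sup>2) - ((norm (x - y))\<^sup>2 - (infdist (x - y) S)\<^sup>2)) / 4"
proof -
  have "orth_proj S (x - y) = orth_proj S x - orth_proj S y"
    using orth_proj_add[of x "- y"] by (simp add: orth_proj_minus)
  then show ?thesis
    unfolding orth_proj_inner[of x y]
    by (simp add: infdist_orth_proj_square orth_proj_add power2_norm_eq_inner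
        inner_add_left inner_add_right inner_diff_left inner_diff_right
        inner_commute[of "orth_proj S y" "orth_proj S x"])
qed

lemma orth_proj_orthogonal_comp: "orth_proj (S\<^sup>\<bottom>) x = x - orth_proj S x"
proof (rule orth_proj_unique[OF subspace_orthogonal_comp orth_proj_diff])
  show "x - (x - orth_proj S x) \<in> S\<^sup>\<bottom>\<^sup>\<bottom>"
    by (simp add: orthogonal_comp_self[OF S] orth_proj_mem)
qed

end

lemma orth_proj_relative_complement:
  assumes S: "subspace S" and P: "subspace P" "P \<subseteq> (S :: 'a::euclidean_space set)"
  shows "orth_proj (P\<^sup>\<bottom> \<inter> S) x = orth_proj S x - orth_proj P x"
proof (rule orth_proj_unique)
  show "subspace (P\<^sup>\<bottom> \<inter> S)" by (intro subspace_inter subspace_orthogonal_comp S)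
  note Pm = orth_proj_mem[OF P(1), of x] orth_proj_diff[OF P(1), of x]
  have "x - orth_proj S x \<in> P\<^sup>\<bottom>"
    using orth_proj_diff[OF S, of x] orthogonal_comp_anti_mono[OF P(2)] by blast
  then have "(x - orth_proj P x) - (x - orth_proj S x) \<in> P\<^sup>\<bottom>"
    by (rule subspace_diff[OF subspace_orthogonal_comp Pm(2)])
  then show "orth_proj S x - orth_proj P x \<in> P\<^sup>\<bottom> \<inter> S"
    using Pm P by (auto intro!: subspace_diff[OF S] orth_proj_mem[OF S])
  show "x - (orth_proj S x - orth_proj P x) \<in> (P\<^sup>\<bottom> \<inter> S)\<^sup>\<bottom>"
    unfolding orthogonal_comp_iff
  proof
    fix y assume y: "y \<in> P\<^sup>\<bottom> \<inter> S"
    then have "y \<bullet> (x - orth_proj S x) = 0" using orth_proj_diff[OF S, of x] by (auto simp: orthogonal_comp_iff)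
    moreover have "y \<bullet> orth_proj P x = 0" using y Pm by (auto simp: orthogonal_comp_iff inner_commute)
    ultimately show "y \<bullet> (x - (orth_proj S x - orth_proj P x)) = 0"
      by (simp add: inner_diff_right)
  qed
qed

lemma dim_orthogonal_comp:
  fixes S :: "(real^'n::finite) set"
  assumes "subspace S" shows "dim (S\<^sup>\<bottom>) = CARD('n) - dim S"
proof -
  have "dim {y \<in> UNIV. \<forall>x\<in>S. orthogonal x y} + dim S = dim (UNIV :: (real^'n) set)"
    by (rule dim_subspace_orthogonal_to_vectors[OF assms subspace_UNIV subset_UNIV])
  moreover have "{y \<in> UNIV. \<forall>x\<in>S. orthogonal x y} = S\<^sup>\<bottom>"
    unfolding orthogonal_comp_def by blast
  ultimately show ?thesis by simp
qed

lemma dim_relative_orthogonal_comp: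
  fixes P :: "(real^'n::finite) set"
  assumes "subspace P" "subspace X" "P \<subseteq> X" shows "dim (P\<^sup>\<bottom> \<inter> X) = dim X - dim P"
proof -
  have "dim {y \<in> X. \<forall>x\<in>P. orthogonal x y} + dim P = dim X"
    by (rule dim_subspace_orthogonal_to_vectors[OF assms])
  moreover have "{y \<in> X. \<forall>x\<in>P. orthogonal x y} = P\<^sup>\<bottom> \<inter> X"
    unfolding orthogonal_comp_def by blast
  ultimately show ?thesis by simp
qed

lemma infdist_orthogonal_sum:
  assumes S: "subspace (S :: 'a::euclidean_space set)" and T: "subspace T" and TS: "T \<subseteq> S\<^sup>\<bottom>"
  shows "infdist x {a + b | a b. a \<in> S \<and> b \<in> T} =
    sqrt ((infdist x S)\<^sup>2 + (infdist x T)\<^sup>2 - (norm x)\<^sup>2)"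
proof -
  let ?U = "{a + b | a b. a \<in> S \<and> b \<in> T}"
  have U: "subspace ?U" by (rule subspace_sums[OF S T])
  have perp: "a \<bullet> b = 0" if "a \<in> S" "b \<in> T" for a b
    using TS that by (auto simp: orthogonal_comp_iff)
  have "orth_proj ?U x = orth_proj S x + orth_proj T x"
  proof (rule orth_proj_unique[OF U])
    show "orth_proj S x + orth_proj T x \<in> ?U"
      by (rule CollectI, rule exI[of _ "orth_proj S x"], rule exI[of _ "orth_proj T x"])
         (simp add: orth_proj_mem S T)
    show "x - (orth_proj S x + orth_proj T x) \<in> ?U\<^sup>\<bottom>"
      unfolding orthogonal_comp_iff
    proof safe
      fix a b assume ab: "a \<in> S" "b \<in> T"
      have "a \<bullet> (x - orth_proj S x) = 0" "b \<bullet> (x - orth_proj T x) = 0"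
        using orth_proj_diff[OF S, of x] orth_proj_diff[OF T, of x] ab by (auto simp: orthogonal_comp_iff)
      moreover have "a \<bullet> orth_proj T x = 0" by (rule perp[OF ab(1) orth_proj_mem[OF T]])
      moreover have "b \<bullet> orth_proj S x = 0"
        by (subst inner_commute) (rule perp[OF orth_proj_mem[OF S] ab(2)])
      ultimately show "(a + b) \<bullet> (x - (orth_proj S x + orth_proj T x)) = 0"
        by (simp add: inner_add_left inner_diff_right inner_add_right)
    qed
  qed
  moreover have "(norm (orth_proj S x + orth_proj T x))\<^sup>2 = (norm (orth_proj S x))\<^sup>2 + (norm (orth_proj T x))\<^sup>2"
    by (rule norm_add_Pythagorean) (simp add: orthogonal_def perp[OF orth_proj_mem[OF S] orth_proj_mem[OF T]])
  ultimately have "(infdist x ?U)\<^sup>2 = (infdist x S)\<^sup>2 + (infdist x T)\<^sup>2 - (norm x)\<^sup>2"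
    by (simp add: infdist_orth_proj_square[OF U] infdist_orth_proj_square[OF S] infdist_orth_proj_square[OF T])
  then show ?thesis by (simp add: infdist_nonneg flip: \<open>(infdist x ?U)\<^sup>2 = _\<close>)
qed

lemma infdist_translate: "infdist x ((+) u ` S) = infdist (x - u) (S :: 'a::real_normed_vector set)"
  by (simp add: infdist_def image_image dist_norm algebra_simps)

lemma empty_notin_grass [simp]: "{} \<notin> grass X m"
  using subspace_0 by (auto simp: grass_def)

lemma empty_notin_affine_grass [simp]: "{} \<notin> affine_grass m"
  by (simp add: affine_grass_def)

lemma grass_subspace: "S \<in> grass X m \<Longrightarrow> subspace S"
  by (simp add: grass_def)

lemma measurable_orth_proj:
  fixes f :: "'b \<Rightarrow> 'a::euclidean_space set"
  assumes f: "f \<in> M \<rightarrow>\<^sub>M plane_algebra (grass X m)" and g[measurable]: "g \<in> borel_measurable M"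
  shows "(\<lambda>w. orth_proj (f w) (g w)) \<in> borel_measurable M"
proof (rule borel_measurable_euclidean_space[THEN iffD2], rule ballI)
  fix b :: 'a
  have fs: "subspace (f w)" if "w \<in> space M" for w
    using measurable_space[OF f that] by (simp add: grass_subspace)
  have [measurable]: "(\<lambda>w. infdist (g w + b) (f w)) \<in> borel_measurable M"
      "(\<lambda>w. infdist (g w - b) (f w)) \<in> borel_measurable M"
    by (rule measurable_infdist_planes[OF f _ empty_notin_grass]; measurable)+
  have "(\<lambda>w. (((norm (g w + b))\<^sup>2 - (infdist (g w + b) (f w))\<^sup>2) - ((norm (g w - b))\<^sup>2 - (infdist (g w - b) (f w))\<^sup>2)) / 4)
      \<in> borel_measurable M" by measurable
  then show "(\<lambda>w. orth_proj (f w) (g w) \<bullet> b) \<in> borel_measurable M"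
    by (rule measurable_cong[THEN iffD1, rotated]) (simp add: orth_proj_polarization[OF fs])
qed

section \<open>Affine planes\<close>

lemma dir_space_translate:
  assumes "subspace S" shows "dir_space ((+) u ` S) = S"
proof -
  have "x \<in> dir_space ((+) u ` S)" if "x \<in> S" for x
    using that subspace_0[OF assms] unfolding dir_space_def
    by (intro CollectI exI[of _ "u + x"] exI[of _ "u + 0"]) auto
  moreover have "x \<in> S" if "x \<in> dir_space ((+) u ` S)" for x
    using that subspace_diff[OF assms] unfolding dir_space_def by auto
  ultimately show ?thesis by blast
qed

lemma foot_translate:
  assumes S: "subspace S" and u: "u \<in> S\<^sup>\<bottom>" shows "foot ((+) u ` S) = u"
  unfolding foot_def dir_space_translate[OF S]
proof (rule the_equality)
  show "u \<in> (+) u ` S \<and> u \<in> S\<^sup>\<bottom>" using u subspace_0[OF S] by force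
  fix v assume v: "v \<in> (+) u ` S \<and> v \<in> S\<^sup>\<bottom>"
  then have "v - u \<in> S" by auto
  moreover have "v - u \<in> S\<^sup>\<bottom>" using u v by (intro subspace_diff[OF subspace_orthogonal_comp]) auto
  ultimately have "v - u \<in> S \<inter> S\<^sup>\<bottom>" by simp
  then show "v = u" using orthogonal_Int_0[OF S] by auto
qed

lemma translate_in_affine_grass:
  assumes "subspace S" "dim S = m" shows "(+) u ` S \<in> affine_grass m"
  using assms by (simp add: affine_grass_def affine_translation[symmetric] subspace_imp_affine aff_dim_translation_eq aff_dim_subspace)

lemma affine_grass_cases:
  assumes "A \<in> affine_grass m"
  obtains S u where "subspace S" "dim S = m" "u \<in> S\<^sup>\<bottom>" "A = (+) u ` S"
proof -
  have A: "affine A" "aff_dim A = int m" "A \<noteq> {}" using assms by (auto simp: affine_grass_def)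
  then obtain a where "a \<in> A" by auto
  define S where "S = (+) (- a) ` A"
  have S: "subspace S" unfolding S_def using affine_diffs_subspace[OF A(1) \<open>a \<in> A\<close>] by simp
  have AS: "A = (+) a ` S" by (simp add: S_def image_image)
  have d: "dim S = m"
    using A(2) aff_dim_subspace[OF S] aff_dim_translation_eq[of a S] AS by simp
  define u where "u = a - orth_proj S a"
  have "A = (+) u ` S"
  proof -
    have "(+) u ` S = (\<lambda>x. a + x) ` (\<lambda>x. - orth_proj S a + x) ` S"
      by (auto simp: u_def image_image algebra_simps)
    also have "(\<lambda>x. - orth_proj S a + x) ` S = S"
    proof (intro equalityI subsetI)
      fix y assume "y \<in> S"
      then have "orth_proj S a + y \<in> S" by (intro subspace_add[OF S] orth_proj_mem[OF S])
      then show "y \<in> (\<lambda>x. - orth_proj S a + x) ` S" by (rule rev_image_eqI) simp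
    next
      fix y assume "y \<in> (\<lambda>x. - orth_proj S a + x) ` S"
      then obtain z where "z \<in> S" "y = z - orth_proj S a" by auto
      then show "y \<in> S" by (simp add: subspace_diff[OF S] orth_proj_mem[OF S])
    qed
    finally show ?thesis using AS by simp
  qed
  then show ?thesis using that[OF S d, of u] orth_proj_diff[OF S, of a] by (simp add: u_def)
qed

lemma dir_space_affine_grass: "A \<in> affine_grass m \<Longrightarrow> dir_space A \<in> grass UNIV m"
  by (erule affine_grass_cases) (simp add: dir_space_translate grass_def)

lemma foot_mem_dir_space_comp: "A \<in> affine_grass m \<Longrightarrow> foot A \<in> (dir_space A)\<^sup>\<bottom>"
  by (erule affine_grass_cases) (simp add: dir_space_translate foot_translate)

lemma affine_grass_eq_translate: "A \<in> affine_grass m \<Longrightarrow> A = (+) (foot A) ` dir_space A"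
  by (erule affine_grass_cases) (simp add: dir_space_translate foot_translate)

lemma infdist_affine_grass:
  assumes "A \<in> affine_grass m"
  shows "infdist x A = infdist (x - foot A) (dir_space A)"
  by (subst (1) affine_grass_eq_translate[OF assms]) (simp add: infdist_translate)

text \<open>
  The foot of an affine plane is its point closest to the origin.
\<close>

lemma infdist_zero_affine_grass:
  assumes "A \<in> affine_grass m"
  shows "infdist 0 A = norm (foot A)"
proof -
  have S: "subspace (dir_space A)" using dir_space_affine_grass[OF assms] grass_subspace by blast
  have "orth_proj (dir_space A) (0 - foot A) = 0"
    using foot_mem_dir_space_comp[OF assms] subspace_0[OF S] subspace_neg[OF subspace_orthogonal_comp]
    by (intro orth_proj_unique[OF S]) auto
  then show ?thesis by (simp add: infdist_affine_grass[OF assms] infdist_eq_orth_proj[OF S])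
qed

text \<open>
  d(x,A)^2 = |x - foot A|^2 - |\<pi> x|^2 with \<pi> the projection to the direction space; the part that
  is odd in x is linear in the foot.
\<close>

lemma foot_polarization:
  assumes "A \<in> affine_grass m"
  shows "foot A \<bullet> x = ((infdist (- x) A)\<^sup>2 - (infdist x A)\<^sup>2) / 4"
proof -
  define S where "S = dir_space A"
  have S: "subspace S" using dir_space_affine_grass[OF assms] grass_subspace S_def by blast
  define u where "u = foot A"
  have u: "u \<in> S\<^sup>\<bottom>" using foot_mem_dir_space_comp[OF assms] by (simp add: u_def S_def)
  have pu: "orth_proj S u = 0"
    using u subspace_0[OF S] by (intro orth_proj_unique[OF S]) auto
  have d: "(infdist x A)\<^sup>2 = (norm (x - u))\<^sup>2 - (norm (orth_proj S x))\<^sup>2" for x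
    using orth_proj_add[OF S, of x "- u"]
    by (simp add: infdist_affine_grass[OF assms] infdist_orth_proj_square[OF S] S_def[symmetric] u_def[symmetric]
       orth_proj_minus[OF S] pu)
  show ?thesis
    by (simp add: d orth_proj_minus[OF S] u_def[symmetric] power2_norm_eq_inner inner_diff_left inner_diff_right inner_commute
         inner_add_left inner_add_right)
qed

lemma measurable_foot [measurable]:
  "foot \<in> borel_measurable (plane_algebra (affine_grass m :: 'a::euclidean_space set set))"
proof (rule borel_measurable_euclidean_space[THEN iffD2], rule ballI)
  fix b :: 'a
  have [measurable]: "(\<lambda>A. infdist x A) \<in> borel_measurable (plane_algebra (affine_grass m))" for x :: 'a
    by (rule measurable_infdist_plane) simp
  have "(\<lambda>A. ((infdist (- b) A)\<^sup>2 - (infdist b A)\<^sup>2) / 4) \<in> borel_measurable (plane_algebra (affine_grass m))"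
    by measurable
  then show "(\<lambda>A. foot A \<bullet> b) \<in> borel_measurable (plane_algebra (affine_grass m))"
    by (rule measurable_cong[THEN iffD1, rotated]) (simp add: foot_polarization)
qed

lemma measurable_dir_space [measurable]:
  "dir_space \<in> plane_algebra (affine_grass m :: 'a::euclidean_space set set) \<rightarrow>\<^sub>M plane_algebra (grass UNIV m)"
proof (rule measurable_into_planes)
  fix x :: 'a
  have "(\<lambda>A. infdist (x + foot A) A) \<in> borel_measurable (plane_algebra (affine_grass m :: 'a set set))"
    by (rule measurable_infdist_planes[OF measurable_ident_sets[OF refl] _ empty_notin_affine_grass]) measurable
  then show "(\<lambda>A. infdist x (dir_space A)) \<in> borel_measurable (plane_algebra (affine_grass m))"
    by (rule measurable_cong[THEN iffD1, rotated]) (simp add: infdist_affine_grass)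
qed (auto simp: dir_space_affine_grass)

lemma measurable_translate_plane:
  fixes f :: "'b \<Rightarrow> 'a::euclidean_space set"
  assumes f: "f \<in> M \<rightarrow>\<^sub>M plane_algebra (grass X m)" and g: "g \<in> borel_measurable M"
  shows "(\<lambda>w. (+) (g w) ` f w) \<in> M \<rightarrow>\<^sub>M plane_algebra (affine_grass m)"
proof (rule measurable_into_planes)
  show "(+) (g w) ` f w \<in> affine_grass m" if "w \<in> space M" for w
    using measurable_space[OF f that] by (intro translate_in_affine_grass) (auto simp: grass_def)
  show "(\<lambda>w. infdist x ((+) (g w) ` f w)) \<in> borel_measurable M" for x
    unfolding infdist_translate using g by (intro measurable_infdist_planes[OF f]) auto
qed simp

lemma measurable_rotate_plane:
  fixes f :: "'b \<Rightarrow> (real^'n::finite) set"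
  assumes f: "f \<in> M \<rightarrow>\<^sub>M plane_algebra G" and g: "g \<in> borel_measurable M"
    and o: "\<And>w. w \<in> space M \<Longrightarrow> orthogonal_matrix (g w)"
    and G: "{} \<notin> G" "{} \<notin> G'" and G': "\<And>w. w \<in> space M \<Longrightarrow> (*v) (g w) ` f w \<in> G'"
  shows "(\<lambda>w. (*v) (g w) ` f w) \<in> M \<rightarrow>\<^sub>M plane_algebra G'"
proof (rule measurable_into_planes[OF G(2) G'])
  fix x :: "real^'n"
  have [measurable]: "(\<lambda>w. transpose (g w)) \<in> borel_measurable M" using g by measurable
  have "(\<lambda>w. infdist (transpose (g w) *v x) (f w)) \<in> borel_measurable M"
    by (rule measurable_infdist_planes[OF f _ G(1)]) measurable
  then show "(\<lambda>w. infdist x ((*v) (g w) ` f w)) \<in> borel_measurable M"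
    by (rule measurable_cong[THEN iffD1, rotated]) (simp add: orthogonal_matrix_infdist[OF o])
qed

section \<open>Gram-Schmidt frames of random vectors\<close>

text \<open>
  Gram-Schmidt needs a linear order of the index type, which is only assumed finite.
\<close>

definition index_order :: "'n::finite \<Rightarrow> nat" where
  "index_order = (SOME f. inj f)"

lemma inj_index_order: "inj (index_order :: 'n::finite \<Rightarrow> nat)"
proof -
  have "\<exists>f::'n \<Rightarrow> nat. inj f" using finite_imp_inj_to_nat_seg[of "UNIV :: 'n set"] by auto
  then show ?thesis unfolding index_order_def by (rule someI_ex)
qed

text \<open>
  Since \<open>sgn 0 = 0\<close>, linearly dependent input produces zero vectors instead of leaving the
  recursion undefined: the output vectors are always pairwise orthogonal, and each has norm 0 or
  1.
\<close>

function gram_schmidt :: "('n::finite \<Rightarrow> 'a::euclidean_space) \<Rightarrow> 'n \<Rightarrow> 'a" where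
  "gram_schmidt g i = sgn (g i - (\<Sum>t | index_order t < index_order i.
     (g i \<bullet> gram_schmidt g t) *\<^sub>R gram_schmidt g t))"
  by auto
termination by (relation "Wellfounded.measure (\<lambda>(g, i). index_order i)") auto

declare gram_schmidt.simps [simp del]

lemma index_induct [case_names less]:
  assumes "\<And>i. (\<And>t. index_order t < index_order i \<Longrightarrow> P t) \<Longrightarrow> P i"
  shows "P (i :: 'n::finite)"
  by (rule measure_induct_rule[of index_order]) (rule assms)

lemma norm_gram_schmidt: "gram_schmidt g i \<noteq> 0 \<Longrightarrow> norm (gram_schmidt g i) = 1"
  by (subst (asm) gram_schmidt.simps, subst gram_schmidt.simps) (simp add: norm_sgn sgn_zero_iff)

lemma gram_schmidt_orthogonal_less:
  fixes i :: "'m::finite"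
  shows "\<forall>t. index_order t < index_order i \<longrightarrow> gram_schmidt g i \<bullet> gram_schmidt g t = 0"
proof (induction i rule: index_induct)
  case (less i)
  show ?case
  proof (intro allI impI)
    fix t :: 'm assume t: "index_order t < index_order i"
    let ?L = "{t::'m. index_order t < index_order i}"
    have "gram_schmidt g s \<bullet> gram_schmidt g t = 0" if "s \<in> ?L" "s \<noteq> t" for s
    proof -
      have "index_order s \<noteq> index_order t" using inj_index_order that by (auto simp: inj_def)
      then consider "index_order s < index_order t" | "index_order t < index_order s" by linarith
      then show ?thesis
      proof cases
        case 1 then show ?thesis using less[of t] t by (simp add: inner_commute)
      next
        case 2 then show ?thesis using less[of s] that by simp
      qed
    qed
    then have "(\<Sum>s\<in>?L. (g i \<bullet> gram_schmidt g s) *\<^sub>R gram_schmidt g s) \<bullet> gram_schmidt g t =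
       (\<Sum>s\<in>?L. if s = t then (g i \<bullet> gram_schmidt g t) * (gram_schmidt g t \<bullet> gram_schmidt g t) else 0)"
      unfolding inner_sum_left by (intro sum.cong) auto
    also have "\<dots> = (g i \<bullet> gram_schmidt g t) * (gram_schmidt g t \<bullet> gram_schmidt g t)"
      using t by simp
    also have "\<dots> = g i \<bullet> gram_schmidt g t"
      using norm_gram_schmidt[of g t] by (cases "gram_schmidt g t = 0") (auto simp: norm_eq_1)
    finally show "gram_schmidt g i \<bullet> gram_schmidt g t = 0"
      by (subst gram_schmidt.simps) (simp add: sgn_div_norm inner_diff_left)
  qed
qed

lemma gram_schmidt_orthogonal:
  assumes "i \<noteq> j" shows "gram_schmidt g i \<bullet> gram_schmidt g j = 0"
proof -
  have "index_order i \<noteq> index_order j" using inj_index_order assms by (auto simp: inj_def)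
  then consider "index_order i < index_order j" | "index_order j < index_order i" by linarith
  then show ?thesis
  proof cases
    case 1 then show ?thesis using gram_schmidt_orthogonal_less[of j g] by (simp add: inner_commute)
  next
    case 2 then show ?thesis using gram_schmidt_orthogonal_less[of i g] by simp
  qed
qed

lemma gram_schmidt_cong:
  "(\<And>t. index_order t \<le> index_order i \<Longrightarrow> g t = g' t) \<Longrightarrow> gram_schmidt g i = gram_schmidt g' i"
proof (induction i rule: index_induct)
  case (less i)
  then have "gram_schmidt g t = gram_schmidt g' t" if "index_order t < index_order i" for t
    using that by auto
  then show ?case
    using less.prems[of i] by (subst (1 2) gram_schmidt.simps) simp
qed

lemma gram_schmidt_rotate:
  fixes g :: "'m::finite \<Rightarrow> real^'n::finite"
  assumes T: "orthogonal_matrix T"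
  shows "gram_schmidt (\<lambda>i. T *v g i) i = T *v gram_schmidt g i"
proof (induction i rule: index_induct)
  case (less i)
  have "(\<Sum>t | index_order t < index_order i. ((T *v g i) \<bullet> gram_schmidt (\<lambda>i. T *v g i) t) *\<^sub>R gram_schmidt (\<lambda>i. T *v g i) t) =
      (\<Sum>t | index_order t < index_order i. T *v ((g i \<bullet> gram_schmidt g t) *\<^sub>R gram_schmidt g t))"
    by (intro sum.cong refl) (auto simp: less orthogonal_matrix_inner[OF T] matrix_vector_mult_scaleR)
  also have "\<dots> = T *v (\<Sum>t | index_order t < index_order i. (g i \<bullet> gram_schmidt g t) *\<^sub>R gram_schmidt g t)"
    by (simp add: linear_sum)
  finally show ?case
    by (subst (1 2) gram_schmidt.simps)
       (simp add: sgn_div_norm orthogonal_matrix_norm[OF T] matrix_vector_mult_scaleR flip: matrix_vector_mult_diff_distrib)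
qed

lemma measurable_gram_schmidt:
  fixes G :: "'b \<Rightarrow> 'm::finite \<Rightarrow> 'a::euclidean_space"
  assumes G[measurable]: "\<And>i. (\<lambda>w. G w i) \<in> borel_measurable M"
  shows "(\<lambda>w. gram_schmidt (G w) i) \<in> borel_measurable M"
proof (induction i rule: index_induct)
  case (less i)
  have "(\<lambda>w. \<Sum>t | index_order t < index_order i. (G w i \<bullet> gram_schmidt (G w) t) *\<^sub>R gram_schmidt (G w) t)
     \<in> borel_measurable M"
    by (intro borel_measurable_sum borel_measurable_scaleR borel_measurable_inner G) (auto simp: less)
  then have "(\<lambda>w. G w i - (\<Sum>t | index_order t < index_order i. (G w i \<bullet> gram_schmidt (G w) t) *\<^sub>R gram_schmidt (G w) t))
     \<in> borel_measurable M" by measurable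
  then show ?case
    by (subst gram_schmidt.simps) (simp add: sgn_div_norm)
qed

text \<open>
  Vectors with index in I are kept in S and the others in the orthogonal complement of S, so that
  the frame is adapted to both.
\<close>

definition block :: "'n set \<Rightarrow> 'a::euclidean_space set \<Rightarrow> 'n \<Rightarrow> 'a set" where
  "block I S i = (if i \<in> I then S else S\<^sup>\<bottom>)"

lemma subspace_block: "subspace S \<Longrightarrow> subspace (block I S i)"
  by (simp add: block_def subspace_orthogonal_comp)

lemma block_orthogonal:
  "x \<in> block I S i \<Longrightarrow> y \<in> block I S t \<Longrightarrow> (i \<in> I) \<noteq> (t \<in> I) \<Longrightarrow> x \<bullet> y = 0"
  by (auto simp: block_def orthogonal_comp_iff inner_commute split: if_splits)

lemma gram_schmidt_mem_block:
  assumes S: "subspace S" and g: "\<And>i. g i \<in> block I S i"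
  shows "gram_schmidt g i \<in> block I S i"
proof (induction i rule: index_induct)
  case (less i)
  note sb = subspace_block[OF S, of I i]
  have "(g i \<bullet> gram_schmidt g t) *\<^sub>R gram_schmidt g t \<in> block I S i" if "index_order t < index_order i" for t
  proof (cases "(i \<in> I) = (t \<in> I)")
    case True
    then have "block I S t = block I S i" by (simp add: block_def)
    then show ?thesis using less[OF that] sb by (simp add: subspace_scale)
  next
    case False
    then have "g i \<bullet> gram_schmidt g t = 0" using block_orthogonal[OF g less[OF that]] by blast
    then show ?thesis using subspace_0[OF sb] by simp
  qed
  then have "(\<Sum>t | index_order t < index_order i. (g i \<bullet> gram_schmidt g t) *\<^sub>R gram_schmidt g t) \<in> block I S i"
    by (intro subspace_sum[OF sb]) simp
  then show ?case
    by (subst gram_schmidt.simps)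
       (unfold sgn_div_norm, intro subspace_scale[OF sb] subspace_diff[OF sb] g)
qed

lemma gram_schmidt_eq_0_imp_span:
  fixes i :: "'m::finite"
  assumes S: "subspace S" and g: "\<And>i. g i \<in> block I S i" and 0: "gram_schmidt g i = 0"
  shows "g i \<in> span (gram_schmidt g ` {t. index_order t < index_order i \<and> (i \<in> I) = (t \<in> I)})"
proof -
  let ?L = "{t::'m. index_order t < index_order i}"
  have "g i = (\<Sum>t\<in>?L. (g i \<bullet> gram_schmidt g t) *\<^sub>R gram_schmidt g t)"
    using 0 by (subst (asm) gram_schmidt.simps) (simp add: sgn_zero_iff)
  also have "\<dots> \<in> span (gram_schmidt g ` {t. index_order t < index_order i \<and> (i \<in> I) = (t \<in> I)})" (is "_ \<in> span ?G")
  proof (rule span_sum)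
    fix t assume "t \<in> ?L"
    show "(g i \<bullet> gram_schmidt g t) *\<^sub>R gram_schmidt g t \<in> span ?G"
    proof (cases "(i \<in> I) = (t \<in> I)")
      case True then show ?thesis using \<open>t \<in> ?L\<close> by (intro span_scale span_base) auto
    next
      case False
      then have "g i \<bullet> gram_schmidt g t = 0" using block_orthogonal[OF g gram_schmidt_mem_block[OF S g]] by blast
      then show ?thesis by (simp add: span_zero)
    qed
  qed
  finally show ?thesis .
qed

text \<open>
  Independent vectors, uniform in the unit ball: what matters is that each one has a rotation
  invariant law which does not charge proper subspaces.
\<close>

definition ball_samples :: "('n::finite \<Rightarrow> real^'n) measure" where
  "ball_samples = (\<Pi>\<^sub>M i\<in>UNIV. uniform_measure lborel (ball 0 1))"

lemma prob_space_uniform_ball: "prob_space (uniform_measure lborel (ball (0::real^'n::finite) 1))"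
  using emeasure_ball_pos_finite by (intro prob_space_uniform_measure) auto

interpretation ball_samples: product_prob_space "\<lambda>_::'n::finite. uniform_measure lborel (ball (0::real^'n) 1)" UNIV
  using prob_space_uniform_ball by (intro product_prob_spaceI)

lemma prob_space_ball_samples: "prob_space ball_samples"
  unfolding ball_samples_def by (rule prob_space_PiM) (rule prob_space_uniform_ball)

interpretation ball_samples_prob: prob_space ball_samples by (rule prob_space_ball_samples)

lemma space_ball_samples [simp]: "space ball_samples = UNIV"
  by (simp add: ball_samples_def space_PiM)

lemma measurable_ball_samples_component [measurable]: "(\<lambda>g. g i) \<in> borel_measurable ball_samples"
proof -
  have "(\<lambda>g. g i) \<in> ball_samples \<rightarrow>\<^sub>M uniform_measure lborel (ball 0 1)"
    unfolding ball_samples_def by (rule measurable_component_singleton) simp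
  then show ?thesis by (simp cong: measurable_cong_sets)
qed

lemma uniform_ball_rotate:
  assumes T: "orthogonal_matrix (T::real^'n::finite^'n)"
  shows "distr (uniform_measure lborel (ball 0 1)) (uniform_measure lborel (ball 0 1)) ((*v) T) =
    uniform_measure lborel (ball 0 1)"
proof (rule measure_eqI)
  fix E assume "E \<in> sets (distr (uniform_measure lborel (ball 0 1)) (uniform_measure lborel (ball 0 1)) ((*v) T))"
  then have [measurable]: "E \<in> sets borel" by simp
  have [measurable]: "(*v) T \<in> uniform_measure lborel (ball 0 1) \<rightarrow>\<^sub>M uniform_measure lborel (ball 0 1)"
    by (simp cong: measurable_cong_sets)
  have T': "(*v) T -` E \<in> sets borel" using measurable_sets_borel[of "(*v) T" borel E] by simp
  have "ball 0 1 \<inter> (*v) T -` E = (*v) T -` (ball 0 1 \<inter> E)"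
    by (auto simp: orthogonal_matrix_norm[OF T])
  also have "emeasure lborel \<dots> = emeasure (distr lborel borel ((*v) T)) (ball 0 1 \<inter> E)"
    by (subst emeasure_distr) simp_all
  also have "\<dots> = emeasure lborel (ball 0 1 \<inter> E)" by (simp add: lborel_rotation_invariant[OF T])
  finally show "emeasure (distr (uniform_measure lborel (ball 0 1)) (uniform_measure lborel (ball 0 1)) ((*v) T)) E =
      emeasure (uniform_measure lborel (ball 0 1)) E"
    using T' by (subst emeasure_distr) simp_all
qed simp

lemma ball_samples_rotate:
  assumes T: "orthogonal_matrix (T::real^'n::finite^'n)"
  shows "distr ball_samples ball_samples (\<lambda>g i. T *v g i) = ball_samples"
proof -
  have "distr ball_samples ball_samples (compose UNIV ((*v) T)) = ball_samples"
    unfolding ball_samples_def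
    by (subst distr_PiM_finite_prob_space') 
       (simp_all add: uniform_ball_rotate[OF T] prob_space_uniform_ball cong: measurable_cong_sets)
  moreover have "compose UNIV ((*v) T) = (\<lambda>(g::'n \<Rightarrow> real^'n) i. T *v g i)"
    by (simp add: compose_def fun_eq_iff)
  ultimately show ?thesis by (simp only:)
qed

definition block_frame :: "'n set \<Rightarrow> (real^'n) set \<Rightarrow> ('n::finite \<Rightarrow> real^'n) \<Rightarrow> 'n \<Rightarrow> real^'n" where
  "block_frame I S g = gram_schmidt (\<lambda>i. orth_proj (block I S i) (g i))"

text \<open>
  The vector with index i degenerates only if the projection of the i-th sample lies in the span
  of fewer than dim X_i vectors that depend on the other samples alone. With those fixed, this
  confines the i-th sample to a proper subspace.
\<close>

lemma block_frame_nonzero: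
  fixes S :: "(real^'n::finite) set"
  assumes S: "subspace S" "dim S = card I"
  shows "AE g in ball_samples. block_frame I S g i \<noteq> 0"
proof -
  let ?U = "uniform_measure lborel (ball (0::real^'n) 1)"
  note sb = subspace_block[OF S(1)]
  have dim_block: "dim (block I S i) = card {t. (i \<in> I) = (t \<in> I)}"
  proof (cases "i \<in> I")
    case True
    then show ?thesis using S by (simp add: block_def)
  next
    case False
    have "card {t. t \<notin> I} = CARD('n) - card I"
      using card_Compl_eq[of I] by (simp add: Compl_eq)
    then show ?thesis using False S by (simp add: block_def dim_orthogonal_comp)
  qed
  have [measurable]: "(\<lambda>x. orth_proj (block I S t) (f x)) \<in> borel_measurable M" if [measurable]: "f \<in> borel_measurable M" 
    for t and f :: "'b \<Rightarrow> real^'n" and M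
  proof -
    have "(\<lambda>x. block I S t) \<in> M \<rightarrow>\<^sub>M plane_algebra (grass UNIV (dim (block I S t)))"
      using sb by (intro measurable_const) (auto simp: grass_def)
    from measurable_orth_proj[OF this that] show ?thesis .
  qed
  have m[measurable]: "(\<lambda>g. block_frame I S g t) \<in> borel_measurable ball_samples" for t
    unfolding block_frame_def by (rule measurable_gram_schmidt) measurable
  have "(\<integral>\<^sup>+g. indicator {g. block_frame I S g i = 0} g \<partial>ball_samples) = 0"
  proof -
    have ins: "insert i (UNIV - {i}) = UNIV" by auto
    have "{g. block_frame I S g i = 0} \<in> sets ball_samples"
    proof -
      have "{g \<in> space ball_samples. block_frame I S g i = 0} \<in> sets ball_samples" by measurable
      then show ?thesis by simp
    qed
    then have "(\<integral>\<^sup>+g. indicator {g. block_frame I S g i = 0} g \<partial>ball_samples) =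
      (\<integral>\<^sup>+x. (\<integral>\<^sup>+y. indicator {g. block_frame I S g i = 0} (x(i := y)) \<partial>?U) \<partial>(\<Pi>\<^sub>M t\<in>UNIV - {i}. ?U))"
      using ball_samples.product_nn_integral_insert[of "UNIV - {i}" i "indicator {g. block_frame I S g i = 0}"]
      unfolding ball_samples_def ins by simp
    also have "\<dots> = (\<integral>\<^sup>+x. 0 \<partial>(\<Pi>\<^sub>M t\<in>UNIV - {i}. ?U))"
    proof (rule nn_integral_cong)
      fix x :: "'n \<Rightarrow> real^'n"
      \<comment> \<open>the sample with index i is set to 0 because the vectors that precede it in the order do not depend on it\<close>
      define V where "V = span (block_frame I S (x(i := 0)) ` {t. index_order t < index_order i \<and> (i \<in> I) = (t \<in> I)})"
      define W where "W = {y. orth_proj (block I S i) y \<in> V}"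
      have fr: "block_frame I S (x(i := y)) t = block_frame I S (x(i := 0)) t" if "index_order t < index_order i" for y t
        unfolding block_frame_def using that by (intro gram_schmidt_cong) auto
      have "linear (orth_proj (block I S i))"
      proof (rule linearI)
        show "orth_proj (block I S i) (c *\<^sub>R y) = c *\<^sub>R orth_proj (block I S i) y" for c y
        proof (rule orth_proj_unique[OF sb])
          show "c *\<^sub>R orth_proj (block I S i) y \<in> block I S i"
            by (intro subspace_scale[OF sb] orth_proj_mem[OF sb])
          have "c *\<^sub>R (y - orth_proj (block I S i) y) \<in> (block I S i)\<^sup>\<bottom>"
            by (intro subspace_scale[OF subspace_orthogonal_comp] orth_proj_diff[OF sb])
          then show "c *\<^sub>R y - c *\<^sub>R orth_proj (block I S i) y \<in> (block I S i)\<^sup>\<bottom>"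
            by (simp add: scaleR_diff_right)
        qed
      qed (rule orth_proj_add[OF sb])
      then have sW: "subspace W"
        unfolding W_def using linear_subspace_vimage[of "orth_proj (block I S i)" V] by (simp add: V_def vimage_def)
      have "dim W < CARD('n)"
      proof (rule ccontr)
        \<comment> \<open>then the whole block would be spanned by the preceding vectors of the same block, of which there are too few\<close>
        assume "\<not> dim W < CARD('n)"
        then have "dim W = DIM(real^'n)" using dim_subset_UNIV[of W] by simp
        then have "W = UNIV" using sW by (metis dim_eq_full span_eq_iff)
        then have "block I S i \<subseteq> V" using orth_proj_ident[OF sb] unfolding W_def by (metis UNIV_I mem_Collect_eq subsetI)
        then have "dim (block I S i) \<le> dim V" by (rule dim_subset)
        also have "dim V \<le> card (block_frame I S (x(i := 0)) ` {t. index_order t < index_order i \<and> (i \<in> I) = (t \<in> I)})"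
          unfolding V_def by (simp add: dim_le_card')
        also have "\<dots> \<le> card {t. index_order t < index_order i \<and> (i \<in> I) = (t \<in> I)}"
          by (rule card_image_le) simp
        also have "\<dots> < card {t. (i \<in> I) = (t \<in> I)}"
          by (rule psubset_card_mono) auto
        finally show False using dim_block by simp
      qed
      then have "negligible W" by (intro negligible_lowdim) simp
      moreover have "W \<in> sets borel" using closed_subspace[OF sW] by simp
      ultimately have "W \<in> null_sets lborel" by (simp add: negligible_iff_null_sets null_sets_completion_iff)
      then have "AE y in ?U. y \<notin> W"
        by (intro AE_uniform_measureI) (auto dest: AE_not_in)
      then have "(\<integral>\<^sup>+y. indicator {g. block_frame I S g i = 0} (x(i := y)) \<partial>?U) = (\<integral>\<^sup>+y. 0 \<partial>?U)"
      proof (rule nn_integral_cong_AE[OF AE_mp], intro AE_I2 impI)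
        fix y assume "y \<notin> W"
        have "block_frame I S (x(i := y)) i \<noteq> 0"
        proof
          assume "block_frame I S (x(i := y)) i = 0"
          then have 0: "gram_schmidt (\<lambda>t. orth_proj (block I S t) ((x(i := y)) t)) i = 0"
            by (simp only: block_frame_def)
          have "orth_proj (block I S i) ((x(i := y)) i) \<in> span (block_frame I S (x(i := y)) ` {t. index_order t < index_order i \<and> (i \<in> I) = (t \<in> I)})"
            unfolding block_frame_def by (rule gram_schmidt_eq_0_imp_span[OF S(1) _ 0]) (rule orth_proj_mem[OF sb])
          then have "orth_proj (block I S i) y \<in> span (block_frame I S (x(i := y)) ` {t. index_order t < index_order i \<and> (i \<in> I) = (t \<in> I)})"
            by (simp only: fun_upd_same)
          moreover have "block_frame I S (x(i := y)) ` {t. index_order t < index_order i \<and> (i \<in> I) = (t \<in> I)} =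
             block_frame I S (x(i := 0)) ` {t. index_order t < index_order i \<and> (i \<in> I) = (t \<in> I)}"
            by (rule image_cong[OF refl], rule fr) simp
          ultimately have "orth_proj (block I S i) y \<in> V" by (simp only: V_def)
          then show False using \<open>y \<notin> W\<close> by (simp add: W_def)
        qed
        then show "indicator {g. block_frame I S g i = 0} (x(i := y)) = (0::ennreal)" by simp
      qed
      then show "(\<integral>\<^sup>+y. indicator {g. block_frame I S g i = 0} (x(i := y)) \<partial>?U) = 0" by simp
    qed
    finally show ?thesis by simp
  qed
  then have "AE g in ball_samples. indicator {g. block_frame I S g i = 0} g = (0::ennreal)"
  proof (subst (asm) nn_integral_0_iff_AE)
    have "{g \<in> space ball_samples. block_frame I S g i = 0} \<in> sets ball_samples" by measurable
    then show "indicator {g. block_frame I S g i = 0} \<in> borel_measurable ball_samples" by simp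
  qed 
  then show ?thesis by eventually_elim (auto simp: indicator_def split: if_splits)
qed

text \<open>
  The frame as the columns of a matrix. If dim S is the size of I, this is almost surely a
  rotation that carries the coordinate subspace over I to S. It is jointly measurable in S and the
  samples, and so serves as a random measurable choice of such a rotation.
\<close>

definition frame_matrix :: "'n set \<Rightarrow> (real^'n) set \<Rightarrow> ('n::finite \<Rightarrow> real^'n) \<Rightarrow> real^'n^'n" where
  "frame_matrix I S g = (\<chi> r i. block_frame I S g i $ r)"

lemma AE_frame_matrix_orthogonal:
  fixes S :: "(real^'n::finite) set"
  assumes S: "subspace S" "dim S = card I"
  shows "AE g in ball_samples. orthogonal_matrix (frame_matrix I S g)"
proof -
  have "AE g in ball_samples. \<forall>i\<in>UNIV. block_frame I S g i \<noteq> 0"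
    by (rule AE_finite_allI) (auto intro: block_frame_nonzero[OF S])
  then show ?thesis
  proof eventually_elim
    case (elim g)
    have col: "column i (frame_matrix I S g) = block_frame I S g i" for i
      by (simp add: column_def frame_matrix_def)
    show ?case
      using elim by (simp add: orthogonal_matrix_orthonormal_columns col orthogonal_def)
          (simp add: block_frame_def norm_gram_schmidt gram_schmidt_orthogonal)
  qed
qed

lemma frame_matrix_image:
  fixes S :: "(real^'n::finite) set"
  assumes S: "subspace S" "dim S = card I" and o: "orthogonal_matrix (frame_matrix I S g)"
  shows "(*v) (frame_matrix I S g) ` coord_space I = S"
proof -
  let ?F = "frame_matrix I S g"
  have axis: "?F *v axis i 1 = block_frame I S g i" for i
    by (simp add: vec_eq_iff matrix_vector_mult_basis column_def frame_matrix_def)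
  have "block_frame I S g i \<in> S" if "i \<in> I" for i
    using gram_schmidt_mem_block[OF S(1), of "\<lambda>i. orth_proj (block I S i) (g i)" I i] that
    by (simp add: orth_proj_mem[OF subspace_block[OF S(1)]] block_frame_def) (simp add: block_def)
  then have "span ((*v) ?F ` (\<lambda>i. axis i 1) ` I) \<subseteq> S"
    by (intro span_minimal S) (auto simp: axis)
  then have sub: "(*v) ?F ` coord_space I \<subseteq> S"
    by (simp add: span_axis_eq_coord_space[symmetric] linear_span_image)
  show ?thesis
    by (rule subspace_dim_equal) (use sub S o in \<open>auto simp: orthogonal_matrix_subspace orthogonal_matrix_dim\<close>)
qed

lemma measurable_matrix_of_columns:
  fixes f :: "'b \<Rightarrow> 'n::finite \<Rightarrow> real^'n"
  assumes f[measurable]: "\<And>i. (\<lambda>w. f w i) \<in> borel_measurable M"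
  shows "(\<lambda>w. (\<chi> r i. f w i $ r) :: real^'n^'n) \<in> borel_measurable M"
proof (rule borel_measurable_euclidean_space[THEN iffD2], rule ballI)
  fix b :: "real^'n^'n" assume "b \<in> Basis"
  then obtain r i where b: "b = axis r (axis i 1)" by (auto simp: Basis_vec_def)
  show "(\<lambda>w. ((\<chi> r i. f w i $ r) :: real^'n^'n) \<bullet> b) \<in> borel_measurable M"
  proof -
    have "(\<lambda>w. ((\<chi> r i. f w i $ r) :: real^'n^'n) \<bullet> b) = (\<lambda>w. f w i \<bullet> axis r 1)"
      by (simp add: b inner_axis)
    then show ?thesis by simp
  qed
qed

lemma measurable_frame_matrix:
  fixes S :: "'b \<Rightarrow> (real^'n::finite) set"
  assumes S: "S \<in> M \<rightarrow>\<^sub>M plane_algebra (grass UNIV m)" and g: "g \<in> M \<rightarrow>\<^sub>M ball_samples"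
  shows "(\<lambda>w. frame_matrix I (S w) (g w)) \<in> borel_measurable M"
  unfolding frame_matrix_def block_frame_def
proof (intro measurable_matrix_of_columns measurable_gram_schmidt)
  fix i
  have gi[measurable]: "(\<lambda>w. g w i) \<in> borel_measurable M"
    using measurable_compose[OF g measurable_ball_samples_component] .
  have "orth_proj (block I (S w) i) (g w i) = (if i \<in> I then orth_proj (S w) (g w i) else g w i - orth_proj (S w) (g w i))" 
    if "w \<in> space M" for w
    using measurable_space[OF S that] by (auto simp: block_def grass_def orth_proj_orthogonal_comp)
  moreover have "(\<lambda>w. orth_proj (S w) (g w i)) \<in> borel_measurable M"
    by (rule measurable_orth_proj[OF S gi])
  moreover have "(\<lambda>w. if i \<in> I then orth_proj (S w) (g w i) else g w i - orth_proj (S w) (g w i)) \<in> borel_measurable M"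
    using calculation(2) by simp
  ultimately show "(\<lambda>w. orth_proj (block I (S w) i) (g w i)) \<in> borel_measurable M"
    by (subst measurable_cong)
qed

section \<open>Haar measure on stabilizers of coordinate subspaces\<close>

text \<open>
  This form shows that the group is a closed set of matrices.
\<close>

lemma rot_stab_altdef:
  "rot_stab I = {A. transpose A ** A = mat 1 \<and> (\<forall>i\<in>I. \<forall>j\<in>-I. A $ j $ i = 0)}" for I :: "'n::finite set"
proof (intro set_eqI iffI)
  fix A :: "real^'n^'n" assume A: "A \<in> rot_stab I"
  have "A $ j $ i = 0" if "i \<in> I" "j \<notin> I" for i j
  proof -
    have "A *v axis i 1 \<in> coord_space I" using A that by (simp add: rot_stab_mem axis_mem_coord_space)
    then show ?thesis using that by (simp add: coord_space_def matrix_vector_mult_basis column_def)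
  qed
  then show "A \<in> {A. transpose A ** A = mat 1 \<and> (\<forall>i\<in>I. \<forall>j\<in>-I. A $ j $ i = 0)}"
    using rot_stab_orthogonal[OF A] by (auto simp: orthogonal_matrix)
next
  fix A :: "real^'n^'n" assume "A \<in> {A. transpose A ** A = mat 1 \<and> (\<forall>i\<in>I. \<forall>j\<in>-I. A $ j $ i = 0)}"
  then have o: "orthogonal_matrix A" and z: "\<And>i j. i \<in> I \<Longrightarrow> j \<notin> I \<Longrightarrow> A $ j $ i = 0"
    by (auto simp: orthogonal_matrix)
  have "(*v) A ` coord_space I \<subseteq> coord_space I"
  proof
    fix y assume "y \<in> (*v) A ` coord_space I"
    then obtain x where x: "x \<in> coord_space I" "y = A *v x" by auto
    have "y $ j = 0" if "j \<notin> I" for j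
    proof -
      have "A $ j $ i * x $ i = 0" for i using x z[OF _ that] by (cases "i \<in> I") (auto simp: coord_space_def)
      then show ?thesis by (auto simp: x matrix_vector_mult_def intro!: sum.neutral)
    qed
    then show "y \<in> coord_space I" by (auto simp: coord_space_def)
  qed
  then have "(*v) A ` coord_space I = coord_space I"
    by (intro subspace_dim_equal) (auto simp: orthogonal_matrix_subspace[OF o] orthogonal_matrix_dim[OF o])
  then show "A \<in> rot_stab I" using o by (simp add: rot_stab_def)
qed

lemma rot_stab_borel [measurable]: "rot_stab (I :: 'n::finite set) \<in> sets borel"
proof -
  have "{A \<in> space borel. transpose A ** A = mat 1} \<in> sets (borel :: (real^'n^'n) measure)" by measurable
  moreover have [measurable]: "(\<lambda>A. A $ j $ i) \<in> borel_measurable (borel :: (real^'n^'n) measure)" for i j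
    by (rule borel_measurable_continuous_onI) (intro continuous_intros)
  have "{A \<in> space borel. \<forall>i\<in>I. \<forall>j\<in>-I. A $ j $ i = 0} \<in> sets (borel :: (real^'n^'n) measure)"
    by measurable
  ultimately have "{A \<in> space borel. transpose A ** A = mat 1} \<inter> {A \<in> space borel. \<forall>i\<in>I. \<forall>j\<in>-I. A $ j $ i = 0}
    \<in> sets (borel :: (real^'n^'n) measure)" by blast
  moreover have "rot_stab I = {A \<in> space borel. transpose A ** A = mat 1} \<inter> {A \<in> space borel. \<forall>i\<in>I. \<forall>j\<in>-I. A $ j $ i = 0}"
    unfolding rot_stab_altdef by auto
  ultimately show ?thesis by simp
qed

definition rot_algebra :: "'n::finite set \<Rightarrow> (real^'n^'n) measure" where
  "rot_algebra I = restrict_space borel (rot_stab I)"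

lemma space_rot_algebra [simp]: "space (rot_algebra I) = rot_stab I"
  by (simp add: rot_algebra_def space_restrict_space)

lemma measurable_from_rot_algebra [measurable]: "(\<lambda>A. A) \<in> borel_measurable (rot_algebra I)"
  unfolding rot_algebra_def by (rule measurable_restrict_space1) simp

lemma measurable_into_rot_algebra:
  assumes "f \<in> borel_measurable M" "\<And>w. w \<in> space M \<Longrightarrow> f w \<in> rot_stab I"
  shows "f \<in> M \<rightarrow>\<^sub>M rot_algebra I"
  unfolding rot_algebra_def using assms by (intro measurable_restrict_space2) auto

text \<open>
  The identity matrix on the null set of degenerate samples makes all values of the random frame
  rotations.
\<close>

definition haar_rot :: "'n::finite set \<Rightarrow> (real^'n^'n) measure" where
  "haar_rot I = distr ball_samples (rot_algebra I)
     (\<lambda>g. if frame_matrix I (coord_space I) g \<in> rot_stab I then frame_matrix I (coord_space I) g else mat 1)"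

lemma sets_haar_rot [simp, measurable_cong]: "sets (haar_rot I) = sets (rot_algebra I)"
  and space_haar_rot [simp]: "space (haar_rot I) = rot_stab I"
  by (simp_all add: haar_rot_def)

lemma measurable_frame_matrix_coord [measurable]:
  "frame_matrix I (coord_space I) \<in> borel_measurable ball_samples"
proof -
  have "(\<lambda>w. frame_matrix I (coord_space I) ((\<lambda>w. w) w)) \<in> borel_measurable ball_samples"
    by (rule measurable_frame_matrix[where m = "card I"]) (auto simp: grass_def)
  then show ?thesis by simp
qed

lemma measurable_frame_rot:
  "(\<lambda>g. if frame_matrix I (coord_space I) g \<in> rot_stab I then frame_matrix I (coord_space I) g else mat 1)
     \<in> ball_samples \<rightarrow>\<^sub>M rot_algebra (I::'n::finite set)"
  by (rule measurable_into_rot_algebra) (measurable, auto simp: rot_stab_id)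

lemma prob_space_haar_rot: "prob_space (haar_rot I)"
  unfolding haar_rot_def by (rule ball_samples_prob.prob_space_distr[OF measurable_frame_rot])

interpretation haar_rot: prob_space "haar_rot I" for I by (rule prob_space_haar_rot)

lemma AE_frame_matrix_rot_stab: "AE g in ball_samples. frame_matrix I (coord_space I) g \<in> rot_stab (I::'n::finite set)"
proof -
  have "AE g in ball_samples. orthogonal_matrix (frame_matrix I (coord_space I) g)"
    by (rule AE_frame_matrix_orthogonal) auto
  then show ?thesis
    by eventually_elim (simp add: rot_stab_def frame_matrix_image)
qed

text \<open>
  Both the projections to the two blocks and Gram-Schmidt commute with rotations that preserve the
  blocks.
\<close>

lemma block_frame_rotate:
  assumes T: "T \<in> rot_stab (I::'n::finite set)"
  shows "block_frame I (coord_space I) (\<lambda>i. T *v g i) i = T *v block_frame I (coord_space I) g i"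
proof -
  have "orth_proj (block I (coord_space I) t) (T *v x) = T *v orth_proj (block I (coord_space I) t) x" for t x
  proof (rule orth_proj_unique)
    let ?B = "block I (coord_space I) t"
    show sb: "subspace ?B" by (simp add: subspace_block)
    have inv: "(*v) T ` ?B = ?B"
    proof -
      have "T \<in> rot_stab (- I)" using T by (simp add: rot_stab_compl)
      then show ?thesis
        using T unfolding block_def coord_space_orthogonal_comp rot_stab_def by simp
    qed
    show "T *v orth_proj ?B x \<in> ?B" using inv orth_proj_mem[OF sb] by blast
    have "T *v (x - orth_proj ?B x) \<in> (*v) T ` (?B\<^sup>\<bottom>)" using orth_proj_diff[OF sb] by blast
    then show "T *v x - T *v orth_proj ?B x \<in> ?B\<^sup>\<bottom>"
      by (simp add: orthogonal_matrix_orthogonal_comp[OF rot_stab_orthogonal[OF T], symmetric] inv matrix_vector_mult_diff_distrib)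
  qed
  then show ?thesis
    unfolding block_frame_def by (simp add: gram_schmidt_rotate[OF rot_stab_orthogonal[OF T]])
qed

lemma frame_matrix_rotate:
  assumes T: "T \<in> rot_stab (I::'n::finite set)"
  shows "frame_matrix I (coord_space I) (\<lambda>i. T *v g i) = T ** frame_matrix I (coord_space I) g"
  unfolding frame_matrix_def block_frame_rotate[OF T]
  by (simp add: vec_eq_iff matrix_vector_mult_def matrix_matrix_mult_def)

lemma measurable_rot_mult_left: 
  "T \<in> rot_stab (I::'n::finite set) \<Longrightarrow> (\<lambda>A. T ** A) \<in> rot_algebra I \<rightarrow>\<^sub>M rot_algebra I"
  by (rule measurable_into_rot_algebra) (measurable, auto simp: rot_stab_mult)

lemma measurable_rot_mult_right: 
  "T \<in> rot_stab (I::'n::finite set) \<Longrightarrow> (\<lambda>A. A ** T) \<in> rot_algebra I \<rightarrow>\<^sub>M rot_algebra I"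
  by (rule measurable_into_rot_algebra) (measurable, auto simp: rot_stab_mult)

lemma measurable_rot_transpose:
  "transpose \<in> rot_algebra (I::'n::finite set) \<rightarrow>\<^sub>M rot_algebra I"
  by (rule measurable_into_rot_algebra) (measurable, auto simp: rot_stab_transpose)

text \<open>
  Rotating the samples does not change their law, and it multiplies the frame matrix from the
  left.
\<close>

lemma haar_rot_left_invariant:
  assumes T: "T \<in> rot_stab (I::'n::finite set)"
  shows "distr (haar_rot I) (rot_algebra I) (\<lambda>A. T ** A) = haar_rot I"
proof -
  let ?F = "\<lambda>g. if frame_matrix I (coord_space I) g \<in> rot_stab I then frame_matrix I (coord_space I) g else mat 1"
  note mF = measurable_frame_rot[of I] and mT = measurable_rot_mult_left[OF T]
  have mR: "(\<lambda>g i. T *v g i) \<in> ball_samples \<rightarrow>\<^sub>M ball_samples"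
    unfolding ball_samples_def
    by (rule measurable_PiM_single') (auto simp flip: ball_samples_def cong: measurable_cong_sets simp: space_PiM)
  have "distr (haar_rot I) (rot_algebra I) (\<lambda>A. T ** A) = distr ball_samples (rot_algebra I) ((\<lambda>A. T ** A) \<circ> ?F)"
    unfolding haar_rot_def by (rule distr_distr[OF mT mF])
  also have "\<dots> = distr ball_samples (rot_algebra I) (?F \<circ> (\<lambda>g i. T *v g i))"
  proof (rule distr_cong_AE[OF refl refl])
    show "AE g in ball_samples. ((\<lambda>A. T ** A) \<circ> ?F) g = (?F \<circ> (\<lambda>g i. T *v g i)) g"
      using AE_frame_matrix_rot_stab[of I]
      by eventually_elim (use T in \<open>simp add: frame_matrix_rotate rot_stab_mult\<close>)
    show "(\<lambda>A. T ** A) \<circ> ?F \<in> ball_samples \<rightarrow>\<^sub>M rot_algebra I" by (rule measurable_comp[OF mF mT])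
    show "?F \<circ> (\<lambda>g i. T *v g i) \<in> ball_samples \<rightarrow>\<^sub>M rot_algebra I" by (rule measurable_comp[OF mR mF])
  qed
  also have "\<dots> = distr (distr ball_samples ball_samples (\<lambda>g i. T *v g i)) (rot_algebra I) ?F"
    by (rule distr_distr[OF mF mR, symmetric])
  also have "\<dots> = haar_rot I"
    unfolding haar_rot_def by (simp only: ball_samples_rotate[OF rot_stab_orthogonal[OF T]])
  finally show ?thesis .
qed

lemma nn_integral_haar_left:
  assumes T: "T \<in> rot_stab (I::'n::finite set)" and f: "f \<in> borel_measurable (rot_algebra I)"
  shows "(\<integral>\<^sup>+A. f (T ** A) \<partial>haar_rot I) = (\<integral>\<^sup>+A. f A \<partial>haar_rot I)"
  by (subst (2) haar_rot_left_invariant[OF T, symmetric], subst nn_integral_distr)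
     (use f measurable_rot_mult_left[OF T] in \<open>simp_all cong: measurable_cong_sets\<close>)

lemma haar_pair_measurable_transpose:
  assumes f: "f \<in> borel_measurable (rot_algebra (I::'n::finite set))"
  shows "(\<lambda>p. f (transpose (fst p) ** snd p)) \<in> borel_measurable (haar_rot I \<Otimes>\<^sub>M haar_rot I)"
proof (rule measurable_compose[OF _ f], rule measurable_into_rot_algebra)
  show "(\<lambda>p. transpose (fst p) ** snd p) \<in> borel_measurable (haar_rot I \<Otimes>\<^sub>M haar_rot I)"
    by measurable
qed (auto simp: space_pair_measure rot_stab_mult rot_stab_transpose)

text \<open>
  A left invariant and a right invariant probability measure on a group coincide: integrate f(xy)
  in both orders. Here the right invariant measure is the image under inversion, and inversion is
  transposition.
\<close>

lemma nn_integral_haar_transpose: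
  assumes f: "f \<in> borel_measurable (rot_algebra (I::'n::finite set))"
  shows "(\<integral>\<^sup>+A. f (transpose A) \<partial>haar_rot I) = (\<integral>\<^sup>+A. f A \<partial>haar_rot I)"
proof -
  interpret pair_sigma_finite "haar_rot I" "haar_rot I" ..
  have ft: "(\<lambda>A. f (transpose A)) \<in> borel_measurable (rot_algebra I)"
    by (rule measurable_compose[OF measurable_rot_transpose f])
  have "(\<integral>\<^sup>+A. f A \<partial>haar_rot I) = (\<integral>\<^sup>+x. (\<integral>\<^sup>+A. f A \<partial>haar_rot I) \<partial>haar_rot I)"
    by (simp add: haar_rot.emeasure_space_1[simplified])
  also have "\<dots> = (\<integral>\<^sup>+x. (\<integral>\<^sup>+y. f (transpose x ** y) \<partial>haar_rot I) \<partial>haar_rot I)"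
    by (rule nn_integral_cong, subst nn_integral_haar_left[OF _ f]) (auto simp: rot_stab_transpose)
  also have "\<dots> = (\<integral>\<^sup>+y. (\<integral>\<^sup>+x. f (transpose x ** y) \<partial>haar_rot I) \<partial>haar_rot I)"
    using haar_pair_measurable_transpose[OF f] by (intro Fubini'[symmetric]) (simp add: case_prod_beta')
  also have "\<dots> = (\<integral>\<^sup>+y. (\<integral>\<^sup>+x. f (transpose (transpose y ** x)) \<partial>haar_rot I) \<partial>haar_rot I)"
    by (simp add: matrix_transpose_mul)
  also have "\<dots> = (\<integral>\<^sup>+y. (\<integral>\<^sup>+x. f (transpose x) \<partial>haar_rot I) \<partial>haar_rot I)"
    by (rule nn_integral_cong, subst nn_integral_haar_left[OF _ ft]) (auto simp: rot_stab_transpose)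
  also have "\<dots> = (\<integral>\<^sup>+x. f (transpose x) \<partial>haar_rot I)"
    by (simp add: haar_rot.emeasure_space_1[simplified])
  finally show ?thesis by simp
qed

lemma nn_integral_haar_right:
  assumes T: "T \<in> rot_stab (I::'n::finite set)" and f: "f \<in> borel_measurable (rot_algebra I)"
  shows "(\<integral>\<^sup>+A. f (A ** T) \<partial>haar_rot I) = (\<integral>\<^sup>+A. f A \<partial>haar_rot I)"
proof -
  have ft: "(\<lambda>A. f (transpose A)) \<in> borel_measurable (rot_algebra I)"
    by (rule measurable_compose[OF measurable_rot_transpose f])
  have fT: "(\<lambda>A. f (A ** T)) \<in> borel_measurable (rot_algebra I)"
    by (rule measurable_compose[OF measurable_rot_mult_right[OF T] f])
  have "(\<integral>\<^sup>+A. f (A ** T) \<partial>haar_rot I) = (\<integral>\<^sup>+A. f (transpose A ** T) \<partial>haar_rot I)"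
    by (rule nn_integral_haar_transpose[OF fT, symmetric])
  also have "\<dots> = (\<integral>\<^sup>+A. f (transpose (transpose T ** A)) \<partial>haar_rot I)"
    by (simp add: matrix_transpose_mul)
  also have "\<dots> = (\<integral>\<^sup>+A. f (transpose A) \<partial>haar_rot I)"
    by (rule nn_integral_haar_left[OF rot_stab_transpose[OF T] ft])
  also have "\<dots> = (\<integral>\<^sup>+A. f A \<partial>haar_rot I)" by (rule nn_integral_haar_transpose[OF f])
  finally show ?thesis .
qed

section \<open>The invariant measure on a Grassmannian\<close>

lemma rotate_mem_grass:
  fixes A :: "real^'n::finite^'n"
  assumes "orthogonal_matrix A" "S \<in> grass X m" shows "(*v) A ` S \<in> grass ((*v) A ` X) m"
  using assms by (auto simp: grass_def orthogonal_matrix_subspace orthogonal_matrix_dim)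

lemma measurable_rotate_grass:
  assumes A: "orthogonal_matrix (A::real^'n::finite^'n)"
  shows "(\<lambda>S. (*v) A ` S) \<in> plane_algebra (grass X m) \<rightarrow>\<^sub>M plane_algebra (grass ((*v) A ` X) m)"
  by (rule measurable_rotate_plane[OF measurable_ident_sets[OF refl]]) (use A in \<open>auto intro: rotate_mem_grass\<close>)

lemma measurable_rot_grass:
  fixes B :: "real^'n::finite^'n"
  assumes J: "J \<subseteq> I" "card J = m" and B: "orthogonal_matrix B"
  shows "(\<lambda>A. (*v) (B ** A) ` coord_space J) \<in> rot_algebra I \<rightarrow>\<^sub>M plane_algebra (grass ((*v) B ` coord_space I) m)"
proof (rule measurable_rotate_plane[where G = "grass UNIV m"])
  show "(\<lambda>A. coord_space J) \<in> rot_algebra I \<rightarrow>\<^sub>M plane_algebra (grass UNIV m)"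
    using J by (intro measurable_const) (simp add: grass_def)
  show "(\<lambda>A. B ** A) \<in> borel_measurable (rot_algebra I)" by measurable
  fix A assume "A \<in> space (rot_algebra I)"
  then have A: "orthogonal_matrix A" "(*v) A ` coord_space I = coord_space I" by (auto simp: rot_stab_def)
  then show BA: "orthogonal_matrix (B ** A)" using B by (simp add: orthogonal_matrix_mul)
  have "coord_space J \<in> grass (coord_space I) m" using J by (simp add: grass_def coord_space_mono)
  from rotate_mem_grass[OF B rotate_mem_grass[OF A(1) this]]
  show "(*v) (B ** A) ` coord_space J \<in> grass ((*v) B ` coord_space I) m"
    by (simp add: image_matrix_mul A(2))
qed auto

lemma orthogonal_transformation_as_matrix:
  fixes T :: "real^'n::finite \<Rightarrow> real^'n"
  assumes "orthogonal_transformation T"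
  obtains A where "orthogonal_matrix A" "T = (*v) A"
  using assms orthogonal_transformation_matrix[of T] by (metis matrix_vector_mul)

text \<open>
  Existence: the image of Haar measure on the stabilizer of X is invariant because Haar measure is
  left invariant. Uniqueness: an invariant measure equals its average over all rotations g that
  preserve X. After exchanging the integrations, the integral over g does not depend on the plane
  S, because S is a rotated copy of a fixed plane and Haar measure is right invariant.
\<close>

lemma rotation_invariant_prob_iff:
  fixes B :: "real^'n::finite^'n"
  assumes J: "J \<subseteq> I" "card J = m" and B: "orthogonal_matrix B"
  defines "X \<equiv> (*v) B ` coord_space I"
  shows "rotation_invariant_prob X m M \<longleftrightarrow>
    M = distr (haar_rot I) (plane_algebra (grass X m)) (\<lambda>A. (*v) (B ** A) ` coord_space J)"
proof
  let ?G = "plane_algebra (grass X m)" and ?f = "\<lambda>A. (*v) (B ** A) ` coord_space J"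
  let ?D = "distr (haar_rot I) ?G ?f"
  have mf: "?f \<in> haar_rot I \<rightarrow>\<^sub>M ?G"
    using measurable_rot_grass[OF J B] by (simp add: X_def cong: measurable_cong_sets)
  have Bt: "transpose B ** B = mat 1" "B ** transpose B = mat 1" using B by (simp_all add: orthogonal_matrix_def)
  \<comment> \<open>conjugation by B turns rotations that preserve X into rotations that preserve the coordinate subspace\<close>
  have conj: "transpose B ** C ** B \<in> rot_stab I" if C: "orthogonal_matrix C" "(*v) C ` X = X" for C
  proof -
    have "(*v) (transpose B ** C ** B) ` coord_space I = (*v) (transpose B) ` ((*v) C ` X)"
      by (simp only: image_matrix_mul X_def)
    also have "\<dots> = (*v) (transpose B) ` X" by (simp only: C(2))
    also have "\<dots> = (*v) (transpose B ** B) ` coord_space I" by (simp only: X_def image_matrix_mul)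
    finally show ?thesis using B C by (simp add: Bt rot_stab_def orthogonal_matrix_mul)
  qed
  {
    assume M: "M = ?D"
    show "rotation_invariant_prob X m M"
      unfolding rotation_invariant_prob_def
    proof (intro conjI allI impI)
      show "space M = grass X m" "sets M = sets ?G" by (simp_all add: M)
      show "prob_space M" unfolding M by (rule haar_rot.prob_space_distr[OF mf])
      fix T :: "real^'n \<Rightarrow> real^'n" assume T: "orthogonal_transformation T \<and> T ` X = X"
      then obtain C where C: "orthogonal_matrix C" "T = (*v) C" using orthogonal_transformation_as_matrix by blast
      then have CX: "(*v) C ` X = X" using T by simp
      let ?C = "transpose B ** C ** B"
      have mT: "(\<lambda>S. (*v) C ` S) \<in> ?G \<rightarrow>\<^sub>M ?G" using measurable_rotate_grass[OF C(1), of X m] by (simp add: CX)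
      have mC: "(\<lambda>A. ?C ** A) \<in> haar_rot I \<rightarrow>\<^sub>M rot_algebra I"
        using measurable_rot_mult_left[OF conj[OF C(1) CX]] by (simp cong: measurable_cong_sets)
      have mf': "?f \<in> rot_algebra I \<rightarrow>\<^sub>M ?G" using mf by (simp cong: measurable_cong_sets)
      have "distr M M (\<lambda>S. T ` S) = distr ?D ?G (\<lambda>S. (*v) C ` S)"
        by (intro distr_cong) (simp_all add: M C)
      also have "\<dots> = distr (haar_rot I) ?G ((\<lambda>S. (*v) C ` S) \<circ> ?f)"
        by (rule distr_distr[OF mT mf])
      also have "(\<lambda>S. (*v) C ` S) \<circ> ?f = ?f \<circ> (\<lambda>A. ?C ** A)"
      proof
        fix A :: "real^'n^'n"
        have "B ** (?C ** A) = (B ** transpose B) ** C ** B ** A" by (simp only: matrix_mul_assoc)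
        then have "C ** (B ** A) = B ** (?C ** A)" by (simp add: Bt matrix_mul_assoc)
        then show "((\<lambda>S. (*v) C ` S) \<circ> ?f) A = (?f \<circ> (\<lambda>A. ?C ** A)) A"
          by (simp only: o_def image_matrix_mul[symmetric])
      qed
      also have "distr (haar_rot I) ?G (?f \<circ> (\<lambda>A. ?C ** A)) = distr (distr (haar_rot I) (rot_algebra I) (\<lambda>A. ?C ** A)) ?G ?f"
        by (rule distr_distr[OF mf' mC, symmetric])
      also have "\<dots> = M" unfolding M by (simp only: haar_rot_left_invariant[OF conj[OF C(1) CX]])
      finally show "distr M M (\<lambda>S. T ` S) = M" .
    qed
  }
  {
    assume "rotation_invariant_prob X m M"
    then have M: "space M = grass X m" "sets M = sets ?G" "prob_space M"
      and inv: "\<And>T. orthogonal_transformation T \<Longrightarrow> T ` X = X \<Longrightarrow> distr M M (\<lambda>S. T ` S) = M"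
      by (auto simp: rotation_invariant_prob_def)
    interpret M: prob_space M by fact
    interpret P: pair_sigma_finite "haar_rot I" M ..
    have mM: "measurable M N = measurable ?G N" "measurable N M = measurable N ?G" for N :: "'z measure"
      using M(2) by (simp_all cong: measurable_cong_sets)
    \<comment> \<open>conversely, a rotation of the coordinate subspace becomes a rotation that preserves X\<close>
    define g where "g A = B ** A ** transpose B" for A :: "real^'n^'n"
    have g: "orthogonal_matrix (g A)" "(*v) (g A) ` X = X" if "A \<in> rot_stab I" for A
    proof -
      show "orthogonal_matrix (g A)" using B rot_stab_orthogonal[OF that] by (simp add: g_def orthogonal_matrix_mul)
      have "(*v) (g A) ` X = (*v) (B ** A ** transpose B ** B) ` coord_space I"
        by (simp only: image_matrix_mul g_def X_def)
      also have "B ** A ** transpose B ** B = B ** A" by (simp add: Bt flip: matrix_mul_assoc)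
      also have "(*v) (B ** A) ` coord_space I = X" using that by (simp add: image_matrix_mul rot_stab_def X_def)
      finally show "(*v) (g A) ` X = X" .
    qed
    show "M = ?D"
    proof (rule measure_eqI)
      fix E assume "E \<in> sets M"
      then have E[measurable]: "E \<in> sets ?G" by (simp add: M)
      have joint: "(\<lambda>(A, S). (*v) (g A) ` S) \<in> haar_rot I \<Otimes>\<^sub>M M \<rightarrow>\<^sub>M ?G"
        unfolding case_prod_beta'
      proof (rule measurable_rotate_plane[where G = "grass X m"])
        have "snd \<in> haar_rot I \<Otimes>\<^sub>M M \<rightarrow>\<^sub>M M" by simp
        then show "snd \<in> haar_rot I \<Otimes>\<^sub>M M \<rightarrow>\<^sub>M ?G" by (simp add: mM)
        show "(\<lambda>p. g (fst p)) \<in> borel_measurable (haar_rot I \<Otimes>\<^sub>M M)" unfolding g_def by measurable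
        fix p assume p: "p \<in> space (haar_rot I \<Otimes>\<^sub>M M)"
        then have p': "fst p \<in> rot_stab I" "snd p \<in> grass X m" by (auto simp: space_pair_measure M)
        then show "orthogonal_matrix (g (fst p))" using g by simp
        show "(*v) (g (fst p)) ` snd p \<in> grass X m"
          using rotate_mem_grass[OF g(1) p'(2)] g(2) p'(1) by simp
      qed auto
      have mE: "(\<lambda>(A, S). indicator E ((*v) (g A) ` S) :: ennreal) \<in> borel_measurable (haar_rot I \<Otimes>\<^sub>M M)"
        using measurable_compose[OF joint borel_measurable_indicator[OF E]] by (simp add: case_prod_beta')
      have "emeasure M E = (\<integral>\<^sup>+A. emeasure M E \<partial>haar_rot I)"
        by (simp add: haar_rot.emeasure_space_1[simplified])
      also have "\<dots> = (\<integral>\<^sup>+A. (\<integral>\<^sup>+S. indicator E ((*v) (g A) ` S) \<partial>M) \<partial>haar_rot I)"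
      proof (rule nn_integral_cong)
        fix A assume "A \<in> space (haar_rot I)"
        then have A: "A \<in> rot_stab I" by simp
        have mA: "(\<lambda>S. (*v) (g A) ` S) \<in> M \<rightarrow>\<^sub>M M"
          using measurable_rotate_grass[OF g(1)[OF A], of X m] by (simp add: g(2)[OF A] mM)
        have "emeasure M E = emeasure (distr M M (\<lambda>S. (*v) (g A) ` S)) E"
          by (subst inv) (simp_all add: orthogonal_matrix_orthogonal_transformation g[OF A])
        also have "\<dots> = (\<integral>\<^sup>+S. indicator E S \<partial>distr M M (\<lambda>S. (*v) (g A) ` S))"
          using E by (simp add: M)
        also have "\<dots> = (\<integral>\<^sup>+S. indicator E ((*v) (g A) ` S) \<partial>M)"
          by (rule nn_integral_distr[OF mA], rule borel_measurable_indicator) (use E M in simp)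
        finally show "emeasure M E = (\<integral>\<^sup>+S. indicator E ((*v) (g A) ` S) \<partial>M)" .
      qed
      also have "\<dots> = (\<integral>\<^sup>+S. (\<integral>\<^sup>+A. indicator E ((*v) (g A) ` S) \<partial>haar_rot I) \<partial>M)"
        by (rule P.Fubini'[OF mE, symmetric])
      also have "\<dots> = (\<integral>\<^sup>+S. emeasure ?D E \<partial>M)"
      proof (rule nn_integral_cong)
        fix S assume "S \<in> space M"
        then have S: "S \<in> grass X m" by (simp add: M)
        have "(*v) (transpose B) ` X = coord_space I"
          unfolding X_def by (simp add: image_image orthogonal_matrix_transpose_mult[OF B])
        then have S': "(*v) (transpose B) ` S \<in> grass (coord_space I) m"
          using rotate_mem_grass[of "transpose B", OF _ S] B by simp
        then have "subspace ((*v) (transpose B) ` S)" "(*v) (transpose B) ` S \<subseteq> coord_space I"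
            "dim ((*v) (transpose B) ` S) = card J"
          using J(2) unfolding grass_def by auto
        then obtain h where h: "orthogonal_matrix h" "(*v) h ` coord_space J = (*v) (transpose B) ` S"
           "\<And>x. x \<in> coord_space (- I) \<Longrightarrow> h *v x = x"
          using coord_space_moved_to_subspace[OF J(1)] by metis
        have "(*v) h ` coord_space (- I) = coord_space (- I)" using h(3) by (simp cong: image_cong)
        then have "h \<in> rot_stab (- I)" using h(1) by (simp add: rot_stab_def)
        then have hI: "h \<in> rot_stab I" by (simp add: rot_stab_compl)
        have eq: "(*v) (g A) ` S = ?f (A ** h)" for A
          by (simp only: g_def image_matrix_mul h(2))
        have mi: "(\<lambda>A. indicator E (?f A) :: ennreal) \<in> borel_measurable (rot_algebra I)"
          using measurable_compose[OF mf borel_measurable_indicator[OF E]] by (simp cong: measurable_cong_sets)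
        have "(\<integral>\<^sup>+A. indicator E ((*v) (g A) ` S) \<partial>haar_rot I) = (\<integral>\<^sup>+A. indicator E (?f (A ** h)) \<partial>haar_rot I)"
          by (simp only: eq)
        also have "\<dots> = (\<integral>\<^sup>+A. indicator E (?f A) \<partial>haar_rot I)"
          by (rule nn_integral_haar_right[OF hI mi])
        also have "\<dots> = (\<integral>\<^sup>+S. indicator E S \<partial>?D)"
          by (rule nn_integral_distr[OF mf, symmetric]) simp
        also have "\<dots> = emeasure ?D E" by (simp add: E)
        finally show "(\<integral>\<^sup>+A. indicator E ((*v) (g A) ` S) \<partial>haar_rot I) = emeasure ?D E" .
      qed
      also have "\<dots> = emeasure ?D E" by (simp add: M.emeasure_space_1)
      finally show "emeasure M E = emeasure ?D E" .
    qed (simp add: M)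
  }
qed

lemma grass_measure_eq_distr:
  fixes B :: "real^'n::finite^'n"
  assumes J: "J \<subseteq> I" "card J = m" and B: "orthogonal_matrix B"
  shows "grass_measure ((*v) B ` coord_space I) m =
    distr (haar_rot I) (plane_algebra (grass ((*v) B ` coord_space I) m)) (\<lambda>A. (*v) (B ** A) ` coord_space J)"
  unfolding grass_measure_def rotation_invariant_prob_iff[OF J B] by simp

section \<open>Measures fibred over a kernel\<close>

text \<open>
  The condition under which the iterated integral in the definition of a fibred measure is
  countably additive.
\<close>

definition measurable_kernel :: "'b measure \<Rightarrow> 'c measure \<Rightarrow> ('b \<Rightarrow> 'c measure) \<Rightarrow> bool" where
  "measurable_kernel M N K \<longleftrightarrow> (\<forall>x\<in>space M. sets (K x) = sets N) \<and>
     (\<forall>E\<in>sets (M \<Otimes>\<^sub>M N). (\<lambda>x. \<integral>\<^sup>+y. indicator E (x, y) \<partial>K x) \<in> borel_measurable M)"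

context
  fixes M :: "'b measure" and N :: "'c measure" and K :: "'b \<Rightarrow> 'c measure"
  assumes K: "measurable_kernel M N K"
begin

lemma sets_kernel: "x \<in> space M \<Longrightarrow> sets (K x) = sets N"
  using K by (simp add: measurable_kernel_def)

lemma measurable_section_kernel:
  assumes f: "f \<in> borel_measurable (M \<Otimes>\<^sub>M N)" and x: "x \<in> space M"
  shows "(\<lambda>y. f (x, y)) \<in> borel_measurable (K x)"
proof -
  have "(\<lambda>y. f (x, y)) \<in> borel_measurable N"
    by (rule measurable_compose[OF measurable_Pair1'[OF x] f])
  then show ?thesis using sets_kernel[OF x] by (simp cong: measurable_cong_sets)
qed

lemma sets_fibred_measure: "sets (fibred_measure M N K) = sets (M \<Otimes>\<^sub>M N)"
  unfolding fibred_measure_def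
  using sets.space_closed[of "M \<Otimes>\<^sub>M N"] sets.sigma_sets_eq[of "M \<Otimes>\<^sub>M N"]
  by (simp add: space_pair_measure)

lemma space_fibred_measure: "space (fibred_measure M N K) = space M \<times> space N"
  using sets_eq_imp_space_eq[OF sets_fibred_measure] by (simp add: space_pair_measure)

lemma emeasure_fibred_measure:
  assumes E: "E \<in> sets (M \<Otimes>\<^sub>M N)"
  shows "emeasure (fibred_measure M N K) E = (\<integral>\<^sup>+x. (\<integral>\<^sup>+y. indicator E (x, y) \<partial>K x) \<partial>M)"
proof (rule emeasure_measure_of[OF fibred_measure_def])
  show "sets (M \<Otimes>\<^sub>M N) \<subseteq> Pow (space M \<times> space N)"
    using sets.space_closed[of "M \<Otimes>\<^sub>M N"] by (simp add: space_pair_measure)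
  show "positive (sets (fibred_measure M N K)) (\<lambda>E. \<integral>\<^sup>+x. (\<integral>\<^sup>+y. indicator E (x, y) \<partial>K x) \<partial>M)"
    by (simp add: positive_def)
  show "countably_additive (sets (fibred_measure M N K)) (\<lambda>E. \<integral>\<^sup>+x. (\<integral>\<^sup>+y. indicator E (x, y) \<partial>K x) \<partial>M)"
    unfolding sets_fibred_measure
  proof (rule countably_additiveI)
    fix A :: "nat \<Rightarrow> ('b \<times> 'c) set"
    assume A: "range A \<subseteq> sets (M \<Otimes>\<^sub>M N)" "disjoint_family A" "\<Union> (range A) \<in> sets (M \<Otimes>\<^sub>M N)"
    have Ai: "A i \<in> sets (M \<Otimes>\<^sub>M N)" for i using A by auto
    have "(\<Sum>i. \<integral>\<^sup>+x. (\<integral>\<^sup>+y. indicator (A i) (x, y) \<partial>K x) \<partial>M) = (\<integral>\<^sup>+x. (\<Sum>i. \<integral>\<^sup>+y. indicator (A i) (x, y) \<partial>K x) \<partial>M)"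
      using K Ai by (intro nn_integral_suminf[symmetric]) (simp add: measurable_kernel_def)
    also have "\<dots> = (\<integral>\<^sup>+x. (\<integral>\<^sup>+y. (\<Sum>i. indicator (A i) (x, y)) \<partial>K x) \<partial>M)"
      using Ai by (intro nn_integral_cong nn_integral_suminf[symmetric] measurable_section_kernel) auto
    also have "\<dots> = (\<integral>\<^sup>+x. (\<integral>\<^sup>+y. indicator (\<Union> (range A)) (x, y) \<partial>K x) \<partial>M)"
      by (simp add: suminf_indicator[OF A(2)])
    finally show "(\<Sum>i. \<integral>\<^sup>+x. (\<integral>\<^sup>+y. indicator (A i) (x, y) \<partial>K x) \<partial>M) =
       (\<integral>\<^sup>+x. (\<integral>\<^sup>+y. indicator (\<Union> (range A)) (x, y) \<partial>K x) \<partial>M)" .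
  qed
qed (use E sets_fibred_measure in auto)

lemma measurable_nn_integral_kernel:
  assumes f: "f \<in> borel_measurable (M \<Otimes>\<^sub>M N)"
  shows "(\<lambda>x. \<integral>\<^sup>+y. f (x, y) \<partial>K x) \<in> borel_measurable M"
  using f
proof induct
  case (cong f g)
  have "(\<integral>\<^sup>+y. f (x, y) \<partial>K x) = (\<integral>\<^sup>+y. g (x, y) \<partial>K x)" if x: "x \<in> space M" for x
    using cong(3) sets_eq_imp_space_eq[OF sets_kernel[OF x]] x
    by (intro nn_integral_cong) (auto simp: space_pair_measure)
  then show ?case using cong(4) by (subst measurable_cong) auto
next
  case (set A) then show ?case using K by (simp add: measurable_kernel_def)
next
  case (mult u c)
  have "(\<lambda>x. c * (\<integral>\<^sup>+y. u (x, y) \<partial>K x)) \<in> borel_measurable M" using mult by simp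
  then show ?case
    by (rule measurable_cong[THEN iffD1, rotated]) (simp add: nn_integral_cmult measurable_section_kernel mult)
next
  case (add u v)
  have "(\<lambda>x. (\<integral>\<^sup>+y. u (x, y) \<partial>K x) + (\<integral>\<^sup>+y. v (x, y) \<partial>K x)) \<in> borel_measurable M" using add by simp
  then show ?case
    by (rule measurable_cong[THEN iffD1, rotated]) (simp add: nn_integral_add measurable_section_kernel add)
next
  case (seq U)
  have "(\<lambda>x. SUP i. (\<integral>\<^sup>+y. U i (x, y) \<partial>K x)) \<in> borel_measurable M" using seq by simp
  then show ?case
  proof (rule measurable_cong[THEN iffD1, rotated])
    fix x assume x: "x \<in> space M"
    have "(\<integral>\<^sup>+y. (SUP i. U i (x, y)) \<partial>K x) = (SUP i. \<integral>\<^sup>+y. U i (x, y) \<partial>K x)"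
      using seq x by (intro nn_integral_monotone_convergence_SUP measurable_section_kernel) (auto simp: incseq_def le_fun_def)
    then show "(SUP i. \<integral>\<^sup>+y. U i (x, y) \<partial>K x) = (\<integral>\<^sup>+y. (SUP i. U i) (x, y) \<partial>K x)"
      by (simp add: image_comp)
  qed
qed

lemma nn_integral_fibred_measure:
  assumes f: "f \<in> borel_measurable (M \<Otimes>\<^sub>M N)"
  shows "(\<integral>\<^sup>+z. f z \<partial>fibred_measure M N K) = (\<integral>\<^sup>+x. (\<integral>\<^sup>+y. f (x, y) \<partial>K x) \<partial>M)"
  using f
proof induct
  case (cong f g)
  have "(\<integral>\<^sup>+y. f (x, y) \<partial>K x) = (\<integral>\<^sup>+y. g (x, y) \<partial>K x)" if x: "x \<in> space M" for x
    using cong(3) sets_eq_imp_space_eq[OF sets_kernel[OF x]] x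
    by (intro nn_integral_cong) (auto simp: space_pair_measure)
  moreover have "(\<integral>\<^sup>+z. f z \<partial>fibred_measure M N K) = (\<integral>\<^sup>+z. g z \<partial>fibred_measure M N K)"
    using cong(3) by (intro nn_integral_cong) (auto simp: space_fibred_measure space_pair_measure)
  ultimately show ?case using cong(4) by (simp cong: nn_integral_cong)
next
  case (set A) then show ?case
    by (simp add: emeasure_fibred_measure[symmetric] sets_fibred_measure)
next
  case (mult u c)
  have "u \<in> borel_measurable (fibred_measure M N K)" using mult by (simp add: sets_fibred_measure cong: measurable_cong_sets)
  then show ?case using mult
    by (simp add: nn_integral_cmult measurable_section_kernel measurable_nn_integral_kernel cong: nn_integral_cong)
next
  case (add u v)
  have "u \<in> borel_measurable (fibred_measure M N K)" "v \<in> borel_measurable (fibred_measure M N K)"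
    using add by (simp_all add: sets_fibred_measure cong: measurable_cong_sets)
  then show ?case using add
    by (simp add: nn_integral_add measurable_section_kernel measurable_nn_integral_kernel cong: nn_integral_cong)
next
  case (seq U)
  have U: "U i \<in> borel_measurable (fibred_measure M N K)" for i
    using seq by (simp add: sets_fibred_measure cong: measurable_cong_sets)
  have "(\<integral>\<^sup>+z. (SUP i. U i z) \<partial>fibred_measure M N K) = (SUP i. \<integral>\<^sup>+z. U i z \<partial>fibred_measure M N K)"
    using seq U by (intro nn_integral_monotone_convergence_SUP) auto
  also have "\<dots> = (SUP i. \<integral>\<^sup>+x. (\<integral>\<^sup>+y. U i (x, y) \<partial>K x) \<partial>M)"
    using seq by simp
  also have "\<dots> = (\<integral>\<^sup>+x. (SUP i. \<integral>\<^sup>+y. U i (x, y) \<partial>K x) \<partial>M)"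
    using seq by (intro nn_integral_monotone_convergence_SUP[symmetric] measurable_nn_integral_kernel)
       (auto simp: incseq_def le_fun_def intro!: nn_integral_mono)
  also have "\<dots> = (\<integral>\<^sup>+x. (\<integral>\<^sup>+y. (SUP i. U i (x, y)) \<partial>K x) \<partial>M)"
    using seq by (intro nn_integral_cong nn_integral_monotone_convergence_SUP[symmetric] measurable_section_kernel)
       (auto simp: incseq_def le_fun_def)
  finally show ?case by (simp add: image_comp)
qed

end

section \<open>Lebesgue measure on a varying subspace\<close>

lemma obtain_coord_rotation:
  fixes S :: "(real^'n::finite) set" and I :: "'n set"
  assumes "subspace S" "dim S = card I"
  obtains A where "orthogonal_matrix A" "(*v) A ` coord_space I = S"
proof -
  have "S \<subseteq> coord_space UNIV" by simp
  from coord_space_moved_to_subspace[OF subset_UNIV assms(1) this assms(2)]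
  obtain A where "orthogonal_matrix A" "(*v) A ` coord_space I = S" by blast
  then show ?thesis by (rule that)
qed

lemma orth_proj_rotated_coord_space:
  fixes A :: "real^'n::finite^'n"
  assumes A: "orthogonal_matrix A"
  shows "orth_proj ((*v) A ` coord_space I) (A *v x) = A *v coord_proj I x"
proof (rule orth_proj_unique)
  show "subspace ((*v) A ` coord_space I)" by (rule orthogonal_matrix_subspace[OF A]) simp
  show "A *v coord_proj I x \<in> (*v) A ` coord_space I" by simp
  show "A *v x - A *v coord_proj I x \<in> ((*v) A ` coord_space I)\<^sup>\<bottom>"
    unfolding orthogonal_matrix_orthogonal_comp[OF A] coord_space_orthogonal_comp
    by (simp add: coord_proj_compl flip: matrix_vector_mult_diff_distrib)
qed

lemma sets_lborel_on [simp]: "sets (lborel_on X) = sets borel"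
  by (simp add: lborel_on_def Let_def)

text \<open>
  The right-hand side depends on Y only through its dimension and its orthogonal projection.
\<close>

lemma nn_integral_lborel_on_slab:
  fixes Y :: "(real^'n::finite) set" and I :: "'n set"
  assumes Y: "subspace Y" "dim Y = card I" and [measurable]: "h \<in> borel_measurable borel"
  shows "(\<integral>\<^sup>+y. h y \<partial>lborel_on Y) =
    (\<integral>\<^sup>+x. h (orth_proj Y x) * indicator (cball 0 1) (x - orth_proj Y x) \<partial>lborel) /
      emeasure (coord_lebesgue (- I)) (cball 0 1)"
proof -
  let ?v = "emeasure (coord_lebesgue (- I)) (cball 0 1)"
  have v: "?v \<noteq> 0" "?v \<noteq> \<infinity>" using emeasure_coord_lebesgue_cball_pos_finite[of 1 "- I"] by auto
  obtain A where A: "orthogonal_matrix A" "(*v) A ` coord_space I = Y" using obtain_coord_rotation[OF Y] .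
  have Yg: "(\<lambda>x. Y) \<in> borel \<rightarrow>\<^sub>M plane_algebra (grass UNIV (card I))"
    using Y by (intro measurable_const) (simp add: grass_def)
  have [measurable]: "orth_proj Y \<in> borel_measurable borel"
    using measurable_orth_proj[OF Yg measurable_ident_sets[OF refl]] .
  have "(\<integral>\<^sup>+y. h y \<partial>lborel_on Y) * ?v = (\<integral>\<^sup>+y. h (A *v y) \<partial>coord_lebesgue I) * ?v"
    unfolding A(2)[symmetric] lborel_on_rotated_coord_space[OF A(1)] by (subst nn_integral_distr) simp_all
  also have "\<dots> = (\<integral>\<^sup>+x. h (A *v coord_proj I x) * indicator (cball 0 1) (coord_proj (- I) x) \<partial>lborel)"
    by (rule coord_lebesgue_as_slab[symmetric]) measurable
  also have "\<dots> = (\<integral>\<^sup>+x. h (orth_proj Y (A *v x)) * indicator (cball 0 1) (A *v x - orth_proj Y (A *v x)) \<partial>lborel)"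
    unfolding A(2)[symmetric] orth_proj_rotated_coord_space[OF A(1)]
    by (intro nn_integral_cong) (simp add: indicator_def orthogonal_matrix_norm[OF A(1)] coord_proj_compl
       flip: matrix_vector_mult_diff_distrib)
  also have "\<dots> = (\<integral>\<^sup>+x. h (orth_proj Y x) * indicator (cball 0 1) (x - orth_proj Y x) \<partial>distr lborel borel ((*v) A))"
    by (subst nn_integral_distr) simp_all
  also have "distr lborel borel ((*v) A) = lborel" by (rule lborel_rotation_invariant[OF A(1)])
  finally have "(\<integral>\<^sup>+y. h y \<partial>lborel_on Y) * ?v =
    (\<integral>\<^sup>+x. h (orth_proj Y x) * indicator (cball 0 1) (x - orth_proj Y x) \<partial>lborel)" .
  then have eq: "((\<integral>\<^sup>+y. h y \<partial>lborel_on Y) * ?v) / ?v =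
    (\<integral>\<^sup>+x. h (orth_proj Y x) * indicator (cball 0 1) (x - orth_proj Y x) \<partial>lborel) / ?v" by (rule arg_cong)
  have "?v / ?v = 1" using v by (intro ennreal_divide_self) (auto simp: less_top)
  then have "((\<integral>\<^sup>+y. h y \<partial>lborel_on Y) * ?v) / ?v = (\<integral>\<^sup>+y. h y \<partial>lborel_on Y)"
    by (simp only: ennreal_times_divide[symmetric] mult.right_neutral)
  then show ?thesis using eq by (rule subst)
qed

text \<open>
  In the slab formula the subspace enters only through the projection, so measurability of the
  projections in the parameter is enough.
\<close>

lemma measurable_kernel_lborel_on:
  fixes Y :: "'b \<Rightarrow> (real^'n::finite) set"
  assumes Y: "\<And>z. z \<in> space M \<Longrightarrow> subspace (Y z)" "\<And>z. z \<in> space M \<Longrightarrow> dim (Y z) = d"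
    and m: "(\<lambda>p. orth_proj (Y (fst p)) (snd p)) \<in> borel_measurable (M \<Otimes>\<^sub>M borel)"
  shows "measurable_kernel M borel (\<lambda>z. lborel_on (Y z))"
proof (cases "space M = {}")
  case True
  then show ?thesis by (simp add: measurable_kernel_def measurable_def)
next
  case False
  then obtain z0 where "z0 \<in> space M" by auto
  then have "d \<le> CARD('n)" using dim_subset_UNIV[of "Y z0"] Y by simp
  then obtain I :: "'n set" where I: "card I = d" using obtain_subset_with_card_n by metis
  let ?v = "emeasure (coord_lebesgue (- I)) (cball 0 1)"
  have m'[measurable]: "(\<lambda>(z, x). orth_proj (Y z) x) \<in> borel_measurable (M \<Otimes>\<^sub>M lborel)"
    using m by (simp add: case_prod_beta' cong: measurable_cong_sets sets_pair_measure_cong)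
  show ?thesis
    unfolding measurable_kernel_def
  proof (intro conjI ballI)
    fix E assume [measurable]: "E \<in> sets (M \<Otimes>\<^sub>M (borel :: (real^'n) measure))"
    have [measurable]: "indicator E \<in> borel_measurable (M \<Otimes>\<^sub>M borel)" by simp
    have "(\<lambda>z. (\<integral>\<^sup>+x. indicator E (z, orth_proj (Y z) x) * indicator (cball 0 1) (x - orth_proj (Y z) x) \<partial>lborel) / ?v)
       \<in> borel_measurable M"
      by measurable
    then show "(\<lambda>z. \<integral>\<^sup>+y. indicator E (z, y) \<partial>lborel_on (Y z)) \<in> borel_measurable M"
    proof (rule measurable_cong[THEN iffD1, rotated])
      fix z assume z: "z \<in> space M"
      have "(\<lambda>y. indicator E (z, y) :: ennreal) \<in> borel_measurable borel"
        using z by measurable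
      from nn_integral_lborel_on_slab[OF Y(1)[OF z] Y(2)[OF z, folded I] this]
      show "(\<integral>\<^sup>+x. indicator E (z, orth_proj (Y z) x) * indicator (cball 0 1) (x - orth_proj (Y z) x) \<partial>lborel) / ?v =
         (\<integral>\<^sup>+y. indicator E (z, y) \<partial>lborel_on (Y z))" by simp
    qed
  qed simp
qed

section \<open>Grassmannian and affine measures in coordinates\<close>

lemma grass_measure_UNIV_eq_distr:
  assumes "card (J :: 'n::finite set) = m"
  shows "grass_measure (UNIV :: (real^'n) set) m =
    distr (haar_rot UNIV) (plane_algebra (grass UNIV m)) (\<lambda>A. (*v) A ` coord_space J)"
  using grass_measure_eq_distr[OF subset_UNIV assms orthogonal_matrix_id] by simp

lemma sets_grass_measure_rotated:
  fixes B :: "real^'n::finite^'n"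
  assumes "m \<le> card I" "orthogonal_matrix B"
  shows "sets (grass_measure ((*v) B ` coord_space I) m) = sets (plane_algebra (grass ((*v) B ` coord_space I) m))"
    and "space (grass_measure ((*v) B ` coord_space I) m) = grass ((*v) B ` coord_space I) m"
    and "prob_space (grass_measure ((*v) B ` coord_space I) m)"
proof -
  obtain J where J: "J \<subseteq> I" "card J = m" using assms(1) by (meson obtain_subset_with_card_n)
  show "sets (grass_measure ((*v) B ` coord_space I) m) = sets (plane_algebra (grass ((*v) B ` coord_space I) m))"
    "space (grass_measure ((*v) B ` coord_space I) m) = grass ((*v) B ` coord_space I) m"
    by (simp_all add: grass_measure_eq_distr[OF J assms(2)])
  show "prob_space (grass_measure ((*v) B ` coord_space I) m)"
    unfolding grass_measure_eq_distr[OF J assms(2)]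
    by (rule haar_rot.prob_space_distr) (use measurable_rot_grass[OF J assms(2)] in \<open>simp cong: measurable_cong_sets\<close>)
qed

lemma sets_grass_measure:
  fixes X :: "(real^'n::finite) set"
  assumes "subspace X" "m \<le> dim X"
  shows "sets (grass_measure X m) = sets (plane_algebra (grass X m))"
    and "space (grass_measure X m) = grass X m"
    and "prob_space (grass_measure X m)"
proof -
  obtain I :: "'n set" where I: "card I = dim X" using dim_subset_UNIV[of X] obtain_subset_with_card_n[of "dim X" UNIV] by auto
  obtain B where B: "orthogonal_matrix B" "(*v) B ` coord_space I = X" using obtain_coord_rotation[OF assms(1) I[symmetric]] .
  show "sets (grass_measure X m) = sets (plane_algebra (grass X m))" "space (grass_measure X m) = grass X m"
      "prob_space (grass_measure X m)"
    using sets_grass_measure_rotated[of m I B] B I assms(2) by auto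
qed

lemma grass_measure_rotate:
  fixes B :: "real^'n::finite^'n"
  assumes m: "m \<le> card I" and B: "orthogonal_matrix B"
  shows "grass_measure ((*v) B ` coord_space I) m =
    distr (grass_measure (coord_space I) m) (plane_algebra (grass ((*v) B ` coord_space I) m)) (\<lambda>S. (*v) B ` S)"
proof -
  obtain J where J: "J \<subseteq> I" "card J = m" using m by (meson obtain_subset_with_card_n)
  have m1: "(\<lambda>A. (*v) A ` coord_space J) \<in> haar_rot I \<rightarrow>\<^sub>M plane_algebra (grass (coord_space I) m)"
    using measurable_rot_grass[OF J orthogonal_matrix_id] by (simp cong: measurable_cong_sets)
  have "grass_measure (coord_space I) m = distr (haar_rot I) (plane_algebra (grass (coord_space I) m)) (\<lambda>A. (*v) A ` coord_space J)"
    using grass_measure_eq_distr[OF J orthogonal_matrix_id] by simp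
  then show ?thesis
    by (simp add: distr_distr[OF measurable_rotate_grass[OF B] m1] grass_measure_eq_distr[OF J B] o_def image_matrix_mul)
qed

lemma kernel_orthogonal_comp:
  assumes "m \<le> CARD('n::finite)"
  shows "measurable_kernel (grass_measure (UNIV :: (real^'n) set) m) borel (\<lambda>\<xi>. lborel_on (\<xi>\<^sup>\<bottom>))"
proof (rule measurable_kernel_lborel_on[where d = "CARD('n) - m"])
  have s: "sets (grass_measure (UNIV :: (real^'n) set) m) = sets (plane_algebra (grass UNIV m))"
    "space (grass_measure (UNIV :: (real^'n) set) m) = grass UNIV m"
    using sets_grass_measure[of "UNIV :: (real^'n) set" m] assms by auto
  fix \<xi> :: "(real^'n) set" assume "\<xi> \<in> space (grass_measure UNIV m)"
  then show "subspace (\<xi>\<^sup>\<bottom>)" "dim (\<xi>\<^sup>\<bottom>) = CARD('n) - m"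
    by (auto simp: s subspace_orthogonal_comp dim_orthogonal_comp grass_def)
next
  have s: "sets (grass_measure (UNIV :: (real^'n) set) m) = sets (plane_algebra (grass UNIV m))"
    "space (grass_measure (UNIV :: (real^'n) set) m) = grass UNIV m"
    using sets_grass_measure[of "UNIV :: (real^'n) set" m] assms by auto
  have "fst \<in> grass_measure (UNIV :: (real^'n) set) m \<Otimes>\<^sub>M (borel :: (real^'n) measure) \<rightarrow>\<^sub>M plane_algebra (grass UNIV m)"
    using measurable_fst[of "grass_measure (UNIV :: (real^'n) set) m" borel] measurable_cong_sets[OF refl s(1)] by blast
  then have "(\<lambda>p. snd p - orth_proj (fst p) (snd p)) \<in> borel_measurable (grass_measure (UNIV :: (real^'n) set) m \<Otimes>\<^sub>M borel)"
    by (intro borel_measurable_diff measurable_orth_proj) auto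
  then show "(\<lambda>p. orth_proj ((fst p)\<^sup>\<bottom>) (snd p)) \<in> borel_measurable (grass_measure (UNIV :: (real^'n) set) m \<Otimes>\<^sub>M borel)"
    by (rule measurable_cong[THEN iffD1, rotated])
       (auto simp: space_pair_measure s orth_proj_orthogonal_comp grass_def)
qed

lemma kernel_relative_orthogonal_comp:
  fixes X :: "(real^'n::finite) set"
  assumes X: "subspace X" and m: "m \<le> dim X"
  shows "measurable_kernel (grass_measure X m) borel (\<lambda>P. lborel_on (P\<^sup>\<bottom> \<inter> X))"
proof (rule measurable_kernel_lborel_on[where d = "dim X - m"])
  note s = sets_grass_measure[OF X m]
  fix P assume "P \<in> space (grass_measure X m)"
  then show "subspace (P\<^sup>\<bottom> \<inter> X)" "dim (P\<^sup>\<bottom> \<inter> X) = dim X - m"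
    using X by (auto simp: s subspace_orthogonal_comp subspace_inter dim_relative_orthogonal_comp grass_def)
next
  note s = sets_grass_measure[OF X m]
  have "fst \<in> grass_measure X m \<Otimes>\<^sub>M (borel :: (real^'n) measure) \<rightarrow>\<^sub>M plane_algebra (grass X m)"
    using measurable_fst[of "grass_measure X m" borel] measurable_cong_sets[OF refl s(1)] by blast
  then have 1: "(\<lambda>p. orth_proj (fst p) (snd p)) \<in> borel_measurable (grass_measure X m \<Otimes>\<^sub>M borel)"
    by (intro measurable_orth_proj) auto
  have "(\<lambda>p::((real^'n) set \<times> _). X) \<in> grass_measure X m \<Otimes>\<^sub>M (borel :: (real^'n) measure) \<rightarrow>\<^sub>M plane_algebra (grass UNIV (dim X))"
    using X by (intro measurable_const) (simp add: grass_def)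
  then have 2: "(\<lambda>p. orth_proj X (snd p)) \<in> borel_measurable (grass_measure X m \<Otimes>\<^sub>M borel)"
    by (rule measurable_orth_proj) auto
  have "(\<lambda>p. orth_proj X (snd p) - orth_proj (fst p) (snd p)) \<in> borel_measurable (grass_measure X m \<Otimes>\<^sub>M borel)"
    by (intro borel_measurable_diff 1 2)
  then show "(\<lambda>p. orth_proj ((fst p)\<^sup>\<bottom> \<inter> X) (snd p)) \<in> borel_measurable (grass_measure X m \<Otimes>\<^sub>M borel)"
    by (rule measurable_cong[THEN iffD1, rotated])
       (auto simp: space_pair_measure s orth_proj_relative_complement[OF X] grass_def)
qed

lemma sets_affine_grass_measure [simp]:
  "sets (affine_grass_measure m) = sets (plane_algebra (affine_grass m))"
  "space (affine_grass_measure m) = affine_grass m"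
  by (simp_all add: affine_grass_measure_def)

lemma rotate_translate: "(*v) A ` ((+) u ` S) = (+) (A *v u) ` ((*v) A ` S)" for A :: "real^'n::finite^'m::finite"
  by (simp add: image_image matrix_vector_right_distrib)

text \<open>
  A random affine m-plane is a randomly rotated translate of a fixed coordinate plane.
\<close>

lemma nn_integral_affine_grass_measure:
  fixes J :: "'n::finite set"
  assumes J: "card J = m" and f: "f \<in> borel_measurable (plane_algebra (affine_grass m))"
  shows "(\<integral>\<^sup>+\<tau>. f \<tau> \<partial>affine_grass_measure m) =
    (\<integral>\<^sup>+A. (\<integral>\<^sup>+u. f ((*v) A ` ((+) u ` coord_space J)) \<partial>coord_lebesgue (- J)) \<partial>haar_rot UNIV)"
proof -
  have mle: "m \<le> CARD('n)" using J card_mono[of UNIV J] by auto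
  note K = kernel_orthogonal_comp[OF mle]
  note s = sets_grass_measure[of "UNIV :: (real^'n) set" m]
  have s': "sets (grass_measure (UNIV :: (real^'n) set) m) = sets (plane_algebra (grass UNIV m))" using s mle by simp
  let ?M = "grass_measure (UNIV :: (real^'n) set) m"
  have mt: "(\<lambda>(\<xi>, u). (+) u ` \<xi>) \<in> ?M \<Otimes>\<^sub>M borel \<rightarrow>\<^sub>M plane_algebra (affine_grass m)"
    unfolding case_prod_beta'
  proof (rule measurable_translate_plane)
    show "fst \<in> ?M \<Otimes>\<^sub>M (borel :: (real^'n) measure) \<rightarrow>\<^sub>M plane_algebra (grass UNIV m)"
      using measurable_fst[of ?M borel] measurable_cong_sets[OF refl s'] by blast
  qed simp
  then have mt': "(\<lambda>(\<xi>, u). (+) u ` \<xi>) \<in> fibred_measure ?M borel (\<lambda>\<xi>. lborel_on (\<xi>\<^sup>\<bottom>)) \<rightarrow>\<^sub>M plane_algebra (affine_grass m)"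
    by (simp add: sets_fibred_measure[OF K] cong: measurable_cong_sets)
  have mf: "(\<lambda>z. f ((+) (snd z) ` fst z)) \<in> borel_measurable (?M \<Otimes>\<^sub>M borel)"
    using measurable_compose[OF mt f] by (simp add: case_prod_beta')
  have "(\<integral>\<^sup>+\<tau>. f \<tau> \<partial>affine_grass_measure m) =
     (\<integral>\<^sup>+z. f ((+) (snd z) ` fst z) \<partial>fibred_measure ?M borel (\<lambda>\<xi>. lborel_on (\<xi>\<^sup>\<bottom>)))"
    unfolding affine_grass_measure_def by (subst nn_integral_distr[OF mt']) (simp_all add: f case_prod_beta')
  also have "\<dots> = (\<integral>\<^sup>+\<xi>. (\<integral>\<^sup>+u. f ((+) u ` \<xi>) \<partial>lborel_on (\<xi>\<^sup>\<bottom>)) \<partial>?M)"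
    by (subst nn_integral_fibred_measure[OF K mf]) simp
  also have "\<dots> = (\<integral>\<^sup>+A. (\<integral>\<^sup>+u. f ((+) u ` ((*v) A ` coord_space J)) \<partial>lborel_on (((*v) A ` coord_space J)\<^sup>\<bottom>)) \<partial>haar_rot UNIV)"
  proof -
    have m1: "(\<lambda>A. (*v) A ` coord_space J) \<in> haar_rot UNIV \<rightarrow>\<^sub>M plane_algebra (grass UNIV m)"
      using measurable_rot_grass[OF subset_UNIV J orthogonal_matrix_id] by (simp cong: measurable_cong_sets)
    have m2: "(\<lambda>\<xi>. \<integral>\<^sup>+u. f ((+) u ` \<xi>) \<partial>lborel_on (\<xi>\<^sup>\<bottom>)) \<in> borel_measurable (plane_algebra (grass UNIV m))"
      using measurable_nn_integral_kernel[OF K mf] by (simp add: s' cong: measurable_cong_sets)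
    show ?thesis
      unfolding grass_measure_UNIV_eq_distr[OF J] by (rule nn_integral_distr[OF m1]) (use m2 in simp)
  qed
  also have "\<dots> = (\<integral>\<^sup>+A. (\<integral>\<^sup>+u. f ((*v) A ` ((+) u ` coord_space J)) \<partial>coord_lebesgue (- J)) \<partial>haar_rot UNIV)"
  proof (rule nn_integral_cong)
    fix A :: "real^'n^'n" assume "A \<in> space (haar_rot UNIV)"
    then have A: "orthogonal_matrix A" by (simp add: rot_stab_orthogonal)
    have "(\<lambda>u. (+) u ` ((*v) A ` coord_space J)) \<in> borel \<rightarrow>\<^sub>M plane_algebra (affine_grass m)"
    proof (rule measurable_translate_plane)
      show "(\<lambda>u. (*v) A ` coord_space J) \<in> borel \<rightarrow>\<^sub>M plane_algebra (grass UNIV m)"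
        using A J by (intro measurable_const) (simp add: grass_def orthogonal_matrix_subspace orthogonal_matrix_dim)
    qed simp
    from measurable_compose[OF this f]
    have [measurable]: "(\<lambda>u. f ((+) u ` ((*v) A ` coord_space J))) \<in> borel_measurable borel" .
    show "(\<integral>\<^sup>+u. f ((+) u ` ((*v) A ` coord_space J)) \<partial>lborel_on (((*v) A ` coord_space J)\<^sup>\<bottom>)) =
        (\<integral>\<^sup>+u. f ((*v) A ` ((+) u ` coord_space J)) \<partial>coord_lebesgue (- J))"
      unfolding orthogonal_matrix_orthogonal_comp[OF A] coord_space_orthogonal_comp lborel_on_rotated_coord_space[OF A]
      unfolding rotate_translate by (rule nn_integral_distr) simp_all
  qed
  finally show ?thesis .
qed

section \<open>The measure of the Strichartz transform\<close>

lemma lborel_on_rotate: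
  fixes Y :: "(real^'n::finite) set"
  assumes Y: "subspace Y" and B: "orthogonal_matrix B"
  shows "lborel_on ((*v) B ` Y) = distr (lborel_on Y) borel ((*v) B)"
proof -
  obtain I :: "'n set" where I: "card I = dim Y" using dim_subset_UNIV[of Y] obtain_subset_with_card_n[of "dim Y" UNIV] by auto
  obtain A where A: "orthogonal_matrix A" "(*v) A ` coord_space I = Y" using obtain_coord_rotation[OF Y I[symmetric]] .
  have "lborel_on ((*v) B ` Y) = lborel_on ((*v) (B ** A) ` coord_space I)" by (simp only: A(2)[symmetric] image_matrix_mul)
  also have "\<dots> = distr (coord_lebesgue I) borel ((*v) (B ** A))"
    by (rule lborel_on_rotated_coord_space) (simp add: A B orthogonal_matrix_mul)
  also have "\<dots> = distr (distr (coord_lebesgue I) borel ((*v) A)) borel ((*v) B)"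
    by (subst distr_distr) (simp_all add: o_def matrix_vector_mul_assoc)
  also have "distr (coord_lebesgue I) borel ((*v) A) = lborel_on Y"
    by (simp only: lborel_on_rotated_coord_space[OF A(1), symmetric] A(2))
  finally show ?thesis .
qed

lemma measurable_lborel_on [simp]: "measurable (lborel_on X) N = measurable borel N"
  by (rule measurable_cong_sets) simp_all

lemma nn_integral_lborel_on_norm:
  fixes Y :: "(real^'n::finite) set" and I :: "'n set"
  assumes Y: "subspace Y" "dim Y = card I" and [measurable]: "g \<in> borel_measurable borel"
  shows "(\<integral>\<^sup>+y. g (norm y) \<partial>lborel_on Y) = (\<integral>\<^sup>+y. g (norm y) \<partial>coord_lebesgue I)"
proof -
  obtain A where A: "orthogonal_matrix A" "(*v) A ` coord_space I = Y" using obtain_coord_rotation[OF Y] .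
  show ?thesis
    unfolding A(2)[symmetric] lborel_on_rotated_coord_space[OF A(1)]
    by (subst nn_integral_distr) (simp_all add: orthogonal_matrix_norm[OF A(1)])
qed

lemma emeasure_lborel_on_cball:
  fixes Y :: "(real^'n::finite) set" and I :: "'n set"
  assumes Y: "subspace Y" "dim Y = card I"
  shows "emeasure (lborel_on Y) (cball 0 t) = emeasure (coord_lebesgue I) (cball 0 t)"
proof -
  have c: "(\<integral>\<^sup>+y. indicator {..t} (norm y) \<partial>M) = emeasure M (cball 0 t)" if "sets M = sets borel" for M :: "(real^'n) measure"
  proof -
    have "(\<integral>\<^sup>+y. indicator {..t} (norm y) \<partial>M) = (\<integral>\<^sup>+y. indicator (cball 0 t) y \<partial>M)"
      by (rule nn_integral_cong) (simp add: indicator_def)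
    then show ?thesis using that by simp
  qed
  have "(\<integral>\<^sup>+y. indicator {..t} (norm y) \<partial>lborel_on Y) = (\<integral>\<^sup>+y. indicator {..t} (norm y) \<partial>coord_lebesgue I)"
    by (rule nn_integral_lborel_on_norm[OF Y]) simp
  then show ?thesis by (simp add: c)
qed

text \<open>
  The j-plane over which the integrand of the transform is evaluated.
\<close>

definition plane_sum :: "'a::euclidean_space set \<times> 'a set \<times> 'a \<Rightarrow> 'a \<Rightarrow> 'a set" where
  "plane_sum = (\<lambda>(Q, P, u) v. {x + y + u + v | x y. x \<in> P \<and> y \<in> Q})"

lemma strichartz_integrand_plane_sum: "strichartz_integrand f v w = f (plane_sum w v)"
  by (cases w) (simp add: strichartz_integrand_def plane_sum_def)

lemma plane_sum_translate: "plane_sum (Q, P, u) v = (+) (u + v) ` {x + y | x y. x \<in> P \<and> y \<in> Q}"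
  unfolding plane_sum_def by (auto simp: image_def) (metis add.assoc add.commute)+

lemma plane_sum_rotate:
  fixes B :: "real^'n::finite^'n"
  shows "(*v) B ` plane_sum (Q, P, u) v = plane_sum ((*v) B ` Q, (*v) B ` P, B *v u) (B *v v)"
proof -
  have "(*v) B ` {x + y | x y. x \<in> P \<and> y \<in> Q} = {x + y | x y. x \<in> (*v) B ` P \<and> y \<in> (*v) B ` Q}"
  proof (intro equalityI subsetI)
    fix z assume "z \<in> {x + y | x y. x \<in> (*v) B ` P \<and> y \<in> (*v) B ` Q}"
    then obtain x y where "x \<in> P" "y \<in> Q" "z = B *v (x + y)" by (auto simp: matrix_vector_right_distrib)
    then show "z \<in> (*v) B ` {x + y | x y. x \<in> P \<and> y \<in> Q}" by blast
  qed (force simp: matrix_vector_right_distrib)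
  then show ?thesis
    by (simp only: plane_sum_translate rotate_translate matrix_vector_right_distrib)
qed

lemma orthogonal_sum_in_grass:
  assumes "P \<in> grass X p" "Q \<in> grass (X\<^sup>\<bottom>) q"
  shows "{x + y | x y. x \<in> P \<and> y \<in> Q} \<in> grass UNIV (p + q)"
proof -
  have PQ: "subspace P" "subspace Q" "dim P = p" "dim Q = q" using assms by (auto simp: grass_def)
  have "P \<inter> Q \<subseteq> {0}"
  proof
    fix x assume "x \<in> P \<inter> Q"
    then have "x \<in> X" "x \<in> X\<^sup>\<bottom>" using assms by (auto simp: grass_def)
    then have "x \<bullet> x = 0" by (simp add: orthogonal_comp_iff)
    then show "x \<in> {0}" by simp
  qed
  then have "dim (P \<inter> Q) = 0" by (simp add: subspace_0 PQ)
  then have "dim {x + y | x y. x \<in> P \<and> y \<in> Q} = p + q"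
    using dim_sums_Int[OF PQ(1,2)] PQ(3,4) by linarith
  then show ?thesis using subspace_sums[OF PQ(1,2)] by (simp add: grass_def)
qed

text \<open>
  The squared distance to an orthogonal sum P \<oplus> Q is d(x,P)^2 + d(x,Q)^2 - |x|^2.
\<close>

lemma measurable_plane_sum:
  fixes X :: "'a::euclidean_space set"
  assumes Q: "Q \<in> M \<rightarrow>\<^sub>M plane_algebra (grass (X\<^sup>\<bottom>) q)" and P: "P \<in> M \<rightarrow>\<^sub>M plane_algebra (grass X p)"
    and u[measurable]: "u \<in> borel_measurable M" and v[measurable]: "v \<in> borel_measurable M"
  shows "(\<lambda>w. plane_sum (Q w, P w, u w) (v w)) \<in> M \<rightarrow>\<^sub>M plane_algebra (affine_grass (p + q))"
  unfolding plane_sum_translate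
proof (rule measurable_translate_plane)
  have Qw: "Q w \<in> grass (X\<^sup>\<bottom>) q" and Pw: "P w \<in> grass X p" if "w \<in> space M" for w
    using measurable_space[OF Q that] measurable_space[OF P that] by simp_all
  show "(\<lambda>w. {x + y |x y. x \<in> P w \<and> y \<in> Q w}) \<in> M \<rightarrow>\<^sub>M plane_algebra (grass UNIV (p + q))"
  proof (rule measurable_into_planes)
    show "{x + y |x y. x \<in> P w \<and> y \<in> Q w} \<in> grass UNIV (p + q)" if "w \<in> space M" for w
      by (rule orthogonal_sum_in_grass[OF Pw[OF that] Qw[OF that]])
    fix x :: 'a
    have [measurable]: "(\<lambda>w. infdist x (P w)) \<in> borel_measurable M" "(\<lambda>w. infdist x (Q w)) \<in> borel_measurable M"
      by (rule measurable_infdist_planes[OF P] measurable_infdist_planes[OF Q]; simp)+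
    have "(\<lambda>w. sqrt ((infdist x (P w))\<^sup>2 + (infdist x (Q w))\<^sup>2 - (norm x)\<^sup>2)) \<in> borel_measurable M"
      by measurable
    then show "(\<lambda>w. infdist x {x + y |x y. x \<in> P w \<and> y \<in> Q w}) \<in> borel_measurable M"
    proof (rule measurable_cong[THEN iffD1, rotated])
      fix w assume "w \<in> space M"
      note Qw[OF this] Pw[OF this]
      then have s: "subspace (P w)" "subspace (Q w)" "Q w \<subseteq> (P w)\<^sup>\<bottom>"
        using orthogonal_comp_anti_mono[of "P w" X] by (auto simp: grass_def)
      show "sqrt ((infdist x (P w))\<^sup>2 + (infdist x (Q w))\<^sup>2 - (norm x)\<^sup>2) = infdist x {x + y |x y. x \<in> P w \<and> y \<in> Q w}"
        by (rule infdist_orthogonal_sum[OF s, symmetric])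
    qed
  qed simp
qed measurable

lemma measurable_plane_sum_section:
  "(\<lambda>w. plane_sum w v) \<in> plane_algebra (grass (X\<^sup>\<bottom>) q) \<Otimes>\<^sub>M (plane_algebra (grass X p) \<Otimes>\<^sub>M borel) \<rightarrow>\<^sub>M
     plane_algebra (affine_grass (p + q))" (is "_ \<in> ?T \<rightarrow>\<^sub>M _")
proof -
  have 1: "(\<lambda>x. fst x) \<in> ?T \<rightarrow>\<^sub>M plane_algebra (grass (X\<^sup>\<bottom>) q)" by simp
  have 2: "(\<lambda>x. fst (snd x)) \<in> ?T \<rightarrow>\<^sub>M plane_algebra (grass X p)"
    by (rule measurable_compose[OF measurable_snd measurable_fst])
  have 3: "(\<lambda>x. snd (snd x)) \<in> ?T \<rightarrow>\<^sub>M borel"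
    by (rule measurable_compose[OF measurable_snd measurable_snd])
  show ?thesis using measurable_plane_sum[OF 1 2 3 measurable_const] by simp
qed

text \<open>
  The second factor of the measure of the transform, on pairs of a p-plane P in X and a point of
  P^\<bottom> \<inter> X.
\<close>

definition plane_point_measure :: "nat \<Rightarrow> 'a::euclidean_space set \<Rightarrow> ('a set \<times> 'a) measure" where
  "plane_point_measure p X = fibred_measure (grass_measure X p) borel (\<lambda>P. lborel_on (P\<^sup>\<bottom> \<inter> X))"

lemma strichartz_measure_eq_pair:
  "strichartz_measure p q X = grass_measure (X\<^sup>\<bottom>) q \<Otimes>\<^sub>M plane_point_measure p X"
  by (simp add: strichartz_measure_def plane_point_measure_def)

context
  fixes X :: "(real^'n::finite) set" and p q :: nat
  assumes X: "subspace X" "p \<le> dim X"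
begin

lemma sets_plane_point_measure:
  "sets (plane_point_measure p X) = sets (plane_algebra (grass X p) \<Otimes>\<^sub>M borel)"
  unfolding plane_point_measure_def sets_fibred_measure[OF kernel_relative_orthogonal_comp[OF X]]
  by (rule sets_pair_measure_cong) (simp_all add: sets_grass_measure[OF X])

lemma nn_integral_plane_point_measure:
  assumes "f \<in> borel_measurable (plane_algebra (grass X p) \<Otimes>\<^sub>M borel)"
  shows "(\<integral>\<^sup>+z. f z \<partial>plane_point_measure p X) =
     (\<integral>\<^sup>+P. (\<integral>\<^sup>+u. f (P, u) \<partial>lborel_on (P\<^sup>\<bottom> \<inter> X)) \<partial>grass_measure X p)"
proof -
  have "sets (plane_algebra (grass X p) \<Otimes>\<^sub>M (borel::(real^'n) measure)) = sets (grass_measure X p \<Otimes>\<^sub>M borel)"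
    by (rule sets_pair_measure_cong) (simp_all add: sets_grass_measure[OF X])
  then have "f \<in> borel_measurable (grass_measure X p \<Otimes>\<^sub>M borel)"
    using assms by (simp cong: measurable_cong_sets)
  then show ?thesis
    unfolding plane_point_measure_def by (rule nn_integral_fibred_measure[OF kernel_relative_orthogonal_comp[OF X]])
qed

lemma measurable_nn_integral_lborel_on:
  assumes "f \<in> borel_measurable (plane_algebra (grass X p) \<Otimes>\<^sub>M borel)"
  shows "(\<lambda>P. \<integral>\<^sup>+u. f (P, u) \<partial>lborel_on (P\<^sup>\<bottom> \<inter> X)) \<in> borel_measurable (plane_algebra (grass X p))"
proof -
  have "sets (plane_algebra (grass X p) \<Otimes>\<^sub>M (borel::(real^'n) measure)) = sets (grass_measure X p \<Otimes>\<^sub>M borel)"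
    by (rule sets_pair_measure_cong) (simp_all add: sets_grass_measure[OF X])
  then have "f \<in> borel_measurable (grass_measure X p \<Otimes>\<^sub>M borel)"
    using assms by (simp cong: measurable_cong_sets)
  from measurable_nn_integral_kernel[OF kernel_relative_orthogonal_comp[OF X] this]
  show ?thesis by (simp add: sets_grass_measure(1)[OF X] cong: measurable_cong_sets)
qed

lemma sigma_finite_plane_point_measure: "sigma_finite_measure (plane_point_measure p X)"
proof
  let ?C = "range (\<lambda>i::nat. grass X p \<times> cball (0::real^'n) (real i))"
  have sp: "space (plane_point_measure p X) = grass X p \<times> UNIV"
    using sets_eq_imp_space_eq[OF sets_plane_point_measure] by (simp add: space_pair_measure)
  interpret prob_space "grass_measure X p" by (rule sets_grass_measure[OF X])
  obtain I :: "'n set" where I: "card I = dim X - p"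
  proof (rule obtain_subset_with_card_n[of "dim X - p" "UNIV :: 'n set"])
    show "dim X - p \<le> CARD('n)" using dim_subset_UNIV[of X] by simp
  qed blast
  have fin: "emeasure (plane_point_measure p X) (grass X p \<times> cball 0 (real i)) \<noteq> \<infinity>" for i
  proof -
    have S[measurable]: "grass X p \<times> cball 0 (real i) \<in> sets (plane_algebra (grass X p) \<Otimes>\<^sub>M borel)"
      using sets.top[of "plane_algebra (grass X p)"] by (intro pair_measureI) simp_all
    have "emeasure (plane_point_measure p X) (grass X p \<times> cball 0 (real i)) =
        (\<integral>\<^sup>+z. indicator (grass X p \<times> cball 0 (real i)) z \<partial>plane_point_measure p X)"
      using S by (simp add: sets_plane_point_measure)
    also have "\<dots> = (\<integral>\<^sup>+P. (\<integral>\<^sup>+u. indicator (grass X p \<times> cball 0 (real i)) (P, u) \<partial>lborel_on (P\<^sup>\<bottom> \<inter> X)) \<partial>grass_measure X p)"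
      by (rule nn_integral_plane_point_measure) simp
    also have "\<dots> = (\<integral>\<^sup>+P. emeasure (coord_lebesgue I) (cball 0 (real i)) \<partial>grass_measure X p)"
    proof (rule nn_integral_cong)
      fix P assume "P \<in> space (grass_measure X p)"
      then have P: "P \<in> grass X p" by (simp add: sets_grass_measure[OF X])
      then have Y: "subspace (P\<^sup>\<bottom> \<inter> X)" "dim (P\<^sup>\<bottom> \<inter> X) = card I"
        using X I by (auto simp: subspace_orthogonal_comp subspace_inter dim_relative_orthogonal_comp grass_def)
      have "(\<integral>\<^sup>+u. indicator (grass X p \<times> cball 0 (real i)) (P, u) \<partial>lborel_on (P\<^sup>\<bottom> \<inter> X)) =
         (\<integral>\<^sup>+u. indicator (cball 0 (real i)) u \<partial>lborel_on (P\<^sup>\<bottom> \<inter> X))"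
        using P by (intro nn_integral_cong) (simp add: indicator_def)
      also have "\<dots> = emeasure (coord_lebesgue I) (cball 0 (real i))"
        by (simp add: emeasure_lborel_on_cball[OF Y])
      finally show "(\<integral>\<^sup>+u. indicator (grass X p \<times> cball 0 (real i)) (P, u) \<partial>lborel_on (P\<^sup>\<bottom> \<inter> X)) =
          emeasure (coord_lebesgue I) (cball 0 (real i))" .
    qed
    also have "\<dots> = emeasure (coord_lebesgue I) (cball 0 (real i))" by (simp add: emeasure_space_1)
    also have "\<dots> \<le> ennreal ((2 * real i) ^ card I)" by (rule emeasure_coord_lebesgue_cball_le) simp
    also have "\<dots> < \<infinity>" by simp
    finally show ?thesis by simp
  qed
  show "\<exists>A. countable A \<and> A \<subseteq> sets (plane_point_measure p X) \<and> \<Union> A = space (plane_point_measure p X) \<and>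
        (\<forall>a\<in>A. emeasure (plane_point_measure p X) a \<noteq> \<infinity>)"
  proof (intro exI conjI)
    show "countable ?C" by simp
    show "?C \<subseteq> sets (plane_point_measure p X)"
      using sets.top[of "plane_algebra (grass X p)"] by (auto simp: sets_plane_point_measure intro!: pair_measureI)
    show "\<Union> ?C = space (plane_point_measure p X)"
    proof -
      have "\<exists>i. norm x \<le> real i" for x :: "real^'n" by (rule real_arch_simple)
      then show ?thesis unfolding sp by auto
    qed
    show "\<forall>a\<in>?C. emeasure (plane_point_measure p X) a \<noteq> \<infinity>" using fin by auto
  qed
qed

context
  assumes q: "q \<le> CARD('n) - dim X"
begin

lemma dim_complement_ge: "q \<le> dim (X\<^sup>\<bottom>)" by (simp add: dim_orthogonal_comp X q)

lemma sets_strichartz_measure: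
  "sets (strichartz_measure p q X) = sets (plane_algebra (grass (X\<^sup>\<bottom>) q) \<Otimes>\<^sub>M (plane_algebra (grass X p) \<Otimes>\<^sub>M borel))"
  unfolding strichartz_measure_eq_pair
  by (rule sets_pair_measure_cong) (simp_all add: sets_grass_measure[OF subspace_orthogonal_comp dim_complement_ge] sets_plane_point_measure)

lemma space_strichartz_measure:
  "space (strichartz_measure p q X) = grass (X\<^sup>\<bottom>) q \<times> grass X p \<times> UNIV"
  using sets_eq_imp_space_eq[OF sets_strichartz_measure] by (simp add: space_pair_measure)

lemma sigma_finite_strichartz_measure: "sigma_finite_measure (strichartz_measure p q X)"
proof -
  interpret Q: prob_space "grass_measure (X\<^sup>\<bottom>) q" by (rule sets_grass_measure[OF subspace_orthogonal_comp dim_complement_ge])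
  interpret Z: sigma_finite_measure "plane_point_measure p X" by (rule sigma_finite_plane_point_measure)
  interpret P: pair_sigma_finite "grass_measure (X\<^sup>\<bottom>) q" "plane_point_measure p X" ..
  show ?thesis unfolding strichartz_measure_eq_pair by (rule P.sigma_finite_measure_axioms)
qed

lemma nn_integral_strichartz_measure':
  assumes f: "f \<in> borel_measurable (plane_algebra (grass (X\<^sup>\<bottom>) q) \<Otimes>\<^sub>M (plane_algebra (grass X p) \<Otimes>\<^sub>M borel))"
  shows "(\<integral>\<^sup>+w. f w \<partial>strichartz_measure p q X) =
     (\<integral>\<^sup>+Q. (\<integral>\<^sup>+z. f (Q, z) \<partial>plane_point_measure p X) \<partial>grass_measure (X\<^sup>\<bottom>) q)"
    and "(\<lambda>Q. \<integral>\<^sup>+z. f (Q, z) \<partial>plane_point_measure p X) \<in> borel_measurable (plane_algebra (grass (X\<^sup>\<bottom>) q))"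
proof -
  interpret Z: sigma_finite_measure "plane_point_measure p X" by (rule sigma_finite_plane_point_measure)
  have s: "sets (grass_measure (X\<^sup>\<bottom>) q) = sets (plane_algebra (grass (X\<^sup>\<bottom>) q))"
    by (rule sets_grass_measure[OF subspace_orthogonal_comp dim_complement_ge])
  have "sets (plane_algebra (grass (X\<^sup>\<bottom>) q) \<Otimes>\<^sub>M (plane_algebra (grass X p) \<Otimes>\<^sub>M borel)) =
     sets (grass_measure (X\<^sup>\<bottom>) q \<Otimes>\<^sub>M plane_point_measure p X)"
    using sets_strichartz_measure unfolding strichartz_measure_eq_pair by simp
  then have f': "f \<in> borel_measurable (grass_measure (X\<^sup>\<bottom>) q \<Otimes>\<^sub>M plane_point_measure p X)"
    using f by (simp cong: measurable_cong_sets)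
  show "(\<integral>\<^sup>+w. f w \<partial>strichartz_measure p q X) =
     (\<integral>\<^sup>+Q. (\<integral>\<^sup>+z. f (Q, z) \<partial>plane_point_measure p X) \<partial>grass_measure (X\<^sup>\<bottom>) q)"
    unfolding strichartz_measure_eq_pair by (rule Z.nn_integral_fst[OF f', symmetric])
  have "(\<lambda>Q. \<integral>\<^sup>+z. f (Q, z) \<partial>plane_point_measure p X) \<in> borel_measurable (grass_measure (X\<^sup>\<bottom>) q)"
    by (rule Z.borel_measurable_nn_integral_fst[OF f'])
  then show "(\<lambda>Q. \<integral>\<^sup>+z. f (Q, z) \<partial>plane_point_measure p X) \<in> borel_measurable (plane_algebra (grass (X\<^sup>\<bottom>) q))"
    using s by (simp cong: measurable_cong_sets)
qed

lemma nn_integral_strichartz_measure: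
  assumes f: "f \<in> borel_measurable (plane_algebra (grass (X\<^sup>\<bottom>) q) \<Otimes>\<^sub>M (plane_algebra (grass X p) \<Otimes>\<^sub>M borel))"
  shows "(\<integral>\<^sup>+w. f w \<partial>strichartz_measure p q X) =
     (\<integral>\<^sup>+Q. (\<integral>\<^sup>+P. (\<integral>\<^sup>+u. f (Q, P, u) \<partial>lborel_on (P\<^sup>\<bottom> \<inter> X)) \<partial>grass_measure X p) \<partial>grass_measure (X\<^sup>\<bottom>) q)"
  unfolding nn_integral_strichartz_measure'(1)[OF f]
proof (rule nn_integral_cong)
  fix Q assume "Q \<in> space (grass_measure (X\<^sup>\<bottom>) q)"
  then have "Q \<in> grass (X\<^sup>\<bottom>) q" by (simp add: sets_grass_measure[OF subspace_orthogonal_comp dim_complement_ge])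
  then have "(\<lambda>z. f (Q, z)) \<in> borel_measurable (plane_algebra (grass X p) \<Otimes>\<^sub>M borel)"
    by (intro measurable_compose[OF measurable_Pair1' f]) simp
  then show "(\<integral>\<^sup>+z. f (Q, z) \<partial>plane_point_measure p X) =
      (\<integral>\<^sup>+P. (\<integral>\<^sup>+u. f (Q, P, u) \<partial>lborel_on (P\<^sup>\<bottom> \<inter> X)) \<partial>grass_measure X p)"
    by (rule nn_integral_plane_point_measure)
qed

end

end

text \<open>
  Each of the three ingredients, the two Grassmannian measures and Lebesgue measure on a subspace,
  is carried along by rotations.
\<close>

lemma nn_integral_strichartz_measure_rotate:
  fixes B :: "real^'n::finite^'n" and I :: "'n set"
  assumes p: "p \<le> card I" and q: "q \<le> card (- I)" and B: "orthogonal_matrix B"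
    and f: "f \<in> borel_measurable (plane_algebra (grass (((*v) B ` coord_space I)\<^sup>\<bottom>) q) \<Otimes>\<^sub>M
       (plane_algebra (grass ((*v) B ` coord_space I) p) \<Otimes>\<^sub>M borel))"
  shows "(\<integral>\<^sup>+w. f w \<partial>strichartz_measure p q ((*v) B ` coord_space I)) =
     (\<integral>\<^sup>+(Q, P, u). f ((*v) B ` Q, (*v) B ` P, B *v u) \<partial>strichartz_measure p q (coord_space I))"
proof -
  let ?E = "coord_space I"
  define X where "X = (*v) B ` ?E"
  have X: "subspace X" "dim X = card I"
    by (simp_all add: X_def orthogonal_matrix_subspace[OF B] orthogonal_matrix_dim[OF B])
  have cI: "card (- I) = CARD('n) - card I" by (rule card_Compl_eq)
  have Xc: "X\<^sup>\<bottom> = (*v) B ` coord_space (- I)"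
    by (simp add: X_def orthogonal_matrix_orthogonal_comp[OF B] coord_space_orthogonal_comp)
  have pX: "p \<le> dim X" and qX: "q \<le> CARD('n) - dim X" using p q X cI by simp_all
  have pE: "p \<le> dim ?E" and qE: "q \<le> CARD('n) - dim ?E" using p q cI by simp_all
  note f' = f[folded X_def]
  define f2 where "f2 = (\<lambda>(Q, P, u). f ((*v) B ` Q, (*v) B ` P, B *v u))"
  have mQ: "(\<lambda>S. (*v) B ` S) \<in> plane_algebra (grass (?E\<^sup>\<bottom>) q) \<rightarrow>\<^sub>M plane_algebra (grass (X\<^sup>\<bottom>) q)"
    using measurable_rotate_grass[OF B, of "?E\<^sup>\<bottom>"] by (simp add: X_def orthogonal_matrix_orthogonal_comp[OF B])
  have mP: "(\<lambda>S. (*v) B ` S) \<in> plane_algebra (grass ?E p) \<rightarrow>\<^sub>M plane_algebra (grass X p)"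
    using measurable_rotate_grass[OF B, of ?E] by (simp add: X_def)
  have f2: "f2 \<in> borel_measurable (plane_algebra (grass (?E\<^sup>\<bottom>) q) \<Otimes>\<^sub>M (plane_algebra (grass ?E p) \<Otimes>\<^sub>M borel))"
  proof -
    have "(\<lambda>w. ((*v) B ` fst w, (*v) B ` fst (snd w), B *v snd (snd w))) \<in>
      plane_algebra (grass (?E\<^sup>\<bottom>) q) \<Otimes>\<^sub>M (plane_algebra (grass ?E p) \<Otimes>\<^sub>M borel) \<rightarrow>\<^sub>M
      plane_algebra (grass (X\<^sup>\<bottom>) q) \<Otimes>\<^sub>M (plane_algebra (grass X p) \<Otimes>\<^sub>M borel)"
    proof (intro measurable_Pair)
      show "(\<lambda>w. (*v) B ` fst w) \<in> plane_algebra (grass (?E\<^sup>\<bottom>) q) \<Otimes>\<^sub>M (plane_algebra (grass ?E p) \<Otimes>\<^sub>M (borel::(real^'n) measure)) \<rightarrow>\<^sub>M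
         plane_algebra (grass (X\<^sup>\<bottom>) q)"
        by (rule measurable_compose[OF measurable_fst mQ])
      show "(\<lambda>w. (*v) B ` fst (snd w)) \<in> plane_algebra (grass (?E\<^sup>\<bottom>) q) \<Otimes>\<^sub>M (plane_algebra (grass ?E p) \<Otimes>\<^sub>M (borel::(real^'n) measure)) \<rightarrow>\<^sub>M
         plane_algebra (grass X p)"
        by (rule measurable_compose[OF measurable_compose[OF measurable_snd measurable_fst] mP])
    qed measurable
    from measurable_compose[OF this f'] show ?thesis by (simp add: f2_def case_prod_beta')
  qed
  have "(\<integral>\<^sup>+w. f w \<partial>strichartz_measure p q X) =
      (\<integral>\<^sup>+Q. (\<integral>\<^sup>+z. f (Q, z) \<partial>plane_point_measure p X) \<partial>grass_measure (X\<^sup>\<bottom>) q)"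
    by (rule nn_integral_strichartz_measure'(1)[OF X(1) pX qX f'])
  also have "grass_measure (X\<^sup>\<bottom>) q = distr (grass_measure (?E\<^sup>\<bottom>) q) (plane_algebra (grass (X\<^sup>\<bottom>) q)) (\<lambda>S. (*v) B ` S)"
    using grass_measure_rotate[OF q B] by (simp add: Xc coord_space_orthogonal_comp)
  also have "(\<integral>\<^sup>+Q. (\<integral>\<^sup>+z. f (Q, z) \<partial>plane_point_measure p X) \<partial>distr (grass_measure (?E\<^sup>\<bottom>) q) (plane_algebra (grass (X\<^sup>\<bottom>) q)) (\<lambda>S. (*v) B ` S))
     = (\<integral>\<^sup>+Q. (\<integral>\<^sup>+z. f ((*v) B ` Q, z) \<partial>plane_point_measure p X) \<partial>grass_measure (?E\<^sup>\<bottom>) q)"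
  proof (rule nn_integral_distr)
    have "q \<le> dim (?E\<^sup>\<bottom>)" using q by (simp add: coord_space_orthogonal_comp)
    from sets_grass_measure(1)[OF subspace_orthogonal_comp this]
    show "(\<lambda>S. (*v) B ` S) \<in> grass_measure (?E\<^sup>\<bottom>) q \<rightarrow>\<^sub>M plane_algebra (grass (X\<^sup>\<bottom>) q)"
      using mQ by (simp cong: measurable_cong_sets)
  qed (use nn_integral_strichartz_measure'(2)[OF X(1) pX qX f'] in simp)
  also have "\<dots> = (\<integral>\<^sup>+Q. (\<integral>\<^sup>+P. (\<integral>\<^sup>+u. f2 (Q, P, u) \<partial>lborel_on (P\<^sup>\<bottom> \<inter> ?E)) \<partial>grass_measure ?E p) \<partial>grass_measure (?E\<^sup>\<bottom>) q)"
  proof (rule nn_integral_cong)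
    fix Q assume "Q \<in> space (grass_measure (?E\<^sup>\<bottom>) q)"
    then have "Q \<in> grass (?E\<^sup>\<bottom>) q"
      using sets_grass_measure(2)[of "?E\<^sup>\<bottom>" q] q by (simp add: subspace_orthogonal_comp coord_space_orthogonal_comp)
    then have BQ: "(*v) B ` Q \<in> grass (X\<^sup>\<bottom>) q" using measurable_space[OF mQ] by simp
    have fB: "(\<lambda>z. f ((*v) B ` Q, z)) \<in> borel_measurable (plane_algebra (grass X p) \<Otimes>\<^sub>M borel)"
      using BQ by (intro measurable_compose[OF measurable_Pair1' f']) simp
    have "(\<integral>\<^sup>+z. f ((*v) B ` Q, z) \<partial>plane_point_measure p X) =
      (\<integral>\<^sup>+P. (\<integral>\<^sup>+u. f ((*v) B ` Q, P, u) \<partial>lborel_on (P\<^sup>\<bottom> \<inter> X)) \<partial>grass_measure X p)"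
      by (rule nn_integral_plane_point_measure[OF X(1) pX fB])
    also have "grass_measure X p = distr (grass_measure ?E p) (plane_algebra (grass X p)) (\<lambda>S. (*v) B ` S)"
      using grass_measure_rotate[OF p B] by (simp add: X_def)
    also have "(\<integral>\<^sup>+P. (\<integral>\<^sup>+u. f ((*v) B ` Q, P, u) \<partial>lborel_on (P\<^sup>\<bottom> \<inter> X)) \<partial>distr (grass_measure ?E p) (plane_algebra (grass X p)) (\<lambda>S. (*v) B ` S))
      = (\<integral>\<^sup>+P. (\<integral>\<^sup>+u. f ((*v) B ` Q, (*v) B ` P, u) \<partial>lborel_on (((*v) B ` P)\<^sup>\<bottom> \<inter> X)) \<partial>grass_measure ?E p)"
    proof (rule nn_integral_distr)
      show "(\<lambda>S. (*v) B ` S) \<in> grass_measure ?E p \<rightarrow>\<^sub>M plane_algebra (grass X p)"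
        using mP sets_grass_measure(1)[OF subspace_coord_space pE] by (simp cong: measurable_cong_sets)
    qed (use measurable_nn_integral_lborel_on[OF X(1) pX fB] in simp)
    also have "\<dots> = (\<integral>\<^sup>+P. (\<integral>\<^sup>+u. f2 (Q, P, u) \<partial>lborel_on (P\<^sup>\<bottom> \<inter> ?E)) \<partial>grass_measure ?E p)"
    proof (rule nn_integral_cong)
      fix P assume "P \<in> space (grass_measure ?E p)"
      then have P: "P \<in> grass ?E p" using sets_grass_measure(2)[OF subspace_coord_space pE] by simp
      then have BP: "(*v) B ` P \<in> grass X p" using measurable_space[OF mP] by simp
      have e: "((*v) B ` P)\<^sup>\<bottom> \<inter> X = (*v) B ` (P\<^sup>\<bottom> \<inter> ?E)"
        unfolding orthogonal_matrix_orthogonal_comp[OF B] X_def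
        using orthogonal_matrix_inj[OF B] by (simp add: image_Int)
      have sY: "subspace (P\<^sup>\<bottom> \<inter> ?E)" by (simp add: subspace_inter subspace_orthogonal_comp)
      have "(\<lambda>u. f ((*v) B ` Q, (*v) B ` P, u)) \<in> borel_measurable borel"
        using BP by (intro measurable_compose[OF measurable_Pair1' fB]) simp
      then show "(\<integral>\<^sup>+u. f ((*v) B ` Q, (*v) B ` P, u) \<partial>lborel_on (((*v) B ` P)\<^sup>\<bottom> \<inter> X)) =
          (\<integral>\<^sup>+u. f2 (Q, P, u) \<partial>lborel_on (P\<^sup>\<bottom> \<inter> ?E))"
        unfolding e lborel_on_rotate[OF sY B] by (subst nn_integral_distr) (simp_all add: f2_def)
    qed
    finally show "(\<integral>\<^sup>+z. f ((*v) B ` Q, z) \<partial>plane_point_measure p X) =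
       (\<integral>\<^sup>+P. (\<integral>\<^sup>+u. f2 (Q, P, u) \<partial>lborel_on (P\<^sup>\<bottom> \<inter> ?E)) \<partial>grass_measure ?E p)" .
  qed
  also have "\<dots> = (\<integral>\<^sup>+w. f2 w \<partial>strichartz_measure p q ?E)"
    by (rule nn_integral_strichartz_measure[OF subspace_coord_space pE qE f2, symmetric])
  finally show ?thesis by (simp add: X_def f2_def)
qed

section \<open>The transform along rotated planes\<close>

context
  fixes I :: "'n::finite set" and p q :: nat
    and f :: "(real^'n) set \<Rightarrow> ennreal"
  assumes p: "p \<le> card I" and q: "q \<le> card (- I)"
    and f: "f \<in> borel_measurable (plane_algebra (affine_grass (p + q)))"
begin

lemma coord_space_dims: "p \<le> dim (coord_space I)" "q \<le> CARD('n) - dim (coord_space I)"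
  using p q by (simp_all add: card_Compl_eq)

lemma measurable_strichartz_rotated_pair:
  "(\<lambda>x. f ((*v) (fst (fst x)) ` plane_sum (snd x) (snd (fst x)))) \<in>
     borel_measurable ((rot_algebra UNIV \<Otimes>\<^sub>M borel) \<Otimes>\<^sub>M strichartz_measure p q (coord_space I))"
proof (rule measurable_compose[OF _ f])
  let ?S = "strichartz_measure p q (coord_space I)"
  let ?N = "(rot_algebra (UNIV::'n set) \<Otimes>\<^sub>M (borel :: (real^'n) measure)) \<Otimes>\<^sub>M ?S"
  let ?T = "plane_algebra (grass ((coord_space I)\<^sup>\<bottom>) q) \<Otimes>\<^sub>M (plane_algebra (grass (coord_space I) p) \<Otimes>\<^sub>M (borel :: (real^'n) measure))"
  have "sets ?S = sets ?T" by (rule sets_strichartz_measure[OF subspace_coord_space coord_space_dims])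
  then have S: "snd \<in> ?N \<rightarrow>\<^sub>M ?T" using measurable_snd[of "rot_algebra UNIV \<Otimes>\<^sub>M borel" ?S] measurable_cong_sets[OF refl] by blast
  have 1: "(\<lambda>x. fst (snd x)) \<in> ?N \<rightarrow>\<^sub>M plane_algebra (grass ((coord_space I)\<^sup>\<bottom>) q)"
    by (rule measurable_compose[OF S measurable_fst])
  have 2: "(\<lambda>x. fst (snd (snd x))) \<in> ?N \<rightarrow>\<^sub>M plane_algebra (grass (coord_space I) p)"
    by (rule measurable_compose[OF S measurable_compose[OF measurable_snd measurable_fst]])
  have 3: "(\<lambda>x. snd (snd (snd x))) \<in> ?N \<rightarrow>\<^sub>M borel"
    by (rule measurable_compose[OF S measurable_compose[OF measurable_snd measurable_snd]])
  have 4: "(\<lambda>x. snd (fst x)) \<in> ?N \<rightarrow>\<^sub>M borel"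
    by (rule measurable_compose[OF measurable_fst measurable_snd])
  have 5: "(\<lambda>x. fst (fst x)) \<in> ?N \<rightarrow>\<^sub>M borel"
    by (rule measurable_compose[OF measurable_compose[OF measurable_fst measurable_fst] measurable_from_rot_algebra])
  have ps: "(\<lambda>x. plane_sum (snd x) (snd (fst x))) \<in> ?N \<rightarrow>\<^sub>M plane_algebra (affine_grass (p + q))"
    using measurable_plane_sum[OF 1 2 3 4] by simp
  show "(\<lambda>x. (*v) (fst (fst x)) ` plane_sum (snd x) (snd (fst x))) \<in> ?N \<rightarrow>\<^sub>M plane_algebra (affine_grass (p + q))"
  proof (rule measurable_rotate_plane[OF ps 5])
    fix x assume x: "x \<in> space ?N"
    then show o: "orthogonal_matrix (fst (fst x))"
      by (auto simp: space_pair_measure rot_stab_UNIV)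
    obtain S u where "subspace S" "dim S = p + q" "plane_sum (snd x) (snd (fst x)) = (+) u ` S"
      using measurable_space[OF ps x] affine_grass_cases[of _ "p + q"] by (metis space_plane_algebra)
    then show "(*v) (fst (fst x)) ` plane_sum (snd x) (snd (fst x)) \<in> affine_grass (p + q)"
      by (simp only: rotate_translate)
         (auto intro!: translate_in_affine_grass simp: orthogonal_matrix_subspace[OF o] orthogonal_matrix_dim[OF o])
  qed simp_all
qed

lemma nn_integral_strichartz_rotated:
  assumes B: "orthogonal_matrix B"
  shows "(\<integral>\<^sup>+w. f (plane_sum w (B *v v)) \<partial>strichartz_measure p q ((*v) B ` coord_space I)) =
     (\<integral>\<^sup>+w. f ((*v) B ` plane_sum w v) \<partial>strichartz_measure p q (coord_space I))"
proof -
  let ?X = "(*v) B ` coord_space I"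
  note ps = measurable_plane_sum_section[of "B *v v" ?X q p]
  show ?thesis
    by (subst nn_integral_strichartz_measure_rotate[OF p q B measurable_compose[OF ps f]])
       (simp add: case_prod_beta' plane_sum_rotate[symmetric])
qed

text \<open>
  Over rotated coordinate planes B(E + v) the transform is a measurable function \<Psi> of B and v by
  Fubini. To descend to a function of the plane, choose B as the random frame of the direction of
  \<zeta> and average over the samples: \<Psi> takes almost surely the same value, so the average is the
  transform, and it is measurable in \<zeta>.
\<close>

lemma measurable_nn_integral_strichartz:
  "(\<lambda>\<zeta>. \<integral>\<^sup>+w. f (plane_sum w (foot \<zeta>)) \<partial>strichartz_measure p q (dir_space \<zeta>))
     \<in> borel_measurable (plane_algebra (affine_grass (card I)))"
proof -
  let ?S = "strichartz_measure p q (coord_space I)"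
  let ?A = "plane_algebra (affine_grass (card I) :: (real^'n) set set)"
  interpret S: sigma_finite_measure ?S by (rule sigma_finite_strichartz_measure[OF subspace_coord_space coord_space_dims])
  define \<Psi> where "\<Psi> Av = (\<integral>\<^sup>+w. f ((*v) (fst Av) ` plane_sum w (snd Av)) \<partial>?S)" for Av :: "(real^'n^'n) \<times> (real^'n)"
  have \<Psi>: "\<Psi> \<in> borel_measurable (rot_algebra UNIV \<Otimes>\<^sub>M borel)"
    unfolding \<Psi>_def using S.borel_measurable_nn_integral_fst[OF measurable_strichartz_rotated_pair] by simp
  \<comment> \<open>the identity matrix replaces the frame on the null set of degenerate samples\<close>
  define R where "R \<zeta> g = (let A = frame_matrix I (dir_space \<zeta>) g in if A \<in> rot_stab UNIV then A else mat 1)"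
    for \<zeta> :: "(real^'n) set" and g
  have mR: "(\<lambda>x. R (fst x) (snd x)) \<in> borel_measurable (?A \<Otimes>\<^sub>M ball_samples)"
  proof -
    have [measurable]: "(\<lambda>x. frame_matrix I (dir_space (fst x)) (snd x)) \<in> borel_measurable (?A \<Otimes>\<^sub>M ball_samples)"
      by (rule measurable_frame_matrix[OF measurable_compose[OF measurable_fst measurable_dir_space] measurable_snd])
    show ?thesis unfolding R_def Let_def by measurable
  qed
  have mR': "(\<lambda>x. R (fst x) (snd x)) \<in> ?A \<Otimes>\<^sub>M ball_samples \<rightarrow>\<^sub>M rot_algebra UNIV"
    by (rule measurable_into_rot_algebra[OF mR]) (simp add: R_def Let_def rot_stab_id)
  have mf: "(\<lambda>x. foot (fst x)) \<in> borel_measurable (?A \<Otimes>\<^sub>M ball_samples)"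
    by (rule measurable_compose[OF measurable_fst measurable_foot])
  have mv: "(\<lambda>x. transpose (R (fst x) (snd x)) *v foot (fst x)) \<in> borel_measurable (?A \<Otimes>\<^sub>M ball_samples)"
    using mR mf by measurable
  have "(\<lambda>x. \<Psi> (R (fst x) (snd x), transpose (R (fst x) (snd x)) *v foot (fst x))) \<in> borel_measurable (?A \<Otimes>\<^sub>M ball_samples)"
    by (rule measurable_compose[OF measurable_Pair[OF mR' mv] \<Psi>])
  from ball_samples_prob.borel_measurable_nn_integral_fst[OF this]
  have "(\<lambda>\<zeta>. \<integral>\<^sup>+g. \<Psi> (R \<zeta> g, transpose (R \<zeta> g) *v foot \<zeta>) \<partial>ball_samples) \<in> borel_measurable ?A" by simp
  then show ?thesis
  proof (rule measurable_cong[THEN iffD1, rotated])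
    fix \<zeta> assume "\<zeta> \<in> space ?A"
    then have "dir_space \<zeta> \<in> grass UNIV (card I)" by (simp add: dir_space_affine_grass)
    then have d: "subspace (dir_space \<zeta>)" "dim (dir_space \<zeta>) = card I" by (auto simp: grass_def)
    let ?c = "\<integral>\<^sup>+w. f (plane_sum w (foot \<zeta>)) \<partial>strichartz_measure p q (dir_space \<zeta>)"
    have "(\<integral>\<^sup>+g. \<Psi> (R \<zeta> g, transpose (R \<zeta> g) *v foot \<zeta>) \<partial>ball_samples) = (\<integral>\<^sup>+g. ?c \<partial>(ball_samples :: ('n \<Rightarrow> real^'n) measure))"
    proof (rule nn_integral_cong_AE)
      show "AE g in ball_samples. \<Psi> (R \<zeta> g, transpose (R \<zeta> g) *v foot \<zeta>) = ?c"
        using AE_frame_matrix_orthogonal[OF d]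
      proof eventually_elim
        case (elim g)
        have R: "R \<zeta> g = frame_matrix I (dir_space \<zeta>) g" using elim by (simp add: R_def Let_def rot_stab_UNIV)
        have o: "orthogonal_matrix (R \<zeta> g)" and im: "(*v) (R \<zeta> g) ` coord_space I = dir_space \<zeta>"
          using elim frame_matrix_image[OF d elim] by (simp_all add: R)
        show ?case
          using nn_integral_strichartz_rotated[OF o, of "transpose (R \<zeta> g) *v foot \<zeta>"]
          by (simp add: \<Psi>_def im orthogonal_matrix_mult_transpose[OF o])
      qed
    qed
    then show "(\<integral>\<^sup>+g. \<Psi> (R \<zeta> g, transpose (R \<zeta> g) *v foot \<zeta>) \<partial>ball_samples) = ?c"
      by (simp add: ball_samples_prob.emeasure_space_1[simplified])
  qed
qed

end

lemma nn_integral_coord_lebesgue_rotate: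
  assumes "h \<in> rot_stab (I::'n::finite set)" and [measurable]: "g \<in> borel_measurable borel"
  shows "(\<integral>\<^sup>+v. g (h *v v) \<partial>coord_lebesgue I) = (\<integral>\<^sup>+v. g v \<partial>coord_lebesgue I)"
  by (subst (2) coord_lebesgue_rotation_invariant[OF assms(1), symmetric], subst nn_integral_distr) simp_all

lemma coord_plane_in_affine_grass: "(+) u ` coord_space (J :: 'n::finite set) \<in> affine_grass (card J)"
  by (rule translate_in_affine_grass) auto

lemma measurable_rotated_coord_plane:
  fixes J :: "'n::finite set"
  assumes f: "f \<in> borel_measurable (plane_algebra (affine_grass (card J)))"
    and A: "A \<in> M \<rightarrow>\<^sub>M rot_algebra UNIV" and u: "u \<in> borel_measurable M"
  shows "(\<lambda>x. f ((*v) (A x) ` ((+) (u x) ` coord_space J))) \<in> borel_measurable M"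
proof (rule measurable_compose[OF _ f])
  have c: "(\<lambda>x. coord_space J) \<in> M \<rightarrow>\<^sub>M plane_algebra (grass UNIV (card J))"
    by (intro measurable_const) (simp add: grass_def)
  have A': "A \<in> borel_measurable M" by (rule measurable_compose[OF A measurable_from_rot_algebra])
  show "(\<lambda>x. (*v) (A x) ` ((+) (u x) ` coord_space J)) \<in> M \<rightarrow>\<^sub>M plane_algebra (affine_grass (card J))"
  proof (rule measurable_rotate_plane[OF measurable_translate_plane[OF c u] A'])
    fix x assume "x \<in> space M"
    then show o: "orthogonal_matrix (A x)" using measurable_space[OF A] by (auto simp: rot_stab_UNIV)
    show "(*v) (A x) ` ((+) (u x) ` coord_space J) \<in> affine_grass (card J)"
      unfolding rotate_translate
      by (intro translate_in_affine_grass) (auto simp: orthogonal_matrix_subspace[OF o] orthogonal_matrix_dim[OF o])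
  qed simp_all
qed

section \<open>Exchanging the order of integration\<close>

text \<open>
  \<real>^n = E_p \<oplus> E_q \<oplus> E_l \<oplus> E_\<rho>, the last index set being the remainder. The j-planes are rotated
  translates of E_p \<oplus> E_q and the k-planes are rotated translates of E_p \<oplus> E_l.
\<close>

locale coord_split =
  fixes Ip Iq Il Ir :: "'n::finite set"
  assumes disj: "Ip \<inter> Iq = {}" "Ip \<inter> Il = {}" "Ip \<inter> Ir = {}" "Iq \<inter> Il = {}" "Iq \<inter> Ir = {}" "Il \<inter> Ir = {}"
    and cover: "Ip \<union> Iq \<union> Il \<union> Ir = UNIV"
begin

lemma compl_pl: "- (Ip \<union> Il) = Iq \<union> Ir" and compl_pq: "- (Ip \<union> Iq) = Il \<union> Ir"
  using disj cover by blast+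

lemma card_pq: "card (Ip \<union> Iq) = card Ip + card Iq" and card_pl: "card (Ip \<union> Il) = card Ip + card Il"
  using disj by (simp_all add: card_Un_disjoint)

text \<open>
  Move E_p to P inside E_p \<oplus> E_l, and E_q to Q inside the complement, by rotations that each fix
  the other summand.
\<close>

lemma rotation_to_flag:
  assumes P: "P \<in> grass (coord_space (Ip \<union> Il)) (card Ip)" and Q: "Q \<in> grass ((coord_space (Ip \<union> Il))\<^sup>\<bottom>) (card Iq)"
  obtains h where "h \<in> rot_stab (Ip \<union> Il)" "(*v) h ` coord_space Ip = P" "(*v) h ` coord_space Iq = Q"
proof -
  have P': "subspace P" "P \<subseteq> coord_space (Ip \<union> Il)" "dim P = card Ip" using P by (auto simp: grass_def)
  have Q': "subspace Q" "Q \<subseteq> coord_space (Iq \<union> Ir)" "dim Q = card Iq"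
    using Q by (auto simp: grass_def coord_space_orthogonal_comp compl_pl[symmetric])
  obtain a where a: "orthogonal_matrix a" "(*v) a ` coord_space Ip = P" "\<And>x. x \<in> coord_space (- (Ip \<union> Il)) \<Longrightarrow> a *v x = x"
    using coord_space_moved_to_subspace[OF Un_upper1 P'] by blast
  obtain b where b: "orthogonal_matrix b" "(*v) b ` coord_space Iq = Q" "\<And>x. x \<in> coord_space (- (Iq \<union> Ir)) \<Longrightarrow> b *v x = x"
    using coord_space_moved_to_subspace[OF Un_upper1 Q'] by blast
  have stab: "c \<in> rot_stab K" if "orthogonal_matrix c" "\<And>x. x \<in> coord_space (- K) \<Longrightarrow> c *v x = x" for c and K :: "'n set"
  proof -
    have "(*v) c ` coord_space (- K) = coord_space (- K)" using that(2) by (simp cong: image_cong)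
    then have "c \<in> rot_stab (- K)" using that(1) by (simp add: rot_stab_def)
    then show ?thesis by (simp add: rot_stab_compl)
  qed
  have ra: "a \<in> rot_stab (Ip \<union> Il)" by (rule stab[OF a(1,3)])
  have "b \<in> rot_stab (Iq \<union> Ir)" by (rule stab[OF b(1,3)])
  then have "b \<in> rot_stab (- (Ip \<union> Il))" by (simp only: compl_pl)
  then have rb: "b \<in> rot_stab (Ip \<union> Il)" by (simp only: rot_stab_compl)
  show ?thesis
  proof (rule that[of "a ** b"])
    show "a ** b \<in> rot_stab (Ip \<union> Il)" by (rule rot_stab_mult[OF ra rb])
    have "b *v x = x" if "x \<in> coord_space Ip" for x
    proof (rule b(3))
      have "Ip \<subseteq> - (Iq \<union> Ir)" using disj by blast
      then show "x \<in> coord_space (- (Iq \<union> Ir))" using that coord_space_mono by blast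
    qed
    then have "(*v) b ` coord_space Ip = coord_space Ip" by (simp cong: image_cong)
    then show "(*v) (a ** b) ` coord_space Ip = P" by (simp add: image_matrix_mul a(2))
    have "a *v x = x" if "x \<in> Q" for x
      by (rule a(3)) (use that Q'(2) compl_pl in auto)
    then have "(*v) a ` Q = Q" by (simp cong: image_cong)
    then show "(*v) (a ** b) ` coord_space Iq = Q" by (simp add: image_matrix_mul b(2))
  qed
qed

lemma coord_plane_sum: "plane_sum (coord_space Iq, coord_space Ip, u) v = (+) (u + v) ` coord_space (Ip \<union> Iq)"
proof -
  have "{x + y | x y. x \<in> coord_space Ip \<and> y \<in> coord_space Iq} = coord_space (Ip \<union> Iq)"
  proof (intro equalityI subsetI)
    fix z :: "real^'n" assume z: "z \<in> coord_space (Ip \<union> Iq)"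
    have "z = coord_proj Ip z + coord_proj Iq z"
      using z disj by (auto simp: vec_eq_iff coord_space_def)
    then show "z \<in> {x + y | x y. x \<in> coord_space Ip \<and> y \<in> coord_space Iq}"
      using coord_proj_mem by blast
  qed (auto simp: coord_space_def)
  then show ?thesis by (simp add: plane_sum_translate)
qed

text \<open>
  Integrate over the flags (Q, P) last. For a fixed flag pick a rotation h that preserves
  E_p \<oplus> E_l and takes (E_q, E_p) to (Q, P); substituting A \<mapsto> A h^(-1) and v \<mapsto> h v removes h, so
  the inner integral does not depend on the flag and the integration over flags is trivial.
\<close>

lemma weighted_integral_of_transform:
  fixes f :: "(real^'n) set \<Rightarrow> ennreal" and G :: "real \<Rightarrow> ennreal"
  assumes f: "f \<in> borel_measurable (plane_algebra (affine_grass (card (Ip \<union> Iq))))"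
    and G[measurable]: "G \<in> borel_measurable borel"
  shows "(\<integral>\<^sup>+\<zeta>. G (norm (foot \<zeta>)) *
        (\<integral>\<^sup>+w. f (plane_sum w (foot \<zeta>)) \<partial>strichartz_measure (card Ip) (card Iq) (dir_space \<zeta>))
          \<partial>affine_grass_measure (card (Ip \<union> Il))) =
     (\<integral>\<^sup>+u. (\<integral>\<^sup>+A. (\<integral>\<^sup>+v. G (norm v) * f ((*v) A ` ((+) (u + v) ` coord_space (Ip \<union> Iq)))
         \<partial>coord_lebesgue (Iq \<union> Ir)) \<partial>haar_rot UNIV) \<partial>coord_lebesgue Il)"
proof -
  let ?I = "Ip \<union> Il" and ?p = "card Ip" and ?q = "card Iq"
  let ?E = "coord_space ?I"
  let ?S = "strichartz_measure ?p ?q ?E"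
  have p: "?p \<le> card ?I" by (simp add: card_mono)
  have q: "?q \<le> card (- ?I)" unfolding compl_pl by (simp add: card_mono)
  note f' = f[unfolded card_pq]
  have dims: "?p \<le> dim ?E" "?q \<le> CARD('n) - dim ?E" using p q unfolding card_Compl_eq by simp_all
  interpret S: sigma_finite_measure ?S by (rule sigma_finite_strichartz_measure[OF subspace_coord_space dims])
  interpret HC: pair_sigma_finite "haar_rot (UNIV::'n set)" "coord_lebesgue (- ?I)" ..
  interpret HCS: pair_sigma_finite "haar_rot (UNIV::'n set) \<Otimes>\<^sub>M coord_lebesgue (- ?I)" ?S ..
  have shc: "sets (haar_rot (UNIV::'n set) \<Otimes>\<^sub>M coord_lebesgue (- ?I)) = sets (rot_algebra UNIV \<Otimes>\<^sub>M borel)"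
    by (rule sets_pair_measure_cong) simp_all
  have shcs: "sets ((haar_rot (UNIV::'n set) \<Otimes>\<^sub>M coord_lebesgue (- ?I)) \<Otimes>\<^sub>M ?S) = sets ((rot_algebra UNIV \<Otimes>\<^sub>M borel) \<Otimes>\<^sub>M ?S)"
    by (rule sets_pair_measure_cong[OF shc refl])
  have joint: "(\<lambda>x. f ((*v) (fst (fst x)) ` plane_sum (snd x) (snd (fst x)))) \<in>
      borel_measurable ((haar_rot UNIV \<Otimes>\<^sub>M coord_lebesgue (- ?I)) \<Otimes>\<^sub>M ?S)"
    using measurable_strichartz_rotated_pair[OF p q f'] shcs by (simp cong: measurable_cong_sets)
  have Gm: "(\<lambda>x. G (norm (snd (fst x)))) \<in> borel_measurable ((haar_rot UNIV \<Otimes>\<^sub>M coord_lebesgue (- ?I)) \<Otimes>\<^sub>M ?S)"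
  proof -
    have "(\<lambda>v::real^'n. G (norm v)) \<in> borel_measurable (coord_lebesgue (- ?I))" by simp
    then show ?thesis by (rule measurable_compose[OF measurable_compose[OF measurable_fst measurable_snd]])
  qed
  \<comment> \<open>J is the inner integral for a fixed flag and point, J_0 its value for the standard flag\<close>
  define J where "J w = (\<integral>\<^sup>+A. (\<integral>\<^sup>+v. G (norm v) * f ((*v) A ` plane_sum w v) \<partial>coord_lebesgue (- ?I)) \<partial>haar_rot UNIV)" for w
  have J_pair: "(\<integral>\<^sup>+x. G (norm (snd x)) * f ((*v) (fst x) ` plane_sum w (snd x)) \<partial>(haar_rot UNIV \<Otimes>\<^sub>M coord_lebesgue (- ?I))) = J w" if "w \<in> space ?S" for w
  proof -
    have "(\<lambda>x. G (norm (snd x)) * f ((*v) (fst x) ` plane_sum w (snd x))) \<in> borel_measurable (haar_rot UNIV \<Otimes>\<^sub>M coord_lebesgue (- ?I))"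
      using measurable_compose[OF measurable_Pair2'[OF that] borel_measurable_times_ennreal[OF Gm joint]] by simp
    from coord_lebesgue.nn_integral_fst[OF this] show ?thesis by (simp add: J_def)
  qed
  define J0 where "J0 u = (\<integral>\<^sup>+A. (\<integral>\<^sup>+v. G (norm v) * f ((*v) A ` ((+) (u + v) ` coord_space (Ip \<union> Iq))) \<partial>coord_lebesgue (- ?I)) \<partial>haar_rot UNIV)" for u
  have mphi: "(\<lambda>\<zeta>. G (norm (foot \<zeta>)) * (\<integral>\<^sup>+w. f (plane_sum w (foot \<zeta>)) \<partial>strichartz_measure ?p ?q (dir_space \<zeta>)))
      \<in> borel_measurable (plane_algebra (affine_grass (card ?I)))"
    using measurable_nn_integral_strichartz[OF p q f'] by measurable
  have "(\<integral>\<^sup>+\<zeta>. G (norm (foot \<zeta>)) * (\<integral>\<^sup>+w. f (plane_sum w (foot \<zeta>)) \<partial>strichartz_measure ?p ?q (dir_space \<zeta>))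
          \<partial>affine_grass_measure (card ?I)) =
    (\<integral>\<^sup>+A. (\<integral>\<^sup>+v. G (norm v) * (\<integral>\<^sup>+w. f ((*v) A ` plane_sum w v) \<partial>?S) \<partial>coord_lebesgue (- ?I)) \<partial>haar_rot UNIV)"
    unfolding nn_integral_affine_grass_measure[OF refl mphi]
  proof (rule nn_integral_cong)
    fix A :: "real^'n^'n" assume "A \<in> space (haar_rot UNIV)"
    then have A: "orthogonal_matrix A" by (simp add: rot_stab_orthogonal)
    show "(\<integral>\<^sup>+v. G (norm (foot ((*v) A ` ((+) v ` ?E)))) *
       (\<integral>\<^sup>+w. f (plane_sum w (foot ((*v) A ` ((+) v ` ?E)))) \<partial>strichartz_measure ?p ?q (dir_space ((*v) A ` ((+) v ` ?E)))) \<partial>coord_lebesgue (- ?I))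
      = (\<integral>\<^sup>+v. G (norm v) * (\<integral>\<^sup>+w. f ((*v) A ` plane_sum w v) \<partial>?S) \<partial>coord_lebesgue (- ?I))"
    proof (rule nn_integral_cong_AE)
      show "AE v in coord_lebesgue (- ?I). G (norm (foot ((*v) A ` ((+) v ` ?E)))) *
       (\<integral>\<^sup>+w. f (plane_sum w (foot ((*v) A ` ((+) v ` ?E)))) \<partial>strichartz_measure ?p ?q (dir_space ((*v) A ` ((+) v ` ?E))))
       = G (norm v) * (\<integral>\<^sup>+w. f ((*v) A ` plane_sum w v) \<partial>?S)"
        using AE_coord_lebesgue[of "- ?I"]
      proof eventually_elim
        case (elim v)
        have sub: "subspace ((*v) A ` ?E)" by (simp add: orthogonal_matrix_subspace[OF A])
        have "A *v v \<in> ((*v) A ` ?E)\<^sup>\<bottom>"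
          using elim by (simp add: orthogonal_matrix_orthogonal_comp[OF A] coord_space_orthogonal_comp)
        then have ft: "foot ((*v) A ` ((+) v ` ?E)) = A *v v" and dr: "dir_space ((*v) A ` ((+) v ` ?E)) = (*v) A ` ?E"
          unfolding rotate_translate using foot_translate[OF sub] dir_space_translate[OF sub] by auto
        show ?case unfolding ft dr nn_integral_strichartz_rotated[OF p q f' A] by (simp add: orthogonal_matrix_norm[OF A])
      qed
    qed
  qed
  also have "\<dots> = (\<integral>\<^sup>+A. (\<integral>\<^sup>+v. (\<integral>\<^sup>+w. G (norm v) * f ((*v) A ` plane_sum w v) \<partial>?S) \<partial>coord_lebesgue (- ?I)) \<partial>haar_rot UNIV)"
  proof (intro nn_integral_cong nn_integral_cmult[symmetric])
    fix A :: "real^'n^'n" and v :: "real^'n" assume A: "A \<in> space (haar_rot UNIV)"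
    then have "(A, v) \<in> space (haar_rot UNIV \<Otimes>\<^sub>M coord_lebesgue (- ?I))" by (simp add: space_pair_measure)
    from measurable_compose[OF measurable_Pair1'[OF this] joint]
    show "(\<lambda>w. f ((*v) A ` plane_sum w v)) \<in> borel_measurable ?S" by simp
  qed
  also have "\<dots> = (\<integral>\<^sup>+x. (\<integral>\<^sup>+w. G (norm (snd x)) * f ((*v) (fst x) ` plane_sum w (snd x)) \<partial>?S) \<partial>(haar_rot UNIV \<Otimes>\<^sub>M coord_lebesgue (- ?I)))"
  proof -
    have "(\<lambda>x. \<integral>\<^sup>+w. G (norm (snd x)) * f ((*v) (fst x) ` plane_sum w (snd x)) \<partial>?S) \<in> borel_measurable (haar_rot UNIV \<Otimes>\<^sub>M coord_lebesgue (- ?I))"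
      using S.borel_measurable_nn_integral_fst[OF borel_measurable_times_ennreal[OF Gm joint]] by simp
    from coord_lebesgue.nn_integral_fst[OF this] show ?thesis by simp
  qed
  also have "\<dots> = (\<integral>\<^sup>+w. (\<integral>\<^sup>+x. G (norm (snd x)) * f ((*v) (fst x) ` plane_sum w (snd x)) \<partial>(haar_rot UNIV \<Otimes>\<^sub>M coord_lebesgue (- ?I))) \<partial>?S)"
    using HCS.Fubini'[of "\<lambda>x w. G (norm (snd x)) * f ((*v) (fst x) ` plane_sum w (snd x))"] borel_measurable_times_ennreal[OF Gm joint]
    by (simp add: case_prod_beta')
  also have "\<dots> = (\<integral>\<^sup>+w. J w \<partial>?S)"
    by (intro nn_integral_cong J_pair)
  also have "\<dots> = (\<integral>\<^sup>+Q. (\<integral>\<^sup>+P. (\<integral>\<^sup>+u. J (Q, P, u) \<partial>lborel_on (P\<^sup>\<bottom> \<inter> ?E)) \<partial>grass_measure ?E ?p) \<partial>grass_measure (?E\<^sup>\<bottom>) ?q)"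
  proof (rule nn_integral_strichartz_measure[OF subspace_coord_space dims])
    have "(\<lambda>w. \<integral>\<^sup>+x. G (norm (snd x)) * f ((*v) (fst x) ` plane_sum w (snd x)) \<partial>(haar_rot UNIV \<Otimes>\<^sub>M coord_lebesgue (- ?I))) \<in> borel_measurable ?S"
      using HC.borel_measurable_nn_integral_fst[OF measurable_pair_swap[OF borel_measurable_times_ennreal[OF Gm joint]]] by simp
    then have "J \<in> borel_measurable ?S"
      by (rule measurable_cong[THEN iffD1, rotated]) (rule J_pair)
    then show "J \<in> borel_measurable (plane_algebra (grass (?E\<^sup>\<bottom>) ?q) \<Otimes>\<^sub>M (plane_algebra (grass ?E ?p) \<Otimes>\<^sub>M borel))"
      by (simp add: sets_strichartz_measure[OF subspace_coord_space dims] cong: measurable_cong_sets)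
  qed
  also have "\<dots> = (\<integral>\<^sup>+Q. (\<integral>\<^sup>+P. (\<integral>\<^sup>+u. J0 u \<partial>coord_lebesgue Il) \<partial>grass_measure ?E ?p) \<partial>grass_measure (?E\<^sup>\<bottom>) ?q)"
  proof (intro nn_integral_cong)
    have qE: "?q \<le> dim (?E\<^sup>\<bottom>)" using q by (simp add: coord_space_orthogonal_comp)
    fix Q P assume "Q \<in> space (grass_measure (?E\<^sup>\<bottom>) ?q)" "P \<in> space (grass_measure ?E ?p)"
    then have Q: "Q \<in> grass (?E\<^sup>\<bottom>) ?q" and P: "P \<in> grass ?E ?p"
      using sets_grass_measure(2)[OF subspace_orthogonal_comp qE] sets_grass_measure(2)[OF subspace_coord_space dims(1)] by auto
    obtain h where h: "h \<in> rot_stab ?I" "(*v) h ` coord_space Ip = P" "(*v) h ` coord_space Iq = Q"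
      using rotation_to_flag[OF P Q] .
    have ho: "orthogonal_matrix h" by (rule rot_stab_orthogonal[OF h(1)])
    have hU: "h \<in> rot_stab UNIV" using ho by (simp add: rot_stab_UNIV)
    have hc: "h \<in> rot_stab (- ?I)" using h(1) by (simp only: rot_stab_compl)
    \<comment> \<open>both sides are Haar integrals of H, evaluated at A h and at A\<close>
    have Jh: "J (Q, P, h *v u) = J0 u" for u
    proof -
      define H where "H A = (\<integral>\<^sup>+v. G (norm v) * f ((*v) A ` plane_sum (coord_space Iq, coord_space Ip, u) v) \<partial>coord_lebesgue (- ?I))" for A
      have mj: "(\<lambda>x. G (norm (snd x)) * f ((*v) (fst x) ` ((+) (u + snd x) ` coord_space (Ip \<union> Iq)))) \<in> borel_measurable (rot_algebra UNIV \<Otimes>\<^sub>M borel)"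
        by (intro borel_measurable_times_ennreal measurable_rotated_coord_plane[OF f]) measurable
      have mj': "(\<lambda>x. G (norm (snd x)) * f ((*v) (fst x) ` ((+) (u + snd x) ` coord_space (Ip \<union> Iq)))) \<in> borel_measurable (rot_algebra UNIV \<Otimes>\<^sub>M coord_lebesgue (- ?I))"
        using mj by (simp cong: measurable_cong_sets sets_pair_measure_cong)
      have mH: "H \<in> borel_measurable (rot_algebra UNIV)"
        unfolding H_def coord_plane_sum using coord_lebesgue.borel_measurable_nn_integral_fst[OF mj'] by simp
      have "J (Q, P, h *v u) = (\<integral>\<^sup>+A. H (A ** h) \<partial>haar_rot UNIV)"
        unfolding J_def
      proof (rule nn_integral_cong)
        fix A :: "real^'n^'n" assume "A \<in> space (haar_rot UNIV)"
        then have A: "A \<in> rot_stab UNIV" by simp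
        have *: "(*v) A ` plane_sum (Q, P, h *v u) (h *v v) = (*v) (A ** h) ` plane_sum (coord_space Iq, coord_space Ip, u) v" for v
          by (simp only: image_matrix_mul plane_sum_rotate h(2,3) matrix_vector_mul_assoc)
        have "(\<lambda>v. G (norm v) * f ((*v) A ` plane_sum (Q, P, h *v u) v)) \<in> borel_measurable borel"
        proof -
          have "(Q, P, h *v u) \<in> space ?S"
            using P Q by (simp add: space_strichartz_measure[OF subspace_coord_space dims])
          from measurable_compose[OF measurable_Pair2'[OF this] joint]
          have "(\<lambda>x. f ((*v) (fst x) ` plane_sum (Q, P, h *v u) (snd x))) \<in> borel_measurable (haar_rot UNIV \<Otimes>\<^sub>M coord_lebesgue (- ?I))" by simp
          from measurable_compose[OF measurable_Pair1' this] A
          have "(\<lambda>v. f ((*v) A ` plane_sum (Q, P, h *v u) v)) \<in> borel_measurable (coord_lebesgue (- ?I))" by simp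
          then have [measurable]: "(\<lambda>v. f ((*v) A ` plane_sum (Q, P, h *v u) v)) \<in> borel_measurable borel" by simp
          show ?thesis by measurable
        qed
        from nn_integral_coord_lebesgue_rotate[OF hc this]
        show "(\<integral>\<^sup>+v. G (norm v) * f ((*v) A ` plane_sum (Q, P, h *v u) v) \<partial>coord_lebesgue (- ?I)) = H (A ** h)"
          by (simp add: * H_def orthogonal_matrix_norm[OF ho])
      qed
      also have "\<dots> = (\<integral>\<^sup>+A. H A \<partial>haar_rot UNIV)" by (rule nn_integral_haar_right[OF hU mH])
      also have "\<dots> = J0 u" unfolding H_def J0_def coord_plane_sum ..
      finally show ?thesis .
    qed
    \<comment> \<open>the point u ranges over the image of E_l under the same rotation\<close>
    have hY: "P\<^sup>\<bottom> \<inter> ?E = (*v) h ` coord_space Il"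
    proof -
      have "(*v) h ` ?E = ?E" using h(1) by (simp add: rot_stab_def)
      then have "P\<^sup>\<bottom> \<inter> ?E = (*v) h ` coord_space (- Ip) \<inter> (*v) h ` ?E"
        by (simp add: h(2)[symmetric] orthogonal_matrix_orthogonal_comp[OF ho] coord_space_orthogonal_comp)
      also have "\<dots> = (*v) h ` (coord_space (- Ip) \<inter> ?E)"
        using orthogonal_matrix_inj[OF ho] by (simp add: image_Int)
      also have "coord_space (- Ip) \<inter> ?E = coord_space Il"
        using disj by (auto simp: coord_space_def)
      finally show ?thesis .
    qed
    have mJ: "(\<lambda>u. J (Q, P, u)) \<in> borel_measurable borel"
    proof -
      have J': "J (Q, P, u) = J0 (transpose h *v u)" for u
        using Jh[of "transpose h *v u"] by (simp add: orthogonal_matrix_mult_transpose[OF ho])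
      have mm: "(\<lambda>x. G (norm (snd (snd x))) * f ((*v) (fst (snd x)) ` ((+) (fst x + snd (snd x)) ` coord_space (Ip \<union> Iq))))
          \<in> borel_measurable (borel \<Otimes>\<^sub>M (rot_algebra (UNIV::'n set) \<Otimes>\<^sub>M (borel :: (real^'n) measure)))"
        by (intro borel_measurable_times_ennreal measurable_rotated_coord_plane[OF f]) measurable
      have "sets (borel \<Otimes>\<^sub>M (rot_algebra (UNIV::'n set) \<Otimes>\<^sub>M (borel :: (real^'n) measure))) = sets (borel \<Otimes>\<^sub>M (haar_rot UNIV \<Otimes>\<^sub>M coord_lebesgue (- ?I)))"
        by (intro sets_pair_measure_cong refl shc[symmetric])
      then have mm': "(\<lambda>x. G (norm (snd (snd x))) * f ((*v) (fst (snd x)) ` ((+) (fst x + snd (snd x)) ` coord_space (Ip \<union> Iq))))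
          \<in> borel_measurable (borel \<Otimes>\<^sub>M (haar_rot UNIV \<Otimes>\<^sub>M coord_lebesgue (- ?I)))"
        using mm by (simp cong: measurable_cong_sets)
      have "(\<lambda>u. \<integral>\<^sup>+x. G (norm (snd x)) * f ((*v) (fst x) ` ((+) (u + snd x) ` coord_space (Ip \<union> Iq))) \<partial>(haar_rot UNIV \<Otimes>\<^sub>M coord_lebesgue (- ?I))) \<in> borel_measurable borel"
        using HC.borel_measurable_nn_integral_fst[OF mm'] by simp
      moreover have "(\<integral>\<^sup>+x. G (norm (snd x)) * f ((*v) (fst x) ` ((+) (u + snd x) ` coord_space (Ip \<union> Iq))) \<partial>(haar_rot UNIV \<Otimes>\<^sub>M coord_lebesgue (- ?I))) = J0 u" for u
      proof -
        have "(\<lambda>x. G (norm (snd x)) * f ((*v) (fst x) ` ((+) (u + snd x) ` coord_space (Ip \<union> Iq)))) \<in> borel_measurable (haar_rot UNIV \<Otimes>\<^sub>M coord_lebesgue (- ?I))"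
          using measurable_compose[OF measurable_Pair1' mm'] by simp
        from coord_lebesgue.nn_integral_fst[OF this] show ?thesis by (simp add: J0_def)
      qed
      ultimately have [measurable]: "J0 \<in> borel_measurable borel" by simp
      show ?thesis unfolding J' by measurable
    qed
    show "(\<integral>\<^sup>+u. J (Q, P, u) \<partial>lborel_on (P\<^sup>\<bottom> \<inter> ?E)) = (\<integral>\<^sup>+u. J0 u \<partial>coord_lebesgue Il)"
      unfolding hY lborel_on_rotated_coord_space[OF ho]
      by (subst nn_integral_distr) (simp_all add: mJ Jh)
  qed
  also have "\<dots> = (\<integral>\<^sup>+u. J0 u \<partial>coord_lebesgue Il)"
  proof -
    have qE: "?q \<le> dim (?E\<^sup>\<bottom>)" using q by (simp add: coord_space_orthogonal_comp)
    interpret P: prob_space "grass_measure ?E ?p" by (rule sets_grass_measure(3)[OF subspace_coord_space dims(1)])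
    interpret Q: prob_space "grass_measure (?E\<^sup>\<bottom>) ?q" by (rule sets_grass_measure(3)[OF subspace_orthogonal_comp qE])
    show ?thesis by (simp add: P.emeasure_space_1 Q.emeasure_space_1)
  qed
  finally show ?thesis unfolding J0_def compl_pl .
qed

end

section \<open>Averaging a slab over rotations\<close>

context coord_split
begin

text \<open>
  The probability that a random rotation from O(E_p \<oplus> E_q) \<times> O(E_l \<oplus> E_\<rho>) moves y into the slab
  where the E_\<rho>-component has norm at most a.
\<close>

definition slab_weight :: "real \<Rightarrow> real^'n \<Rightarrow> ennreal" where
  "slab_weight a y = (\<integral>\<^sup>+h. indicator (cball 0 a) (coord_proj Ir (h *v y)) \<partial>haar_rot (Ip \<union> Iq))"

lemma measurable_slab_weight [measurable]: "slab_weight a \<in> borel_measurable borel"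
proof -
  have "(\<lambda>x. indicator (cball 0 a) (coord_proj Ir (snd x *v fst x)) :: ennreal)
     \<in> borel_measurable ((borel :: (real^'n) measure) \<Otimes>\<^sub>M haar_rot (Ip \<union> Iq))"
    by measurable
  from haar_rot.borel_measurable_nn_integral_fst[OF this] show ?thesis
    by (simp add: slab_weight_def[abs_def])
qed

lemma slab_weight_le_1: "slab_weight a y \<le> 1"
proof -
  have "slab_weight a y \<le> (\<integral>\<^sup>+h. 1 \<partial>haar_rot (Ip \<union> Iq))"
    unfolding slab_weight_def by (intro nn_integral_mono) (simp add: indicator_def)
  then show ?thesis by (simp add: haar_rot.emeasure_space_1[simplified])
qed

text \<open>
  If v = x + w with x \<in> E_q and w \<in> E_\<rho>, the translate of E_p \<oplus> E_q by u + v depends only on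
  u + w, so integrating over x costs at most the volume of a ball in E_q. The integral over the
  slab that is left does not change when the slab is rotated by an element of
  O(E_p \<oplus> E_q) \<times> O(E_l \<oplus> E_\<rho>), so it may be averaged over these rotations.
\<close>

lemma transform_on_ball_le:
  fixes f :: "(real^'n) set \<Rightarrow> ennreal"
  assumes f: "f \<in> borel_measurable (plane_algebra (affine_grass (card (Ip \<union> Iq))))"
  shows "(\<integral>\<^sup>+\<zeta>. indicator {..a} (norm (foot \<zeta>)) *
        (\<integral>\<^sup>+w. f (plane_sum w (foot \<zeta>)) \<partial>strichartz_measure (card Ip) (card Iq) (dir_space \<zeta>))
          \<partial>affine_grass_measure (card (Ip \<union> Il))) \<le>
     emeasure (coord_lebesgue Iq) (cball 0 a) *
       (\<integral>\<^sup>+A. (\<integral>\<^sup>+y. slab_weight a y * f ((*v) A ` ((+) y ` coord_space (Ip \<union> Iq)))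
         \<partial>coord_lebesgue (Il \<union> Ir)) \<partial>haar_rot UNIV)"
proof -
  let ?E = "coord_space (Ip \<union> Iq)"
  define F where "F A y = f ((*v) A ` ((+) y ` ?E))" for A y
  let ?c = "emeasure (coord_lebesgue Iq) (cball 0 a)"
  let ?i = "indicator (cball 0 a) :: real^'n \<Rightarrow> ennreal"
  interpret HC: pair_sigma_finite "haar_rot (UNIV::'n set)" "coord_lebesgue (Il \<union> Ir)" ..
  interpret HL: pair_sigma_finite "haar_rot (UNIV::'n set)" "coord_lebesgue Il" ..
  have F_meas: "(\<lambda>x. F (A x) (u x)) \<in> borel_measurable M" if "A \<in> M \<rightarrow>\<^sub>M rot_algebra UNIV" "u \<in> borel_measurable M"
    for A u and M :: "'z measure"
    unfolding F_def by (rule measurable_rotated_coord_plane[OF f that])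
  have F1: "(\<lambda>y. F A (g y)) \<in> borel_measurable M" if "A \<in> rot_stab UNIV" "g \<in> borel_measurable M" for A g and M :: "'z measure"
    using that by (intro F_meas measurable_const) simp_all
  \<comment> \<open>translations along E_q do not move the plane\<close>
  have Fq: "F A (u + (w + x)) = F A (u + w)" if "x \<in> coord_space Iq" for A u w x
  proof -
    have "(+) x ` ?E = ?E"
    proof (intro equalityI subsetI)
      have x: "x \<in> ?E" using that coord_space_mono[of Iq "Ip \<union> Iq"] by blast
      fix y assume "y \<in> ?E"
      then have "y - x \<in> ?E" using x by (intro subspace_diff[OF subspace_coord_space])
      then show "y \<in> (+) x ` ?E" by (rule rev_image_eqI) simp
    next
      have x: "x \<in> ?E" using that coord_space_mono[of Iq "Ip \<union> Iq"] by blast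
      fix y assume "y \<in> (+) x ` ?E"
      then show "y \<in> ?E" using x by (auto intro: subspace_add[OF subspace_coord_space])
    qed
    moreover have "(+) (u + (w + x)) ` ?E = (+) (u + w) ` ((+) x ` ?E)"
      by (simp add: image_image add.assoc)
    ultimately show ?thesis by (simp add: F_def)
  qed
  have "(\<integral>\<^sup>+\<zeta>. indicator {..a} (norm (foot \<zeta>)) *
        (\<integral>\<^sup>+w. f (plane_sum w (foot \<zeta>)) \<partial>strichartz_measure (card Ip) (card Iq) (dir_space \<zeta>))
          \<partial>affine_grass_measure (card (Ip \<union> Il))) =
     (\<integral>\<^sup>+u. (\<integral>\<^sup>+A. (\<integral>\<^sup>+v. indicator {..a} (norm v) * F A (u + v) \<partial>coord_lebesgue (Iq \<union> Ir)) \<partial>haar_rot UNIV) \<partial>coord_lebesgue Il)"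
    unfolding F_def by (rule weighted_integral_of_transform[OF f]) simp
  also have "\<dots> \<le> (\<integral>\<^sup>+u. (\<integral>\<^sup>+A. ?c * (\<integral>\<^sup>+w. ?i w * F A (u + w) \<partial>coord_lebesgue Ir) \<partial>haar_rot UNIV) \<partial>coord_lebesgue Il)"
  proof (intro nn_integral_mono)
    fix u :: "real^'n" and A :: "real^'n^'n" assume "A \<in> space (haar_rot UNIV)"
    then have A: "A \<in> rot_stab UNIV" by simp
    have [measurable]: "(\<lambda>v. F A (u + v)) \<in> borel_measurable borel" by (rule F1[OF A]) simp
    have "(\<integral>\<^sup>+v. indicator {..a} (norm v) * F A (u + v) \<partial>coord_lebesgue (Iq \<union> Ir)) =
      (\<integral>\<^sup>+w. (\<integral>\<^sup>+x. indicator {..a} (norm (w + x)) * F A (u + (w + x)) \<partial>coord_lebesgue Iq) \<partial>coord_lebesgue Ir)"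
      unfolding Un_commute[of Iq Ir] using disj by (intro nn_integral_coord_lebesgue_Un) auto
    also have "\<dots> \<le> (\<integral>\<^sup>+w. (\<integral>\<^sup>+x. ?i w * F A (u + w) * ?i x \<partial>coord_lebesgue Iq) \<partial>coord_lebesgue Ir)"
    proof (rule nn_integral_mono_AE)
      show "AE w in coord_lebesgue Ir. (\<integral>\<^sup>+x. indicator {..a} (norm (w + x)) * F A (u + (w + x)) \<partial>coord_lebesgue Iq) \<le>
         (\<integral>\<^sup>+x. ?i w * F A (u + w) * ?i x \<partial>coord_lebesgue Iq)"
        using AE_coord_lebesgue[of Ir]
      proof eventually_elim
        case (elim w)
        show ?case
        proof (rule nn_integral_mono_AE)
          show "AE x in coord_lebesgue Iq. indicator {..a} (norm (w + x)) * F A (u + (w + x)) \<le> ?i w * F A (u + w) * ?i x"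
            using AE_coord_lebesgue[of Iq]
          proof eventually_elim
            case (elim x)
            have "coord_proj Ir (w + x) = w" "coord_proj Iq (w + x) = x"
              using elim \<open>w \<in> coord_space Ir\<close> disj by (auto simp: vec_eq_iff coord_space_def)
            then have "norm w \<le> norm (w + x)" "norm x \<le> norm (w + x)"
              using norm_coord_proj_le[of Ir "w + x"] norm_coord_proj_le[of Iq "w + x"] by simp_all
            then show ?case by (auto simp: Fq[OF elim] indicator_def)
          qed
        qed
      qed
    qed
    also have "\<dots> = (\<integral>\<^sup>+w. ?i w * F A (u + w) * ?c \<partial>coord_lebesgue Ir)"
      by (simp add: nn_integral_cmult)
    also have "\<dots> = ?c * (\<integral>\<^sup>+w. ?i w * F A (u + w) \<partial>coord_lebesgue Ir)"
      by (subst nn_integral_multc) (simp_all add: mult.commute)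
    finally show "(\<integral>\<^sup>+v. indicator {..a} (norm v) * F A (u + v) \<partial>coord_lebesgue (Iq \<union> Ir)) \<le>
       ?c * (\<integral>\<^sup>+w. ?i w * F A (u + w) \<partial>coord_lebesgue Ir)" .
  qed
  also have "\<dots> = ?c * (\<integral>\<^sup>+A. (\<integral>\<^sup>+y. ?i (coord_proj Ir y) * F A y \<partial>coord_lebesgue (Il \<union> Ir)) \<partial>haar_rot UNIV)"
  proof -
    have j0: "(\<lambda>x. ?i (snd x) * F (fst (fst x)) (snd (fst x) + snd x)) \<in> borel_measurable ((haar_rot UNIV \<Otimes>\<^sub>M coord_lebesgue Il) \<Otimes>\<^sub>M coord_lebesgue Ir)"
    proof (intro borel_measurable_times_ennreal F_meas)
      show "(\<lambda>x. fst (fst x)) \<in> (haar_rot UNIV \<Otimes>\<^sub>M coord_lebesgue Il) \<Otimes>\<^sub>M coord_lebesgue Ir \<rightarrow>\<^sub>M rot_algebra UNIV"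
        using measurable_compose[OF measurable_fst measurable_fst, of "haar_rot UNIV" "coord_lebesgue Il" "coord_lebesgue Ir"]
        by (simp cong: measurable_cong_sets)
    qed measurable
    have j1: "(\<lambda>x. \<integral>\<^sup>+w. ?i w * F (fst x) (snd x + w) \<partial>coord_lebesgue Ir) \<in> borel_measurable (haar_rot UNIV \<Otimes>\<^sub>M coord_lebesgue Il)"
      using coord_lebesgue.borel_measurable_nn_integral_fst[OF j0] by simp
    have "(\<integral>\<^sup>+u. (\<integral>\<^sup>+A. ?c * (\<integral>\<^sup>+w. ?i w * F A (u + w) \<partial>coord_lebesgue Ir) \<partial>haar_rot UNIV) \<partial>coord_lebesgue Il) =
       (\<integral>\<^sup>+A. (\<integral>\<^sup>+u. ?c * (\<integral>\<^sup>+w. ?i w * F A (u + w) \<partial>coord_lebesgue Ir) \<partial>coord_lebesgue Il) \<partial>haar_rot UNIV)"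
      using j1 by (intro HL.Fubini') (simp add: case_prod_beta')
    also have "\<dots> = (\<integral>\<^sup>+A. ?c * (\<integral>\<^sup>+u. (\<integral>\<^sup>+w. ?i w * F A (u + w) \<partial>coord_lebesgue Ir) \<partial>coord_lebesgue Il) \<partial>haar_rot UNIV)"
    proof (intro nn_integral_cong nn_integral_cmult)
      fix A :: "real^'n^'n" assume "A \<in> space (haar_rot UNIV)"
      from measurable_compose[OF measurable_Pair1'[OF this] j1]
      show "(\<lambda>u. \<integral>\<^sup>+w. ?i w * F A (u + w) \<partial>coord_lebesgue Ir) \<in> borel_measurable (coord_lebesgue Il)" by simp
    qed
    also have "\<dots> = ?c * (\<integral>\<^sup>+A. (\<integral>\<^sup>+u. (\<integral>\<^sup>+w. ?i w * F A (u + w) \<partial>coord_lebesgue Ir) \<partial>coord_lebesgue Il) \<partial>haar_rot UNIV)"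
      using coord_lebesgue.borel_measurable_nn_integral_fst[OF j1] by (intro nn_integral_cmult) simp
    also have "(\<integral>\<^sup>+A. (\<integral>\<^sup>+u. (\<integral>\<^sup>+w. ?i w * F A (u + w) \<partial>coord_lebesgue Ir) \<partial>coord_lebesgue Il) \<partial>haar_rot UNIV) =
       (\<integral>\<^sup>+A. (\<integral>\<^sup>+y. ?i (coord_proj Ir y) * F A y \<partial>coord_lebesgue (Il \<union> Ir)) \<partial>haar_rot UNIV)"
    proof (rule nn_integral_cong)
      fix A :: "real^'n^'n" assume "A \<in> space (haar_rot UNIV)"
      then have A: "A \<in> rot_stab UNIV" by simp
      have [measurable]: "F A \<in> borel_measurable borel" by (rule F1[OF A]) simp
      have "(\<integral>\<^sup>+y. ?i (coord_proj Ir y) * F A y \<partial>coord_lebesgue (Il \<union> Ir)) =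
        (\<integral>\<^sup>+u. (\<integral>\<^sup>+w. ?i (coord_proj Ir (u + w)) * F A (u + w) \<partial>coord_lebesgue Ir) \<partial>coord_lebesgue Il)"
        using disj by (intro nn_integral_coord_lebesgue_Un) auto
      also have "\<dots> = (\<integral>\<^sup>+u. (\<integral>\<^sup>+w. ?i w * F A (u + w) \<partial>coord_lebesgue Ir) \<partial>coord_lebesgue Il)"
      proof (rule nn_integral_cong_AE)
        show "AE u in coord_lebesgue Il. (\<integral>\<^sup>+w. ?i (coord_proj Ir (u + w)) * F A (u + w) \<partial>coord_lebesgue Ir) =
           (\<integral>\<^sup>+w. ?i w * F A (u + w) \<partial>coord_lebesgue Ir)"
          using AE_coord_lebesgue[of Il]
        proof eventually_elim
          case (elim u)
          show ?case
          proof (rule nn_integral_cong_AE)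
            show "AE w in coord_lebesgue Ir. ?i (coord_proj Ir (u + w)) * F A (u + w) = ?i w * F A (u + w)"
              using AE_coord_lebesgue[of Ir]
            proof eventually_elim
              case (elim w)
              have "coord_proj Ir (u + w) = w"
                using elim \<open>u \<in> coord_space Il\<close> disj by (auto simp: vec_eq_iff coord_space_def)
              then show ?case by simp
            qed
          qed
        qed
      qed
      finally show "(\<integral>\<^sup>+u. (\<integral>\<^sup>+w. ?i w * F A (u + w) \<partial>coord_lebesgue Ir) \<partial>coord_lebesgue Il) =
        (\<integral>\<^sup>+y. ?i (coord_proj Ir y) * F A y \<partial>coord_lebesgue (Il \<union> Ir))" ..
    qed
    finally show ?thesis .
  qed
  also have "(\<integral>\<^sup>+A. (\<integral>\<^sup>+y. ?i (coord_proj Ir y) * F A y \<partial>coord_lebesgue (Il \<union> Ir)) \<partial>haar_rot UNIV) =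
     (\<integral>\<^sup>+A. (\<integral>\<^sup>+y. slab_weight a y * F A y \<partial>coord_lebesgue (Il \<union> Ir)) \<partial>haar_rot UNIV)" (is "?T = _")
  proof -
    let ?HC = "haar_rot (UNIV::'n set) \<Otimes>\<^sub>M coord_lebesgue (Il \<union> Ir)"
    let ?H = "haar_rot (Ip \<union> Iq)"
    interpret HHC: pair_sigma_finite ?H ?HC ..
    have FHC: "(\<lambda>x. F (fst x) (snd x)) \<in> borel_measurable ?HC"
    proof (intro F_meas)
      show "fst \<in> ?HC \<rightarrow>\<^sub>M rot_algebra UNIV"
        using measurable_fst[of "haar_rot UNIV" "coord_lebesgue (Il \<union> Ir)"] by (simp cong: measurable_cong_sets)
    qed measurable
    have j: "(\<lambda>x. ?i (coord_proj Ir (fst x *v snd (snd x))) * F (fst (snd x)) (snd (snd x))) \<in> borel_measurable (?H \<Otimes>\<^sub>M ?HC)"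
    proof (rule borel_measurable_times_ennreal)
      have [measurable]: "(\<lambda>x. fst x) \<in> borel_measurable (?H \<Otimes>\<^sub>M ?HC)"
        by (rule measurable_compose[OF measurable_fst]) measurable
      have [measurable]: "(\<lambda>x. snd (snd x)) \<in> borel_measurable (?H \<Otimes>\<^sub>M ?HC)"
        by (rule measurable_compose[OF measurable_snd]) measurable
      show "(\<lambda>x. ?i (coord_proj Ir (fst x *v snd (snd x)))) \<in> borel_measurable (?H \<Otimes>\<^sub>M ?HC)"
        by measurable
      show "(\<lambda>x. F (fst (snd x)) (snd (snd x))) \<in> borel_measurable (?H \<Otimes>\<^sub>M ?HC)"
        by (rule measurable_compose[OF measurable_snd FHC])
    qed
    have jh: "(\<lambda>x. ?i (coord_proj Ir (h *v snd x)) * F (fst x) (snd x)) \<in> borel_measurable ?HC" for h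
      using FHC by measurable
    \<comment> \<open>the integral over the slab equals the one over each rotated slab, hence also their mean\<close>
    have "?T = (\<integral>\<^sup>+h. ?T \<partial>?H)" by (simp add: haar_rot.emeasure_space_1[simplified])
    also have "\<dots> = (\<integral>\<^sup>+h. (\<integral>\<^sup>+x. ?i (coord_proj Ir (h *v snd x)) * F (fst x) (snd x) \<partial>?HC) \<partial>?H)"
    proof (rule nn_integral_cong)
      fix h assume "h \<in> space ?H"
      then have h: "h \<in> rot_stab (Ip \<union> Iq)" by simp
      then have hc: "h \<in> rot_stab (Il \<union> Ir)" using rot_stab_compl[of "Ip \<union> Iq"] unfolding compl_pq by simp
      have hU: "h \<in> rot_stab UNIV" using rot_stab_orthogonal[OF h] by (simp add: rot_stab_UNIV)
      have hE: "(*v) h ` ?E = ?E" using h by (simp add: rot_stab_def)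
      define H where "H A = (\<integral>\<^sup>+y. ?i (coord_proj Ir (h *v y)) * F A y \<partial>coord_lebesgue (Il \<union> Ir))" for A
      have mH: "H \<in> borel_measurable (rot_algebra UNIV)"
        using coord_lebesgue.borel_measurable_nn_integral_fst[OF jh[of h]]
        unfolding H_def[abs_def] by (simp cong: measurable_cong_sets)
      have Fh: "F A (h *v y) = F (A ** h) y" for A y
      proof -
        have "(+) (h *v y) ` ?E = (*v) h ` ((+) y ` ?E)" by (simp only: rotate_translate hE)
        then show ?thesis by (simp only: F_def image_matrix_mul)
      qed
      have "?T = (\<integral>\<^sup>+A. H (A ** h) \<partial>haar_rot UNIV)"
      proof (rule nn_integral_cong)
        fix A :: "real^'n^'n" assume "A \<in> space (haar_rot UNIV)"
        then have A: "A \<in> rot_stab UNIV" by simp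
        have [measurable]: "F A \<in> borel_measurable borel" by (rule F1[OF A]) simp
        have "(\<lambda>y. ?i (coord_proj Ir y) * F A y) \<in> borel_measurable borel" by measurable
        from nn_integral_coord_lebesgue_rotate[OF hc this]
        show "(\<integral>\<^sup>+y. ?i (coord_proj Ir y) * F A y \<partial>coord_lebesgue (Il \<union> Ir)) = H (A ** h)"
          by (simp only: H_def Fh)
      qed
      also have "\<dots> = (\<integral>\<^sup>+A. H A \<partial>haar_rot UNIV)" by (rule nn_integral_haar_right[OF hU mH])
      also have "\<dots> = (\<integral>\<^sup>+x. ?i (coord_proj Ir (h *v snd x)) * F (fst x) (snd x) \<partial>?HC)"
        using coord_lebesgue.nn_integral_fst[OF jh[of h]] by (simp add: H_def)
      finally show "?T = (\<integral>\<^sup>+x. ?i (coord_proj Ir (h *v snd x)) * F (fst x) (snd x) \<partial>?HC)" .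
    qed
    also have "\<dots> = (\<integral>\<^sup>+x. (\<integral>\<^sup>+h. ?i (coord_proj Ir (h *v snd x)) * F (fst x) (snd x) \<partial>?H) \<partial>?HC)"
      using j by (intro HHC.Fubini'[symmetric]) (simp add: case_prod_beta')
    also have "\<dots> = (\<integral>\<^sup>+x. slab_weight a (snd x) * F (fst x) (snd x) \<partial>?HC)"
    proof (rule nn_integral_cong)
      fix x :: "(real^'n^'n) \<times> (real^'n)"
      have "(\<lambda>h. ?i (coord_proj Ir (h *v snd x))) \<in> borel_measurable ?H" by measurable
      then show "(\<integral>\<^sup>+h. ?i (coord_proj Ir (h *v snd x)) * F (fst x) (snd x) \<partial>?H) = slab_weight a (snd x) * F (fst x) (snd x)"
        unfolding slab_weight_def by (rule nn_integral_multc)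
    qed
    also have "\<dots> = (\<integral>\<^sup>+A. (\<integral>\<^sup>+y. slab_weight a y * F A y \<partial>coord_lebesgue (Il \<union> Ir)) \<partial>haar_rot UNIV)"
    proof -
      have "(\<lambda>x. slab_weight a (snd x) * F (fst x) (snd x)) \<in> borel_measurable ?HC"
        using FHC by measurable
      from coord_lebesgue.nn_integral_fst[OF this] show ?thesis by simp
    qed
    finally show ?thesis .
  qed
  finally show ?thesis unfolding F_def .
qed

text \<open>
  The weight is radial, because the rotations act transitively on spheres and Haar measure is
  right invariant; and shrinking a vector keeps it in the slab.
\<close>

lemma slab_weight_antimono:
  assumes y: "y \<in> coord_space (Il \<union> Ir)" and y': "y' \<in> coord_space (Il \<union> Ir)" and le: "norm y' \<le> norm y"
  shows "slab_weight a y \<le> slab_weight a y'"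
proof (cases "y = 0")
  case True
  then show ?thesis using le by simp
next
  case False
  define c where "c = norm y' / norm y"
  have c: "0 \<le> c" "c \<le> 1" using le False by (auto simp: c_def)
  have "norm (c *\<^sub>R y) = norm y'" using False by (simp add: c_def)
  then obtain g where g: "g \<in> rot_stab (Il \<union> Ir)" "g *v (c *\<^sub>R y) = y'"
    using rot_stab_transitive_on_spheres[OF subspace_scale[OF subspace_coord_space y] y'] by blast
  have g': "g \<in> rot_stab (Ip \<union> Iq)" using g(1) rot_stab_compl[of "Ip \<union> Iq"] unfolding compl_pq by simp
  have m: "(\<lambda>h. indicator (cball 0 a) (coord_proj Ir (h *v (c *\<^sub>R y))) :: ennreal) \<in> borel_measurable (rot_algebra (Ip \<union> Iq))"
    by measurable
  have "slab_weight a y \<le> (\<integral>\<^sup>+h. indicator (cball 0 a) (coord_proj Ir (h *v (c *\<^sub>R y))) \<partial>haar_rot (Ip \<union> Iq))"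
    unfolding slab_weight_def
  proof (rule nn_integral_mono)
    fix h
    have "coord_proj Ir (h *v (c *\<^sub>R y)) = c *\<^sub>R coord_proj Ir (h *v y)"
      by (auto simp: vec_eq_iff matrix_vector_mult_scaleR)
    moreover have "c * norm (coord_proj Ir (h *v y)) \<le> 1 * norm (coord_proj Ir (h *v y))"
      using c by (intro mult_right_mono) auto
    ultimately show "indicator (cball 0 a) (coord_proj Ir (h *v y)) \<le> (indicator (cball 0 a) (coord_proj Ir (h *v (c *\<^sub>R y))) :: ennreal)"
      using c by (auto simp: indicator_def)
  qed
  also have "\<dots> = (\<integral>\<^sup>+h. indicator (cball 0 a) (coord_proj Ir ((h ** g) *v (c *\<^sub>R y))) \<partial>haar_rot (Ip \<union> Iq))"
    by (rule nn_integral_haar_right[OF g' m, symmetric])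
  also have "\<dots> = slab_weight a y'"
    by (simp only: slab_weight_def matrix_vector_mul_assoc[symmetric] g(2))
  finally show ?thesis .
qed

text \<open>
  By monotonicity the left-hand side is at most the integral of the weight over the ball of radius
  |y|. The ball is rotation invariant, so this integral is the volume of the ball intersected with
  the slab.
\<close>

lemma slab_weight_mult_ball_le:
  assumes y: "y \<in> coord_space (Il \<union> Ir)"
  shows "slab_weight a y * emeasure (coord_lebesgue (Il \<union> Ir)) (cball 0 (norm y)) \<le>
    emeasure (coord_lebesgue Il) (cball 0 (norm y)) * emeasure (coord_lebesgue Ir) (cball 0 a)"
proof -
  let ?K = "Il \<union> Ir" and ?t = "norm y"
  let ?i = "indicator (cball 0 a) :: real^'n \<Rightarrow> ennreal" and ?b = "indicator (cball 0 ?t) :: real^'n \<Rightarrow> ennreal"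
  interpret CH: pair_sigma_finite "coord_lebesgue ?K" "haar_rot (Ip \<union> Iq)" ..
  have "slab_weight a y * emeasure (coord_lebesgue ?K) (cball 0 ?t) = (\<integral>\<^sup>+z. slab_weight a y * ?b z \<partial>coord_lebesgue ?K)"
    by (simp add: nn_integral_cmult)
  also have "\<dots> \<le> (\<integral>\<^sup>+z. slab_weight a z * ?b z \<partial>coord_lebesgue ?K)"
  proof (rule nn_integral_mono_AE)
    show "AE z in coord_lebesgue ?K. slab_weight a y * ?b z \<le> slab_weight a z * ?b z"
      using AE_coord_lebesgue[of ?K] by eventually_elim (auto simp: indicator_def intro: slab_weight_antimono[OF y])
  qed
  also have "\<dots> = (\<integral>\<^sup>+z. (\<integral>\<^sup>+h. ?i (coord_proj Ir (h *v z)) * ?b z \<partial>haar_rot (Ip \<union> Iq)) \<partial>coord_lebesgue ?K)"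
    unfolding slab_weight_def by (intro nn_integral_cong nn_integral_multc[symmetric]) measurable
  also have "\<dots> = (\<integral>\<^sup>+h. (\<integral>\<^sup>+z. ?i (coord_proj Ir (h *v z)) * ?b z \<partial>coord_lebesgue ?K) \<partial>haar_rot (Ip \<union> Iq))"
    by (rule CH.Fubini'[symmetric]) measurable
  also have "\<dots> = (\<integral>\<^sup>+h. (\<integral>\<^sup>+z. ?i (coord_proj Ir z) * ?b z \<partial>coord_lebesgue ?K) \<partial>haar_rot (Ip \<union> Iq))"
  proof (rule nn_integral_cong)
    fix h assume "h \<in> space (haar_rot (Ip \<union> Iq))"
    then have h: "h \<in> rot_stab (Ip \<union> Iq)" by simp
    then have hc: "h \<in> rot_stab ?K" using rot_stab_compl[of "Ip \<union> Iq"] unfolding compl_pq by simp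
    have b: "?b (h *v z) = ?b z" for z by (simp add: indicator_def orthogonal_matrix_norm[OF rot_stab_orthogonal[OF h]])
    have "(\<lambda>z. ?i (coord_proj Ir z) * ?b z) \<in> borel_measurable borel" by measurable
    from nn_integral_coord_lebesgue_rotate[OF hc this]
    show "(\<integral>\<^sup>+z. ?i (coord_proj Ir (h *v z)) * ?b z \<partial>coord_lebesgue ?K) = (\<integral>\<^sup>+z. ?i (coord_proj Ir z) * ?b z \<partial>coord_lebesgue ?K)"
      by (simp only: b)
  qed
  also have "\<dots> = (\<integral>\<^sup>+z. ?i (coord_proj Ir z) * ?b z \<partial>coord_lebesgue ?K)"
    by (simp add: haar_rot.emeasure_space_1[simplified])
  also have "\<dots> = (\<integral>\<^sup>+u. (\<integral>\<^sup>+w. ?i (coord_proj Ir (u + w)) * ?b (u + w) \<partial>coord_lebesgue Ir) \<partial>coord_lebesgue Il)"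
    using disj by (intro nn_integral_coord_lebesgue_Un) auto
  also have "\<dots> \<le> (\<integral>\<^sup>+u. (\<integral>\<^sup>+w. ?b u * ?i w \<partial>coord_lebesgue Ir) \<partial>coord_lebesgue Il)"
  proof (rule nn_integral_mono_AE)
    show "AE u in coord_lebesgue Il. (\<integral>\<^sup>+w. ?i (coord_proj Ir (u + w)) * ?b (u + w) \<partial>coord_lebesgue Ir) \<le>
       (\<integral>\<^sup>+w. ?b u * ?i w \<partial>coord_lebesgue Ir)"
      using AE_coord_lebesgue[of Il]
    proof eventually_elim
      case (elim u)
      show ?case
      proof (rule nn_integral_mono_AE)
        show "AE w in coord_lebesgue Ir. ?i (coord_proj Ir (u + w)) * ?b (u + w) \<le> ?b u * ?i w"
          using AE_coord_lebesgue[of Ir]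
        proof eventually_elim
          case (elim w)
          have "coord_proj Ir (u + w) = w" "coord_proj Il (u + w) = u"
            using elim \<open>u \<in> coord_space Il\<close> disj by (auto simp: vec_eq_iff coord_space_def)
          then show ?case using norm_coord_proj_le[of Il "u + w"] by (auto simp: indicator_def)
        qed
      qed
    qed
  qed
  also have "\<dots> = (\<integral>\<^sup>+u. ?b u * emeasure (coord_lebesgue Ir) (cball 0 a) \<partial>coord_lebesgue Il)"
    by (simp add: nn_integral_cmult)
  also have "\<dots> = emeasure (coord_lebesgue Il) (cball 0 ?t) * emeasure (coord_lebesgue Ir) (cball 0 a)"
    by (simp add: nn_integral_multc)
  finally show ?thesis .
qed

lemma slab_weight_decay:
  fixes a :: real
  assumes y: "y \<in> coord_space (Il \<union> Ir)" "y \<noteq> 0" and a: "a \<ge> 0"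
  shows "slab_weight a y \<le> ennreal (CARD('n) ^ (card Il + card Ir) * 2 ^ card Il * (2 * a) ^ card Ir / norm y ^ card Ir)"
proof -
  let ?t = "norm y" and ?N = "real CARD('n)" and ?l = "card Il" and ?r = "card Ir"
  have t: "?t > 0" using y by simp
  have cK: "card (Il \<union> Ir) = ?l + ?r" using disj by (simp add: card_Un_disjoint)
  have W: "slab_weight a y \<noteq> \<infinity>" using slab_weight_le_1[of a y] by (auto simp: top_unique)
  then obtain w where w: "slab_weight a y = ennreal w" "w \<ge> 0" by (cases "slab_weight a y") auto
  have "ennreal (w * (?t / ?N) ^ (?l + ?r)) = slab_weight a y * ennreal ((?t / ?N) ^ card (Il \<union> Ir))"
    using w by (simp add: ennreal_mult'' cK)
  also have "\<dots> \<le> slab_weight a y * emeasure (coord_lebesgue (Il \<union> Ir)) (cball 0 ?t)"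
    by (intro mult_left_mono emeasure_coord_lebesgue_cball_ge) auto
  also have "\<dots> \<le> emeasure (coord_lebesgue Il) (cball 0 ?t) * emeasure (coord_lebesgue Ir) (cball 0 a)"
    by (rule slab_weight_mult_ball_le[OF y(1)])
  also have "\<dots> \<le> ennreal ((2 * ?t) ^ ?l) * ennreal ((2 * a) ^ ?r)"
    using a by (intro mult_mono emeasure_coord_lebesgue_cball_le) auto
  also have "\<dots> = ennreal ((2 * ?t) ^ ?l * (2 * a) ^ ?r)"
    using a by (simp add: ennreal_mult'')
  finally have "w * (?t / ?N) ^ (?l + ?r) \<le> (2 * ?t) ^ ?l * (2 * a) ^ ?r"
    using a by (subst (asm) ennreal_le_iff) auto
  then have "w * (?t / ?N) ^ (?l + ?r) * (?N ^ (?l + ?r) / ?t ^ (?l + ?r)) \<le> (2 * ?t) ^ ?l * (2 * a) ^ ?r * (?N ^ (?l + ?r) / ?t ^ (?l + ?r))"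
    by (rule mult_right_mono) simp
  also have "w * (?t / ?N) ^ (?l + ?r) * (?N ^ (?l + ?r) / ?t ^ (?l + ?r)) = w"
    using t by (simp add: power_divide)
  also have "(2 * ?t) ^ ?l * (2 * a) ^ ?r * (?N ^ (?l + ?r) / ?t ^ (?l + ?r)) = ?N ^ (?l + ?r) * 2 ^ ?l * (2 * a) ^ ?r / ?t ^ ?r"
    using t by (simp add: power_mult_distrib power_add field_simps)
  finally show ?thesis using w by (simp add: ennreal_leI)
qed

end

text \<open>
  Decompose into the unit ball and the dyadic shells 2^i \<le> |y| \<le> 2^(i+1), whose volumes are of
  order 2^(id) with d the dimension.
\<close>

lemma nn_integral_coord_lebesgue_dyadic_finite:
  fixes g :: "real^'n::finite \<Rightarrow> ennreal" and I :: "'n set"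
  assumes [measurable]: "g \<in> borel_measurable borel"
    and g0: "\<And>y. y \<in> coord_space I \<Longrightarrow> g y \<le> ennreal c0"
    and gi: "\<And>y i. y \<in> coord_space I \<Longrightarrow> 2 ^ i \<le> norm y \<Longrightarrow> g y \<le> ennreal (c i)"
    and c: "\<And>i::nat. c i \<ge> 0" and sum: "summable (\<lambda>i. c i * (2 ^ i) ^ card I)"
  shows "(\<integral>\<^sup>+y. g y \<partial>coord_lebesgue I) < \<infinity>"
proof -
  let ?d = "card I"
  have "(\<integral>\<^sup>+y. g y \<partial>coord_lebesgue I) \<le>
    (\<integral>\<^sup>+y. ennreal c0 * indicator (cball 0 1) y + (\<Sum>i. ennreal (c i) * indicator (cball 0 (2 ^ Suc i)) y) \<partial>coord_lebesgue I)"
  proof (rule nn_integral_mono_AE)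
    show "AE y in coord_lebesgue I. g y \<le> ennreal c0 * indicator (cball 0 1) y + (\<Sum>i. ennreal (c i) * indicator (cball 0 (2 ^ Suc i)) y)"
      using AE_coord_lebesgue[of I]
    proof eventually_elim
      case (elim y)
      show ?case
      proof (cases "norm y \<le> 1")
        case True
        then show ?thesis using g0[OF elim] by (simp add: indicator_def add_increasing2)
      next
        case False
        \<comment> \<open>the index of the shell that contains y\<close>
        define i where "i = nat \<lfloor>log 2 (norm y)\<rfloor>"
        have l: "log 2 (norm y) \<ge> 0"
        proof (subst zero_le_log_cancel_iff)
          show "0 < norm y" "1 \<le> norm y" using False by linarith+
        qed simp
        have i: "real i = of_int \<lfloor>log 2 (norm y)\<rfloor>" using l by (simp add: i_def)
        have ny: "2 powr log 2 (norm y) = norm y" using False by (intro powr_log_cancel) linarith+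
        have "2 powr real i \<le> 2 powr log 2 (norm y)" unfolding i by (intro powr_mono of_int_floor_le) simp
        then have "2 powr real i \<le> norm y" unfolding ny .
        then have lo: "2 ^ i \<le> norm y" by (simp add: powr_realpow)
        have "2 powr log 2 (norm y) < 2 powr (real i + 1)" unfolding i by (intro powr_less_mono) linarith+
        then have "norm y < 2 powr (real i + 1)" unfolding ny .
        then have hi: "norm y \<le> 2 ^ Suc i" by (simp add: powr_add powr_realpow)
        have "g y \<le> ennreal (c i) * indicator (cball 0 (2 ^ Suc i)) y" using gi[OF elim lo] hi by (simp add: indicator_def)
        also have "\<dots> \<le> (\<Sum>i. ennreal (c i) * indicator (cball 0 (2 ^ Suc i)) y)"
        proof -
          have "f i \<le> suminf f" for f :: "nat \<Rightarrow> ennreal" using sum_le_suminf[of f "{i}"] by simp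
          from this[of "\<lambda>i. ennreal (c i) * indicator (cball 0 (2 ^ Suc i)) y"] show ?thesis .
        qed
        finally show ?thesis by (simp add: add_increasing)
      qed
    qed
  qed
  also have "\<dots> = ennreal c0 * emeasure (coord_lebesgue I) (cball 0 1) + (\<Sum>i. ennreal (c i) * emeasure (coord_lebesgue I) (cball 0 (2 ^ Suc i)))"
    by (simp add: nn_integral_add nn_integral_cmult nn_integral_suminf)
  also have "\<dots> < \<infinity>"
  proof -
    have "(\<Sum>i. ennreal (c i) * emeasure (coord_lebesgue I) (cball 0 (2 ^ Suc i))) \<le> (\<Sum>i. ennreal (4 ^ ?d * (c i * (2 ^ i) ^ ?d)))"
    proof (rule suminf_le)
      fix i
      have "emeasure (coord_lebesgue I) (cball 0 (2 ^ Suc i)) \<le> ennreal ((2 * 2 ^ Suc i) ^ ?d)"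
        by (rule emeasure_coord_lebesgue_cball_le) simp
      also have "(2 * 2 ^ Suc i :: real) ^ ?d = 4 ^ ?d * (2 ^ i) ^ ?d"
      proof -
        have "(2 * 2 ^ Suc i :: real) = 4 * 2 ^ i" by simp
        then show ?thesis by (simp only: power_mult_distrib)
      qed
      finally have "ennreal (c i) * emeasure (coord_lebesgue I) (cball 0 (2 ^ Suc i)) \<le> ennreal (c i) * ennreal (4 ^ ?d * (2 ^ i) ^ ?d)"
        by (rule mult_left_mono) simp
      also have "\<dots> = ennreal (4 ^ ?d * (c i * (2 ^ i) ^ ?d))"
        using c[of i] by (simp add: ennreal_mult'[symmetric] ac_simps)
      finally show "ennreal (c i) * emeasure (coord_lebesgue I) (cball 0 (2 ^ Suc i)) \<le> ennreal (4 ^ ?d * (c i * (2 ^ i) ^ ?d))" .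
    qed auto
    also have "\<dots> = ennreal (\<Sum>i. 4 ^ ?d * (c i * (2 ^ i) ^ ?d))"
      using c sum by (intro suminf_ennreal2 summable_mult) auto
    also have "\<dots> < \<infinity>" by simp
    finally show ?thesis
      using emeasure_coord_lebesgue_cball_pos_finite(2)[of 1 I] by (simp add: ennreal_mult_less_top)
  qed
  finally show ?thesis .
qed

section \<open>Existence almost everywhere\<close>

text \<open>
  Young's inequality without its constants: compare w with x^(s-1).
\<close>

lemma young_type_bound:
  fixes w x s :: real
  assumes "w \<ge> 0" "x \<ge> 0" "s > 1"
  shows "w * x \<le> x powr s + w powr (s / (s - 1))"
proof (cases "w \<le> x powr (s - 1)")
  case True
  have "w * x \<le> x powr (s - 1) * x" using True assms by (intro mult_right_mono)
  also have "\<dots> = x powr s" using assms by (cases "x = 0") (auto simp: powr_diff)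
  finally show ?thesis by (simp add: add_increasing2)
next
  case False
  then have w: "w > 0" by (smt (verit) powr_ge_zero)
  have "x = (x powr (s - 1)) powr (1 / (s - 1))" using assms by (simp add: powr_powr)
  also have "\<dots> \<le> w powr (1 / (s - 1))" using False assms by (intro powr_mono2) auto
  finally have "w * x \<le> w * w powr (1 / (s - 1))" using w by simp
  also have "\<dots> = w powr (1 + 1 / (s - 1))" using w by (simp add: powr_add)
  also have "1 + 1 / (s - 1) = s / (s - 1)" using assms by (simp add: field_simps)
  finally show ?thesis by (simp add: add_increasing)
qed

lemma borel_measurable_completion_AE:
  fixes F F' :: "'b \<Rightarrow> real"
  assumes "F' \<in> borel_measurable M" and ae: "AE x in M. F x = F' x"
  shows "F \<in> borel_measurable (completion M)"
proof -
  have F': "F' \<in> borel_measurable (completion M)" by (rule measurable_completion[OF assms(1)])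
  have ae': "AE x in completion M. F x = F' x" by (rule AE_completion[OF ae])
  show ?thesis
  proof (rule measurableI)
    fix S :: "real set" assume S: "S \<in> sets borel"
    show "F -` S \<inter> space (completion M) \<in> sets (completion M)"
    proof (rule completion.in_sets_AE)
      show "F' -` S \<inter> space (completion M) \<in> sets (completion M)" by (rule measurable_sets[OF F' S])
      show "AE x in completion M. (x \<in> F' -` S \<inter> space (completion M)) = (x \<in> F -` S \<inter> space (completion M))"
        using ae' by eventually_elim auto
    qed auto
  qed simp
qed

context coord_split
begin

abbreviation transform_integral :: "((real^'n) set \<Rightarrow> ennreal) \<Rightarrow> (real^'n) set \<Rightarrow> ennreal" where
  "transform_integral f \<zeta> \<equiv>
     \<integral>\<^sup>+w. f (plane_sum w (foot \<zeta>)) \<partial>strichartz_measure (card Ip) (card Iq) (dir_space \<zeta>)"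

abbreviation weighted_integral :: "real \<Rightarrow> ((real^'n) set \<Rightarrow> ennreal) \<Rightarrow> ennreal" where
  "weighted_integral a f \<equiv> \<integral>\<^sup>+A. (\<integral>\<^sup>+y. slab_weight a y * f ((*v) A ` ((+) y ` coord_space (Ip \<union> Iq)))
         \<partial>coord_lebesgue (Il \<union> Ir)) \<partial>haar_rot UNIV"

lemma card_bounds: "card Ip \<le> card (Ip \<union> Il)" "card Iq \<le> card (- (Ip \<union> Il))"
  unfolding compl_pl by (simp_all add: card_mono)

lemma measurable_transform_integral:
  assumes f: "f \<in> borel_measurable (plane_algebra (affine_grass (card (Ip \<union> Iq))))"
  shows "transform_integral f \<in> borel_measurable (plane_algebra (affine_grass (card (Ip \<union> Il))))"
  by (rule measurable_nn_integral_strichartz[OF card_bounds f[unfolded card_pq]])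

lemma transform_integral_AE:
  assumes f: "f \<in> borel_measurable (plane_algebra (affine_grass (card (Ip \<union> Iq))))"
  shows "(\<And>a. a \<ge> 0 \<Longrightarrow> weighted_integral a f < \<infinity>) \<Longrightarrow>
      AE \<zeta> in affine_grass_measure (card (Ip \<union> Il)). transform_integral f \<zeta> < \<infinity>" (is "PROP ?fin \<Longrightarrow> ?A")
    and "(\<And>a. a \<ge> 0 \<Longrightarrow> weighted_integral a f = 0) \<Longrightarrow>
      AE \<zeta> in affine_grass_measure (card (Ip \<union> Il)). transform_integral f \<zeta> = 0" (is "PROP ?zero \<Longrightarrow> ?B")
proof -
  let ?M = "affine_grass_measure (card (Ip \<union> Il)) :: (real^'n) set measure"
  note m = measurable_transform_integral[OF f]
  have mi: "(\<lambda>\<zeta>. indicator {..a} (norm (foot \<zeta>)) * transform_integral f \<zeta>) \<in> borel_measurable ?M" for a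
  proof -
    have "(\<lambda>\<zeta>. indicator {..a} (norm (foot \<zeta>)) * transform_integral f \<zeta>) \<in> borel_measurable (plane_algebra (affine_grass (card (Ip \<union> Il))))"
      using m by measurable
    then show ?thesis by (simp cong: measurable_cong_sets)
  qed
  have cfin: "emeasure (coord_lebesgue Iq) (cball 0 (real a)) < \<infinity>" for a :: nat
    using emeasure_coord_lebesgue_cball_le[of "real a" Iq] by (auto simp: less_top[symmetric] top_unique)
  {
    assume fin: "PROP ?fin"
    have "AE \<zeta> in ?M. \<forall>a::nat. indicator {..real a} (norm (foot \<zeta>)) * transform_integral f \<zeta> \<noteq> \<infinity>"
    proof (rule AE_all_countable[THEN iffD2], rule allI)
      fix a :: nat
      have "(\<integral>\<^sup>+\<zeta>. indicator {..real a} (norm (foot \<zeta>)) * transform_integral f \<zeta> \<partial>?M) < \<infinity>"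
        using transform_on_ball_le[OF f, of "real a"] cfin[of a] fin[of "real a"]
        by (elim le_less_trans) (simp add: ennreal_mult_less_top)
      then show "AE \<zeta> in ?M. indicator {..real a} (norm (foot \<zeta>)) * transform_integral f \<zeta> \<noteq> \<infinity>"
        by (intro nn_integral_PInf_AE mi) simp
    qed
    then show ?A
    proof eventually_elim
      case (elim \<zeta>)
      obtain a :: nat where "norm (foot \<zeta>) \<le> real a" using real_arch_simple by blast
      then show ?case using elim[rule_format, of a] by (simp add: less_top)
    qed
  }
  {
    assume z: "PROP ?zero"
    have "AE \<zeta> in ?M. \<forall>a::nat. indicator {..real a} (norm (foot \<zeta>)) * transform_integral f \<zeta> = 0"
    proof (rule AE_all_countable[THEN iffD2], rule allI)
      fix a :: nat
      have "(\<integral>\<^sup>+\<zeta>. indicator {..real a} (norm (foot \<zeta>)) * transform_integral f \<zeta> \<partial>?M) = 0"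
        using transform_on_ball_le[OF f, of "real a"] z[of "real a"] by simp
      then show "AE \<zeta> in ?M. indicator {..real a} (norm (foot \<zeta>)) * transform_integral f \<zeta> = 0"
        by (subst (asm) nn_integral_0_iff_AE[OF mi])
    qed
    then show ?B
    proof eventually_elim
      case (elim \<zeta>)
      obtain a :: nat where "norm (foot \<zeta>) \<le> real a" using real_arch_simple by blast
      then show ?case using elim[rule_format, of a] by simp
    qed
  }
qed

lemma nn_integral_affine_pq:
  assumes f: "f \<in> borel_measurable (plane_algebra (affine_grass (card (Ip \<union> Iq))))"
  shows "(\<integral>\<^sup>+\<tau>. f \<tau> \<partial>affine_grass_measure (card (Ip \<union> Iq))) =
     (\<integral>\<^sup>+A. (\<integral>\<^sup>+y. f ((*v) A ` ((+) y ` coord_space (Ip \<union> Iq))) \<partial>coord_lebesgue (Il \<union> Ir)) \<partial>haar_rot UNIV)"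
  using nn_integral_affine_grass_measure[OF refl f] unfolding compl_pq .

lemma weighted_integral_le:
  assumes f: "f \<in> borel_measurable (plane_algebra (affine_grass (card (Ip \<union> Iq))))"
  shows "weighted_integral a f \<le> (\<integral>\<^sup>+\<tau>. f \<tau> \<partial>affine_grass_measure (card (Ip \<union> Iq)))"
  unfolding nn_integral_affine_pq[OF f]
  using slab_weight_le_1 by (intro nn_integral_mono) (metis mult.left_neutral mult_right_mono zero_le)

lemma slab_weight_power_integrable:
  fixes s' a :: real
  assumes s: "s' * card Ir > card Il + card Ir" "s' > 0" and a: "a \<ge> 0"
  shows "(\<integral>\<^sup>+y. ennreal (enn2real (slab_weight a y) powr s') \<partial>coord_lebesgue (Il \<union> Ir)) < \<infinity>"
proof -
  let ?l = "card Il" and ?r = "card Ir"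
  define K where "K = real CARD('n) ^ (?l + ?r) * 2 ^ ?l * (2 * a) ^ ?r"
  have K: "K \<ge> 0" using a by (simp add: K_def)
  define c where "c i = (K / (2 ^ i) ^ ?r) powr s'" for i :: nat
  have cK: "card (Il \<union> Ir) = ?l + ?r" using disj by (simp add: card_Un_disjoint)
  show ?thesis
  proof (rule nn_integral_coord_lebesgue_dyadic_finite[where c = c])
    show "(\<lambda>y. ennreal (enn2real (slab_weight a y) powr s')) \<in> borel_measurable borel" by measurable
    show "ennreal (enn2real (slab_weight a y) powr s') \<le> ennreal 1" for y
    proof (rule ennreal_leI)
      have "enn2real (slab_weight a y) \<le> 1" using slab_weight_le_1[of a y] by (simp add: enn2real_leI)
      then show "enn2real (slab_weight a y) powr s' \<le> 1" using s(2) by (intro powr_le1) auto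
    qed
    show "ennreal (enn2real (slab_weight a y) powr s') \<le> ennreal (c i)" if y: "y \<in> coord_space (Il \<union> Ir)" "2 ^ i \<le> norm y" for y i
    proof (rule ennreal_leI)
      have y0: "y \<noteq> 0" using y(2) by (metis not_le norm_zero zero_less_numeral zero_less_power)
      have "slab_weight a y \<le> ennreal (K / norm y ^ ?r)" using slab_weight_decay[OF y(1) y0 a] by (simp add: K_def)
      also have "\<dots> \<le> ennreal (K / (2 ^ i) ^ ?r)"
        using y(2) K y0 by (intro ennreal_leI divide_left_mono power_mono) auto
      finally have "enn2real (slab_weight a y) \<le> K / (2 ^ i) ^ ?r" using K by (intro enn2real_leI) auto
      then show "enn2real (slab_weight a y) powr s' \<le> c i" unfolding c_def using s(2) by (intro powr_mono2) auto
    qed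
    show "c i \<ge> 0" for i by (simp add: c_def)
    have "c i * (2 ^ i) ^ (?l + ?r) = K powr s' * (2 powr (real (?l + ?r) - s' * real ?r)) ^ i" for i
    proof -
      have e: "((2::real) ^ i) ^ m = 2 powr (real i * real m)" for m
        by (simp add: powr_realpow[symmetric] powr_powr)
      have "c i * (2 ^ i) ^ (?l + ?r) = (K / 2 powr (real i * real ?r)) powr s' * 2 powr (real i * real (?l + ?r))"
        unfolding c_def e ..
      also have "(K / 2 powr (real i * real ?r)) powr s' = K powr s' / 2 powr (real i * real ?r * s')"
        using K by (simp add: powr_divide powr_powr)
      also have "K powr s' / 2 powr (real i * real ?r * s') * 2 powr (real i * real (?l + ?r)) =
        K powr s' * 2 powr (real i * (real (?l + ?r) - s' * real ?r))"
        by (simp add: algebra_simps powr_diff powr_add)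
      also have "2 powr (real i * (real (?l + ?r) - s' * real ?r)) = (2 powr (real (?l + ?r) - s' * real ?r)) ^ i"
        by (simp add: powr_powr powr_realpow[symmetric] mult.commute)
      finally show ?thesis .
    qed
    moreover have "summable (\<lambda>i. K powr s' * (2 powr (real (?l + ?r) - s' * real ?r)) ^ i)"
    proof (intro summable_mult summable_geometric)
      have "2 powr (real (?l + ?r) - s' * real ?r) < 2 powr 0"
        using s by (intro powr_less_mono) auto
      then show "norm ((2::real) powr (real (?l + ?r) - s' * real ?r)) < 1" by simp
    qed
    ultimately show "summable (\<lambda>i. c i * (2 ^ i) ^ card (Il \<union> Ir))" by (simp add: cK)
  qed
qed

text \<open>
  For s = 1 the weight is bounded by 1. For s > 1 the hypothesis s < (l+\<rho>)/l says that the
  conjugate exponent s' satisfies \<rho> s' > l + \<rho>.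
\<close>

lemma weighted_integral_finite:
  fixes f :: "(real^'n) set \<Rightarrow> real"
  assumes f: "f \<in> borel_measurable (plane_algebra (affine_grass (card (Ip \<union> Iq))))" and f0: "\<And>\<tau>. f \<tau> \<ge> 0"
    and s: "1 \<le> s" "s < (real (card Il) + real (card Ir)) / real (card Il)" and l: "card Il > 0" and a: "a \<ge> 0"
    and fin: "(\<integral>\<^sup>+\<tau>. ennreal (f \<tau> powr s) \<partial>affine_grass_measure (card (Ip \<union> Iq))) < \<infinity>"
  shows "weighted_integral a (\<lambda>\<tau>. ennreal (f \<tau>)) < \<infinity>"
proof (cases "s = 1")
  case True
  have fe: "(\<lambda>\<tau>. ennreal (f \<tau>)) \<in> borel_measurable (plane_algebra (affine_grass (card (Ip \<union> Iq))))" using f by measurable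
  have "(\<integral>\<^sup>+\<tau>. ennreal (f \<tau>) \<partial>affine_grass_measure (card (Ip \<union> Iq))) < \<infinity>"
    using fin True f0 by simp
  then show ?thesis using weighted_integral_le[OF fe, of a] by (rule le_less_trans[rotated])
next
  case False
  then have s1: "s > 1" using s by simp
  \<comment> \<open>the conjugate exponent, so that 1/s + 1/s' = 1\<close>
  define s' where "s' = s / (s - 1)"
  have "s * real (card Il) < real (card Il) + real (card Ir)"
    using s(2) l by (simp add: pos_less_divide_eq)
  then have "s * (real (card Il) + real (card Ir)) - (real (card Il) + real (card Ir)) < s * real (card Ir)"
    by (simp add: algebra_simps)
  then have "(real (card Il) + real (card Ir)) * (s - 1) < s * real (card Ir)" by (simp add: algebra_simps)
  then have s': "s' * card Ir > card Il + card Ir" using s1 by (simp add: s'_def pos_less_divide_eq)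
  have s'0: "s' > 0" using s1 by (simp add: s'_def)
  let ?w = "\<lambda>y. ennreal (enn2real (slab_weight a y) powr s')"
  let ?g = "\<lambda>A y. ennreal (f ((*v) A ` ((+) y ` coord_space (Ip \<union> Iq))) powr s)"
  have fs: "(\<lambda>\<tau>. ennreal (f \<tau> powr s)) \<in> borel_measurable (plane_algebra (affine_grass (card (Ip \<union> Iq))))" using f by measurable
  have g1: "(\<lambda>y. ?g A y) \<in> borel_measurable borel" if "A \<in> rot_stab UNIV" for A
    using that by (intro measurable_rotated_coord_plane[OF fs] measurable_const) simp_all
  have g2: "(\<lambda>x. ?g (fst x) (snd x)) \<in> borel_measurable (haar_rot UNIV \<Otimes>\<^sub>M coord_lebesgue (Il \<union> Ir))"
  proof (rule measurable_rotated_coord_plane[OF fs])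
    show "fst \<in> haar_rot UNIV \<Otimes>\<^sub>M coord_lebesgue (Il \<union> Ir) \<rightarrow>\<^sub>M rot_algebra UNIV"
      using measurable_fst[of "haar_rot UNIV" "coord_lebesgue (Il \<union> Ir)"] by (simp cong: measurable_cong_sets)
  qed measurable
  have "weighted_integral a (\<lambda>\<tau>. ennreal (f \<tau>)) \<le> (\<integral>\<^sup>+A. (\<integral>\<^sup>+y. ?g A y + ?w y \<partial>coord_lebesgue (Il \<union> Ir)) \<partial>haar_rot UNIV)"
  proof (intro nn_integral_mono)
    fix A y
    let ?x = "f ((*v) A ` ((+) y ` coord_space (Ip \<union> Iq)))"
    have "slab_weight a y * ennreal ?x = ennreal (enn2real (slab_weight a y) * ?x)"
    proof -
      have "slab_weight a y < top" by (rule le_less_trans[OF slab_weight_le_1]) simp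
      then have "ennreal (enn2real (slab_weight a y)) = slab_weight a y" by (rule ennreal_enn2real)
      then show ?thesis by (simp add: ennreal_mult f0)
    qed
    also have "\<dots> \<le> ennreal (?x powr s + enn2real (slab_weight a y) powr s')"
      unfolding s'_def by (intro ennreal_leI young_type_bound f0 s1) simp
    finally show "slab_weight a y * ennreal ?x \<le> ?g A y + ?w y" by simp
  qed
  also have "\<dots> = (\<integral>\<^sup>+A. (\<integral>\<^sup>+y. ?g A y \<partial>coord_lebesgue (Il \<union> Ir)) + (\<integral>\<^sup>+y. ?w y \<partial>coord_lebesgue (Il \<union> Ir)) \<partial>haar_rot UNIV)"
    using g1 by (intro nn_integral_cong nn_integral_add) simp_all
  also have "\<dots> = (\<integral>\<^sup>+A. (\<integral>\<^sup>+y. ?g A y \<partial>coord_lebesgue (Il \<union> Ir)) \<partial>haar_rot UNIV) +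
     (\<integral>\<^sup>+A. (\<integral>\<^sup>+y. ?w y \<partial>coord_lebesgue (Il \<union> Ir)) \<partial>haar_rot (UNIV::'n set))"
    using coord_lebesgue.borel_measurable_nn_integral_fst[OF g2] by (intro nn_integral_add) simp_all
  also have "\<dots> = (\<integral>\<^sup>+\<tau>. ennreal (f \<tau> powr s) \<partial>affine_grass_measure (card (Ip \<union> Iq))) + (\<integral>\<^sup>+y. ?w y \<partial>coord_lebesgue (Il \<union> Ir))"
    by (simp add: nn_integral_affine_pq[OF fs] haar_rot.emeasure_space_1[simplified])
  also have "\<dots> < \<infinity>" using fin slab_weight_power_integrable[OF s' s'0 a] by simp
  finally show ?thesis .
qed

lemma measurable_plane_sum_strichartz:
  fixes \<zeta> :: "(real^'n) set"
  assumes \<zeta>: "\<zeta> \<in> affine_grass (card (Ip \<union> Il))"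
  shows "(\<lambda>w. plane_sum w (foot \<zeta>)) \<in> strichartz_measure (card Ip) (card Iq) (dir_space \<zeta>) \<rightarrow>\<^sub>M
     plane_algebra (affine_grass (card (Ip \<union> Iq)))"
proof -
  let ?X = "dir_space \<zeta>"
  have X: "subspace ?X" "dim ?X = card (Ip \<union> Il)"
    using dir_space_affine_grass[OF \<zeta>] by (auto simp: grass_def)
  have p: "card Ip \<le> dim ?X" and q: "card Iq \<le> CARD('n) - dim ?X"
    using card_bounds unfolding card_Compl_eq by (simp_all add: X)
  show ?thesis
    using measurable_plane_sum_section[of "foot \<zeta>" ?X "card Iq" "card Ip"]
    by (simp add: card_pq sets_strichartz_measure[OF X(1) p q] cong: measurable_cong_sets)
qed

text \<open>
  Replace f by a Borel representative f'. The planes where they differ lie in a null set N, and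
  the weighted integral of the indicator of N vanishes, so at almost every \<zeta> the integrands of f
  and f' agree almost everywhere.
\<close>

theorem strichartz_exists_AE:
  fixes f :: "(real^'n) set \<Rightarrow> real"
  assumes f: "f \<in> Lp_funs s (affine_grass_measure (card (Ip \<union> Iq)))"
    and s: "1 \<le> s" "s < (real (card Il) + real (card Ir)) / real (card Il)" and l: "card Il > 0"
  shows "AE \<zeta> in affine_grass_measure (card (Ip \<union> Il)). strichartz_exists (card Ip) (card Iq) f \<zeta>"
proof -
  let ?J = "affine_grass_measure (card (Ip \<union> Iq)) :: (real^'n) set measure"
  let ?A = "plane_algebra (affine_grass (card (Ip \<union> Iq))) :: (real^'n) set measure"
  have fm: "f \<in> borel_measurable (completion ?J)" and fi: "integrable (completion ?J) (\<lambda>x. \<bar>f x\<bar> powr s)"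
    using f by (auto simp: Lp_funs_def)
  obtain f' where f'J: "f' \<in> borel_measurable ?J" and ae: "AE \<tau> in ?J. f \<tau> = f' \<tau>"
    using completion_ex_borel_measurable_real[OF fm] by blast
  have f': "f' \<in> borel_measurable ?A" using f'J by (simp cong: measurable_cong_sets)
  obtain N where N: "N \<in> null_sets ?J" "{\<tau> \<in> space ?J. f \<tau> \<noteq> f' \<tau>} \<subseteq> N"
    using AE_E[OF ae] by (metis (mono_tags, lifting) null_setsI)
  have "(\<integral>\<^sup>+\<tau>. ennreal (\<bar>f' \<tau>\<bar> powr s) \<partial>?J) = (\<integral>\<^sup>+\<tau>. ennreal (\<bar>f \<tau>\<bar> powr s) \<partial>?J)"
    using ae by (intro nn_integral_cong_AE) (auto elim: AE_mp)
  also have "\<dots> = (\<integral>\<^sup>+\<tau>. ennreal (\<bar>f \<tau>\<bar> powr s) \<partial>completion ?J)" by (simp add: nn_integral_completion)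
  also have "\<dots> < \<infinity>" using fi by (simp add: integrable_iff_bounded)
  finally have fin: "(\<integral>\<^sup>+\<tau>. ennreal (\<bar>f' \<tau>\<bar> powr s) \<partial>?J) < \<infinity>" .
  have mabs: "(\<lambda>\<tau>. \<bar>f' \<tau>\<bar>) \<in> borel_measurable ?A" using f' by measurable
  have mabs': "(\<lambda>\<tau>. ennreal \<bar>f' \<tau>\<bar>) \<in> borel_measurable ?A" using f' by measurable
  have 1: "AE \<zeta> in affine_grass_measure (card (Ip \<union> Il)). transform_integral (\<lambda>\<tau>. ennreal \<bar>f' \<tau>\<bar>) \<zeta> < \<infinity>"
    by (rule transform_integral_AE(1)[OF mabs'], rule weighted_integral_finite[OF mabs _ s l _ fin]) auto
  have NA: "N \<in> sets ?A" using N(1) by auto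
  then have mN: "(indicator N :: _ \<Rightarrow> ennreal) \<in> borel_measurable ?A" by simp
  have 2: "AE \<zeta> in affine_grass_measure (card (Ip \<union> Il)). transform_integral (indicator N) \<zeta> = 0"
  proof (rule transform_integral_AE(2)[OF mN])
    fix a :: real
    have "(\<integral>\<^sup>+\<tau>. indicator N \<tau> \<partial>?J) = 0" using N(1) by (subst nn_integral_indicator) (auto simp: null_sets_def)
    then show "weighted_integral a (indicator N) = 0" using weighted_integral_le[OF mN, of a] by simp
  qed
  show ?thesis
    using 1 2 AE_space
  proof eventually_elim
    case (elim \<zeta>)
    then have \<zeta>: "\<zeta> \<in> affine_grass (card (Ip \<union> Il))" by simp
    let ?S = "strichartz_measure (card Ip) (card Iq) (dir_space \<zeta>)"
    let ?F = "\<lambda>w. f (plane_sum w (foot \<zeta>))" and ?F' = "\<lambda>w. f' (plane_sum w (foot \<zeta>))"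
    note ps = measurable_plane_sum_strichartz[OF \<zeta>]
    have F': "?F' \<in> borel_measurable ?S" by (rule measurable_compose[OF ps f'])
    have int: "integrable ?S ?F'" using elim(1) F' by (simp add: integrable_iff_bounded)
    have "AE w in ?S. indicator N (plane_sum w (foot \<zeta>)) = (0::ennreal)"
      using elim(2) by (subst (asm) nn_integral_0_iff_AE[OF measurable_compose[OF ps mN]])
    then have ae: "AE w in ?S. ?F w = ?F' w"
      using AE_space
    proof eventually_elim
      case (elim w)
      then have "plane_sum w (foot \<zeta>) \<in> affine_grass (card (Ip \<union> Iq))" using measurable_space[OF ps] by simp
      then show ?case using elim N(2) by (auto simp: indicator_def split: if_splits)
    qed
    have "?F \<in> borel_measurable (completion ?S)" by (rule borel_measurable_completion_AE[OF F' ae])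
    moreover have "integrable (completion ?S) ?F'" using int F' by (simp add: integrable_completion)
    ultimately have "integrable (completion ?S) ?F"
      by (subst integrable_cong_AE[where g = ?F']) (auto intro: AE_completion[OF ae] measurable_completion F')
    then show ?case
      unfolding strichartz_exists_def by (simp add: strichartz_integrand_plane_sum[abs_def])
  qed
qed

end

section \<open>Sharpness of the exponent\<close>

text \<open>
  The logarithm gives summability to the power s > 1 at the critical rate of decay, but not to the
  first power.
\<close>

definition critical_profile :: "nat \<Rightarrow> real \<Rightarrow> real \<Rightarrow> real" where
  "critical_profile d s t = (1 + t) powr (- (real d / s)) / (1 + ln (1 + t))"

lemma critical_profile_nonneg: "t \<ge> 0 \<Longrightarrow> critical_profile d s t \<ge> 0"
  by (auto simp: critical_profile_def intro!: divide_nonneg_nonneg add_nonneg_nonneg)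

lemma critical_profile_antimono:
  assumes "0 \<le> t" "t \<le> u" "s > 0"
  shows "critical_profile d s u \<le> critical_profile d s t"
  unfolding critical_profile_def
proof (rule frac_le)
  show "(1 + u) powr (- (real d / s)) \<le> (1 + t) powr (- (real d / s))"
    using assms by (intro powr_mono2') auto
  show "1 + ln (1 + t) \<le> 1 + ln (1 + u)" using assms by simp
  show "0 < 1 + ln (1 + t)" using assms by (simp add: add_pos_nonneg)
qed simp

lemma measurable_critical_profile [measurable]: "critical_profile d s \<in> borel_measurable borel"
  unfolding critical_profile_def[abs_def] by measurable

lemma critical_profile_power_integrable:
  fixes I :: "'n::finite set"
  assumes s: "s > 1"
  shows "(\<integral>\<^sup>+y. ennreal (critical_profile (card I) s (norm y) powr s) \<partial>coord_lebesgue I) < \<infinity>"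
proof -
  let ?d = "card I"
  define c where "c i = 1 / (2 ^ i) ^ ?d * (ln 2 * real (Suc i)) powr (- s)" for i :: nat
  show ?thesis
  proof (rule nn_integral_coord_lebesgue_dyadic_finite[where c = c])
    show "ennreal (critical_profile ?d s (norm y) powr s) \<le> ennreal 1" for y :: "real^'n"
    proof (rule ennreal_leI)
      have "critical_profile ?d s (norm y) \<le> critical_profile ?d s 0" using s by (intro critical_profile_antimono) auto
      also have "\<dots> = 1" by (simp add: critical_profile_def)
      finally show "critical_profile ?d s (norm y) powr s \<le> 1"
        using s by (intro powr_le1) (auto simp: critical_profile_nonneg)
    qed
    show "ennreal (critical_profile ?d s (norm y) powr s) \<le> ennreal (c i)" if "2 ^ i \<le> norm y" for y :: "real^'n" and i
    proof (rule ennreal_leI)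
      have "critical_profile ?d s (norm y) \<le> critical_profile ?d s (2 ^ i)"
        using s that by (intro critical_profile_antimono) auto
      also have "\<dots> \<le> (2 ^ i) powr (- (real ?d / s)) / (ln 2 * real (Suc i))"
        unfolding critical_profile_def
      proof (rule frac_le)
        show "(1 + 2 ^ i) powr (- (real ?d / s)) \<le> (2 ^ i) powr (- (real ?d / s))"
          using s by (intro powr_mono2') auto
        have "real i * ln 2 = ln (2 ^ i)" by (simp add: ln_realpow)
        also have "\<dots> \<le> ln (1 + 2 ^ i)" by (subst ln_le_cancel_iff) (simp_all add: add_pos_pos)
        finally have "real i * ln 2 \<le> ln (1 + 2 ^ i)" .
        moreover have "ln 2 \<le> (1::real)" using ln_2_less_1 by simp
        ultimately show "ln 2 * real (Suc i) \<le> 1 + ln (1 + 2 ^ i)" by (simp add: algebra_simps)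
      qed simp_all
      finally have "critical_profile ?d s (norm y) powr s \<le> ((2 ^ i) powr (- (real ?d / s)) / (ln 2 * real (Suc i))) powr s"
        using s by (intro powr_mono2 critical_profile_nonneg) auto
      also have "\<dots> = (2 ^ i) powr (- real ?d) * (ln 2 * real (Suc i)) powr (- s)"
      proof -
        have "((2 ^ i) powr (- (real ?d / s)) / (ln 2 * real (Suc i))) powr s =
            ((2 ^ i) powr (- (real ?d / s))) powr s / (ln 2 * real (Suc i)) powr s"
          by (rule powr_divide)
        also have "((2 ^ i :: real) powr (- (real ?d / s))) powr s = (2 ^ i) powr (- real ?d)"
          using s by (subst powr_powr) simp
        finally show ?thesis by (simp only: powr_minus_divide[of _ s] times_divide_eq_right mult_1_right)
      qed
      also have "(2 ^ i :: real) powr (- real ?d) = 1 / (2 ^ i) ^ ?d"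
        by (simp add: powr_minus powr_realpow divide_inverse)
      finally show "critical_profile ?d s (norm y) powr s \<le> c i" by (simp add: c_def)
    qed
    show "c i \<ge> 0" for i by (simp add: c_def)
    have "c i * (2 ^ i) ^ ?d = ln 2 powr (- s) * real (Suc i) powr (- s)" for i
      by (simp add: c_def powr_mult)
    moreover have "summable (\<lambda>i. real (Suc i) powr (- s))"
      using s by (subst summable_Suc_iff) (simp add: summable_real_powr_iff)
    ultimately show "summable (\<lambda>i. c i * (2 ^ i) ^ card I)" by (simp add: summable_mult)
  qed measurable
qed

text \<open>
  Here d/s \<le> m enters: in dimension m the volume 2^(im) of the i-th shell compensates the power
  decay, which leaves the harmonic series.
\<close>

lemma critical_profile_lower_bound:
  assumes s: "s > 0" "real d \<le> s * real m" and K: "K \<ge> 1"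
  shows "critical_profile d s (K * 2 ^ i - 1) * (2 ^ i) ^ m \<ge> 1 / (K ^ m * (1 + ln K + 1)) * (1 / real (Suc i))"
proof -
  have K2: "K * 2 ^ i \<ge> 1" using K mult_mono[of 1 K 1 "2 ^ i"] by simp
  have "real d / s \<le> real m" using s by (simp add: pos_divide_le_eq mult.commute)
  then have "(K * 2 ^ i) powr (- real m) \<le> (K * 2 ^ i) powr (- (real d / s))"
    using K2 by (intro powr_mono) auto
  moreover have "(K * 2 ^ i) powr (- real m) = 1 / (K ^ m * (2 ^ i) ^ m)"
    using K by (simp add: powr_minus powr_realpow power_mult_distrib divide_inverse)
  ultimately have 1: "1 / (K ^ m * (2 ^ i) ^ m) \<le> (K * 2 ^ i) powr (- (real d / s))" by simp
  have lnK: "ln K \<ge> 0" using K by simp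
  have "1 + ln (K * 2 ^ i) = 1 + ln K + real i * ln 2" using K by (simp add: ln_mult ln_realpow)
  also have "\<dots> \<le> (1 + ln K + 1) * real (Suc i)"
  proof -
    have "real i * ln 2 \<le> real i * 1" using ln_2_less_1 by (intro mult_left_mono) auto
    moreover have "0 \<le> ln K * real i" using lnK by simp
    ultimately show ?thesis by (simp add: algebra_simps)
  qed
  finally have 2: "1 + ln (K * 2 ^ i) \<le> (1 + ln K + 1) * real (Suc i)" .
  have "1 / (K ^ m * (2 ^ i) ^ m) / ((1 + ln K + 1) * real (Suc i)) \<le> (K * 2 ^ i) powr (- (real d / s)) / (1 + ln (K * 2 ^ i))"
    using 1 2 K2 by (intro frac_le) (auto simp: add_pos_nonneg)
  also have "\<dots> = critical_profile d s (K * 2 ^ i - 1)" by (simp add: critical_profile_def)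
  finally have "1 / (K ^ m * (2 ^ i) ^ m) / ((1 + ln K + 1) * real (Suc i)) * (2 ^ i) ^ m \<le> critical_profile d s (K * 2 ^ i - 1) * (2 ^ i) ^ m"
    by (rule mult_right_mono) simp
  moreover have "1 / (K ^ m * (2 ^ i) ^ m) / ((1 + ln K + 1) * real (Suc i)) * (2 ^ i) ^ m = 1 / (K ^ m * (1 + ln K + 1)) * (1 / real (Suc i))"
  proof -
    have "1 / (k * a) / (b * c) * a = 1 / (k * b) * (1 / c)" if "a \<noteq> 0" for a b c k :: real
      using that by simp
    from this[of "(2 ^ i) ^ m" "K ^ m" "1 + ln K + 1" "real (Suc i)"] show ?thesis by simp
  qed
  ultimately show ?thesis by simp
qed

text \<open>
  The disjoint cubes with side 2^i and all coordinates in [2^i, 2^(i+1)) contribute the terms of a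
  harmonic series.
\<close>

lemma critical_profile_not_integrable:
  fixes I :: "'n::finite set"
  assumes s: "s > 0" "real d \<le> s * real (card I)" and I: "card I > 0" and c: "c \<ge> 0"
  shows "(\<integral>\<^sup>+u. ennreal (critical_profile d s (norm u + c)) \<partial>coord_lebesgue I) = \<infinity>"
proof -
  let ?m = "card I"
  \<comment> \<open>chosen so that |u| + c \<le> K 2^i - 1 on the i-th cube\<close>
  define K where "K = 1 + c + 2 * real ?m"
  have K: "K \<ge> 1" using c by (simp add: K_def)
  define B where "B i = {x::real^'n. \<forall>b\<in>I. x $ b \<in> {2 ^ i..<2 ^ Suc i}}" for i :: nat
  have B[measurable]: "B i \<in> sets borel" for i
  proof -
    have "{x \<in> space borel. \<forall>b\<in>I. x $ b \<in> {2 ^ i..<2 ^ Suc i}} \<in> sets (borel :: (real^'n) measure)"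
      by measurable
    then show ?thesis by (simp add: B_def)
  qed
  have disj: "i = j" if "x \<in> B i" "x \<in> B j" for x i j
  proof -
    obtain b where b: "b \<in> I" using I by (metis card_gt_0_iff ex_in_conv)
    have "2 ^ i < (2::real) ^ Suc j" "2 ^ j < (2::real) ^ Suc i"
      using that b unfolding B_def by fastforce+
    then have "i < Suc j" "j < Suc i"
      using power_less_imp_less_exp[of "2::real"] one_less_numeral_iff semiring_norm(76) by blast+
    then show ?thesis by simp
  qed
  let ?\<phi> = "\<lambda>i. critical_profile d s (K * 2 ^ i - 1)"
  have phi0: "?\<phi> i \<ge> 0" for i
  proof (rule critical_profile_nonneg)
    show "0 \<le> K * 2 ^ i - 1" using K mult_mono[of 1 K 1 "2 ^ i"] by simp
  qed
  have "(\<Sum>i. ennreal (?\<phi> i * (2 ^ i) ^ ?m)) = (\<Sum>i. ennreal (?\<phi> i) * emeasure (coord_lebesgue I) (B i))"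
  proof (rule suminf_cong)
    fix i
    have "emeasure (coord_lebesgue I) (B i) = ennreal ((2 ^ i) ^ ?m)"
      unfolding B_def by (subst emeasure_coord_lebesgue_box) (simp_all add: ennreal_power)
    then show "ennreal (?\<phi> i * (2 ^ i) ^ ?m) = ennreal (?\<phi> i) * emeasure (coord_lebesgue I) (B i)"
      using phi0[of i] by (simp add: ennreal_mult)
  qed
  also have "\<dots> = (\<integral>\<^sup>+u. (\<Sum>i. ennreal (?\<phi> i) * indicator (B i) u) \<partial>coord_lebesgue I)"
    by (simp add: nn_integral_suminf nn_integral_cmult)
  also have "\<dots> \<le> (\<integral>\<^sup>+u. ennreal (critical_profile d s (norm u + c)) \<partial>coord_lebesgue I)"
  proof (rule nn_integral_mono_AE)
    show "AE u in coord_lebesgue I. (\<Sum>i. ennreal (?\<phi> i) * indicator (B i) u) \<le> ennreal (critical_profile d s (norm u + c))"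
      using AE_coord_lebesgue[of I]
    proof eventually_elim
      case (elim u)
      show ?case
      proof (cases "\<exists>i. u \<in> B i")
        case False
        then show ?thesis by simp
      next
        case True
        then obtain i where i: "u \<in> B i" by blast
        have "(\<Sum>j. ennreal (?\<phi> j) * indicator (B j) u) = (\<Sum>j\<in>{i}. ennreal (?\<phi> j) * indicator (B j) u)"
          using disj[OF i] by (intro suminf_finite) (auto simp: indicator_def)
        also have "\<dots> = ennreal (?\<phi> i)" using i by simp
        also have "\<dots> \<le> ennreal (critical_profile d s (norm u + c))"
        proof (intro ennreal_leI critical_profile_antimono s)
          have "norm u \<le> (\<Sum>b\<in>UNIV. \<bar>u $ b\<bar>)" by (rule norm_le_l1_cart)
          also have "\<dots> = (\<Sum>b\<in>I. \<bar>u $ b\<bar>)"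
            using elim by (intro sum.mono_neutral_right) (auto simp: coord_space_def)
          also have "\<dots> \<le> (\<Sum>b\<in>I. 2 ^ Suc i)"
          proof (rule sum_mono)
            fix b assume "b \<in> I"
            then have "2 ^ i \<le> u $ b" "u $ b < 2 ^ Suc i" using i by (auto simp: B_def)
            moreover have "(0::real) \<le> 2 ^ i" by simp
            ultimately show "\<bar>u $ b\<bar> \<le> 2 ^ Suc i" by linarith
          qed
          also have "\<dots> = 2 * real ?m * 2 ^ i" by simp
          finally have "norm u \<le> 2 * real ?m * 2 ^ i" .
          moreover have "1 + c \<le> (1 + c) * 2 ^ i" using c mult_left_mono[of 1 "2 ^ i" "1 + c"] by simp
          ultimately show "norm u + c \<le> K * 2 ^ i - 1" by (simp add: K_def algebra_simps)
        qed (use c in simp)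
        finally show ?thesis .
      qed
    qed
  qed
  finally have le: "(\<Sum>i. ennreal (?\<phi> i * (2 ^ i) ^ ?m)) \<le> (\<integral>\<^sup>+u. ennreal (critical_profile d s (norm u + c)) \<partial>coord_lebesgue I)" .
  have "(\<Sum>i. ennreal (?\<phi> i * (2 ^ i) ^ ?m)) = \<infinity>"
  proof (rule ccontr)
    assume "(\<Sum>i. ennreal (?\<phi> i * (2 ^ i) ^ ?m)) \<noteq> \<infinity>"
    then have "summable (\<lambda>i. ?\<phi> i * (2 ^ i) ^ ?m)"
      using phi0 by (intro summable_suminf_not_top) auto
    then have "summable (\<lambda>i. 1 / (K ^ ?m * (1 + ln K + 1)) * (1 / real (Suc i)))"
    proof (rule summable_comparison_test'[where N = 0])
      fix i :: nat
      have "0 \<le> 1 / (K ^ ?m * (1 + ln K + 1)) * (1 / real (Suc i))" using K by simp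
      then show "norm (1 / (K ^ ?m * (1 + ln K + 1)) * (1 / real (Suc i))) \<le> ?\<phi> i * (2 ^ i) ^ ?m"
        using critical_profile_lower_bound[OF s K, of i] by simp
    qed
    moreover have "1 / (K ^ ?m * (1 + ln K + 1)) \<noteq> 0"
    proof -
      have "1 + ln K + 1 > 0" using K by (simp add: add_pos_nonneg)
      then show ?thesis using K by simp
    qed
    ultimately have "summable (\<lambda>i. 1 / real (Suc i))" by (subst (asm) summable_cmult_iff) blast
    then have "summable (\<lambda>i. 1 / real i)" by (subst (asm) summable_Suc_iff)
    then show False using not_summable_harmonic[where 'a = real] by (simp add: divide_inverse)
  qed
  then show ?thesis using le by (simp add: top_unique)
qed

context coord_split
begin

definition radial_counterexample :: "real \<Rightarrow> (real^'n) set \<Rightarrow> real" where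
  "radial_counterexample s \<tau> = critical_profile (card Il + card Ir) s (infdist 0 \<tau>)"

lemma measurable_radial_counterexample [measurable]:
  "radial_counterexample s \<in> borel_measurable (plane_algebra (affine_grass m))"
proof -
  have [measurable]: "(\<lambda>A::(real^'n) set. infdist 0 A) \<in> borel_measurable (plane_algebra (affine_grass m))"
    by (rule measurable_infdist_plane) simp
  show ?thesis unfolding radial_counterexample_def[abs_def] by measurable
qed

lemma radial_counterexample_nonneg: "radial_counterexample s \<tau> \<ge> 0"
  by (simp add: radial_counterexample_def critical_profile_nonneg infdist_nonneg)

lemma radial_counterexample_Lp:
  assumes s: "s > 1"
  shows "radial_counterexample s \<in> Lp_funs s (affine_grass_measure (card (Ip \<union> Iq)))"
proof -
  let ?J = "affine_grass_measure (card (Ip \<union> Iq)) :: (real^'n) set measure"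
  let ?A = "plane_algebra (affine_grass (card (Ip \<union> Iq))) :: (real^'n) set measure"
  let ?f = "radial_counterexample s"
  have f: "?f \<in> borel_measurable ?J" using measurable_radial_counterexample by (simp cong: measurable_cong_sets)
  have fs: "(\<lambda>\<tau>. ennreal (?f \<tau> powr s)) \<in> borel_measurable ?A" by measurable
  have "(\<integral>\<^sup>+\<tau>. ennreal (?f \<tau> powr s) \<partial>?J) =
     (\<integral>\<^sup>+A. (\<integral>\<^sup>+y. ennreal (critical_profile (card (Il \<union> Ir)) s (norm y) powr s) \<partial>coord_lebesgue (Il \<union> Ir)) \<partial>haar_rot (UNIV::'n set))"
    unfolding nn_integral_affine_pq[OF fs]
  proof (rule nn_integral_cong)
    fix A :: "real^'n^'n" assume "A \<in> space (haar_rot UNIV)"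
    then have A: "orthogonal_matrix A" by (simp add: rot_stab_orthogonal)
    have cK: "card (Il \<union> Ir) = card Il + card Ir" using disj by (simp add: card_Un_disjoint)
    show "(\<integral>\<^sup>+y. ennreal (?f ((*v) A ` ((+) y ` coord_space (Ip \<union> Iq))) powr s) \<partial>coord_lebesgue (Il \<union> Ir)) =
        (\<integral>\<^sup>+y. ennreal (critical_profile (card (Il \<union> Ir)) s (norm y) powr s) \<partial>coord_lebesgue (Il \<union> Ir))"
    proof (rule nn_integral_cong_AE)
      show "AE y in coord_lebesgue (Il \<union> Ir). ennreal (?f ((*v) A ` ((+) y ` coord_space (Ip \<union> Iq))) powr s) =
         ennreal (critical_profile (card (Il \<union> Ir)) s (norm y) powr s)"
        using AE_coord_lebesgue[of "Il \<union> Ir"]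
      proof eventually_elim
        case (elim y)
        have y: "y \<in> (coord_space (Ip \<union> Iq))\<^sup>\<bottom>" using elim unfolding coord_space_orthogonal_comp compl_pq .
        have "infdist 0 ((*v) A ` ((+) y ` coord_space (Ip \<union> Iq))) = infdist 0 ((+) y ` coord_space (Ip \<union> Iq))"
          by (simp add: orthogonal_matrix_infdist[OF A])
        also have "\<dots> = norm y"
          by (simp add: infdist_zero_affine_grass[OF coord_plane_in_affine_grass] foot_translate[OF subspace_coord_space y])
        finally show ?case by (simp add: radial_counterexample_def cK)
      qed
    qed
  qed
  also have "\<dots> = (\<integral>\<^sup>+y. ennreal (critical_profile (card (Il \<union> Ir)) s (norm y) powr s) \<partial>coord_lebesgue (Il \<union> Ir))"
    by (simp add: haar_rot.emeasure_space_1[simplified])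
  also have "\<dots> < \<infinity>" by (rule critical_profile_power_integrable[OF s])
  finally have "integrable ?J (\<lambda>\<tau>. \<bar>?f \<tau>\<bar> powr s)"
    using f by (simp add: integrable_iff_bounded radial_counterexample_nonneg)
  then show ?thesis
    using f by (simp add: Lp_funs_def integrable_completion measurable_completion)
qed

text \<open>
  The plane P \<oplus> Q + u + v contains u + v, hence its distance to the origin is at most |u| + |v|.
  This bound does not involve P and Q, and the integral over u in the l-dimensional space P^\<bottom> \<inter> \<eta>,
  with \<eta> the direction of \<zeta>, diverges already.
\<close>

lemma radial_counterexample_diverges:
  assumes s: "s > 0" "real (card Il + card Ir) \<le> s * real (card Il)" and l: "card Il > 0"
    and \<zeta>: "\<zeta> \<in> affine_grass (card (Ip \<union> Il))"
  shows "\<not> strichartz_exists (card Ip) (card Iq) (radial_counterexample s) \<zeta>"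
proof
  let ?X = "dir_space \<zeta>" and ?v = "foot \<zeta>" and ?f = "radial_counterexample s"
  let ?S = "strichartz_measure (card Ip) (card Iq) ?X"
  let ?d = "card Il + card Ir"
  have X: "subspace ?X" "dim ?X = card (Ip \<union> Il)"
    using dir_space_affine_grass[OF \<zeta>] by (auto simp: grass_def)
  have p: "card Ip \<le> dim ?X" and q: "card Iq \<le> CARD('n) - dim ?X"
    using card_bounds unfolding card_Compl_eq by (simp_all add: X)
  have qX: "card Iq \<le> dim (?X\<^sup>\<bottom>)" using q by (simp add: dim_orthogonal_comp X)
  assume "strichartz_exists (card Ip) (card Iq) ?f \<zeta>"
  then have "(\<integral>\<^sup>+w. ennreal (norm (?f (plane_sum w ?v))) \<partial>completion ?S) < \<infinity>"
    unfolding strichartz_exists_def by (simp add: strichartz_integrand_plane_sum[abs_def] integrable_iff_bounded)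
  then have fin: "(\<integral>\<^sup>+w. ennreal (?f (plane_sum w ?v)) \<partial>?S) < \<infinity>"
    by (simp add: nn_integral_completion radial_counterexample_nonneg)
  have "(\<integral>\<^sup>+w. ennreal (critical_profile ?d s (norm (snd (snd w)) + norm ?v)) \<partial>?S) \<le> (\<integral>\<^sup>+w. ennreal (?f (plane_sum w ?v)) \<partial>?S)"
  proof (rule nn_integral_mono)
    fix w assume "w \<in> space ?S"
    then obtain Q P u where w: "w = (Q, P, u)" "Q \<in> grass (?X\<^sup>\<bottom>) (card Iq)" "P \<in> grass ?X (card Ip)"
      by (auto simp: space_strichartz_measure[OF X(1) p q])
    have "0 \<in> P" "0 \<in> Q" using w by (auto simp: grass_def subspace_0)
    then have "u + ?v \<in> plane_sum w ?v" by (force simp: w plane_sum_def)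
    then have "infdist 0 (plane_sum w ?v) \<le> norm (u + ?v)" using infdist_le[of "u + ?v" "plane_sum w ?v" 0] by simp
    also have "\<dots> \<le> norm u + norm ?v" by (rule norm_triangle_ineq)
    finally show "ennreal (critical_profile ?d s (norm (snd (snd w)) + norm ?v)) \<le> ennreal (?f (plane_sum w ?v))"
      unfolding radial_counterexample_def using s by (intro ennreal_leI critical_profile_antimono) (auto simp: w infdist_nonneg)
  qed
  moreover have "(\<integral>\<^sup>+w. ennreal (critical_profile ?d s (norm (snd (snd w)) + norm ?v)) \<partial>?S) = \<infinity>"
  proof -
    interpret P: prob_space "grass_measure ?X (card Ip)" by (rule sets_grass_measure(3)[OF X(1) p])
    interpret Q: prob_space "grass_measure (?X\<^sup>\<bottom>) (card Iq)" by (rule sets_grass_measure(3)[OF subspace_orthogonal_comp qX])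
    have m: "(\<lambda>w. ennreal (critical_profile ?d s (norm (snd (snd w)) + norm ?v))) \<in>
      borel_measurable (plane_algebra (grass (?X\<^sup>\<bottom>) (card Iq)) \<Otimes>\<^sub>M (plane_algebra (grass ?X (card Ip)) \<Otimes>\<^sub>M borel))"
    proof -
      have "(\<lambda>u. ennreal (critical_profile ?d s (norm u + norm ?v))) \<in> borel_measurable borel" by measurable
      from measurable_compose[OF measurable_compose[OF measurable_snd measurable_snd] this] show ?thesis by simp
    qed
    have "(\<integral>\<^sup>+w. ennreal (critical_profile ?d s (norm (snd (snd w)) + norm ?v)) \<partial>?S) =
      (\<integral>\<^sup>+Q. (\<integral>\<^sup>+P. (\<integral>\<^sup>+u. ennreal (critical_profile ?d s (norm u + norm ?v)) \<partial>lborel_on (P\<^sup>\<bottom> \<inter> ?X)) \<partial>grass_measure ?X (card Ip)) \<partial>grass_measure (?X\<^sup>\<bottom>) (card Iq))"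
      using nn_integral_strichartz_measure[OF X(1) p q m] by simp
    also have "\<dots> = (\<integral>\<^sup>+Q. (\<integral>\<^sup>+P. \<infinity> \<partial>grass_measure ?X (card Ip)) \<partial>grass_measure (?X\<^sup>\<bottom>) (card Iq))"
    proof (intro nn_integral_cong)
      fix P assume "P \<in> space (grass_measure ?X (card Ip))"
      then have P: "P \<in> grass ?X (card Ip)" by (simp add: sets_grass_measure[OF X(1) p])
      then have Y: "subspace (P\<^sup>\<bottom> \<inter> ?X)" "dim (P\<^sup>\<bottom> \<inter> ?X) = card Il"
        using X card_pl by (auto simp: subspace_orthogonal_comp subspace_inter dim_relative_orthogonal_comp grass_def)
      have "(\<integral>\<^sup>+u. ennreal (critical_profile ?d s (norm u + norm ?v)) \<partial>lborel_on (P\<^sup>\<bottom> \<inter> ?X)) =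
          (\<integral>\<^sup>+u. ennreal (critical_profile ?d s (norm u + norm ?v)) \<partial>coord_lebesgue Il)"
        by (rule nn_integral_lborel_on_norm[OF Y]) measurable
      also have "\<dots> = \<infinity>" by (rule critical_profile_not_integrable[OF s l]) simp
      finally show "(\<integral>\<^sup>+u. ennreal (critical_profile ?d s (norm u + norm ?v)) \<partial>lborel_on (P\<^sup>\<bottom> \<inter> ?X)) = \<infinity>" .
    qed
    also have "\<dots> = \<infinity>" by (simp add: P.emeasure_space_1 Q.emeasure_space_1)
    finally show ?thesis .
  qed
  ultimately show False using fin by (simp add: top_unique)
qed

lemma affine_grass_measure_nonzero: "\<not> (AE \<zeta> in (affine_grass_measure (card (Ip \<union> Il)) :: (real^'n) set measure). False)"
proof
  let ?M = "affine_grass_measure (card (Ip \<union> Il)) :: (real^'n) set measure"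
  assume "AE \<zeta> in ?M. False"
  then have "(\<integral>\<^sup>+\<zeta>. 1 \<partial>?M) = (\<integral>\<^sup>+\<zeta>. 0 \<partial>?M)" by (intro nn_integral_cong_AE) auto
  also have "(\<integral>\<^sup>+\<zeta>. 1 \<partial>?M) = (\<integral>\<^sup>+A. (\<integral>\<^sup>+u. 1 \<partial>coord_lebesgue (- (Ip \<union> Il))) \<partial>haar_rot (UNIV::'n set))"
    by (rule nn_integral_affine_grass_measure[OF refl]) simp
  also have "\<dots> = emeasure (coord_lebesgue (- (Ip \<union> Il))) UNIV"
    by (simp add: haar_rot.emeasure_space_1[simplified])
  finally have "emeasure (coord_lebesgue (- (Ip \<union> Il))) UNIV = 0" by simp
  then have "emeasure (coord_lebesgue (- (Ip \<union> Il))) (cball 0 1) = 0"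
    using emeasure_mono[of "cball 0 1" UNIV "coord_lebesgue (- (Ip \<union> Il))"] by (simp add: coord_lebesgue_def)
  then show False using emeasure_coord_lebesgue_cball_pos_finite(1)[of 1 "- (Ip \<union> Il)"] by simp
qed

theorem strichartz_exists_sharp:
  assumes s: "s \<ge> (real (card Il) + real (card Ir)) / real (card Il)" and l: "card Il > 0" and r: "card Ir > 0"
  shows "\<exists>f :: (real^'n) set \<Rightarrow> real. f \<in> Lp_funs s (affine_grass_measure (card (Ip \<union> Iq))) \<and>
     \<not> (AE \<zeta> in affine_grass_measure (card (Ip \<union> Il)). strichartz_exists (card Ip) (card Iq) f \<zeta>)"
proof (intro exI conjI)
  have "1 < (real (card Il) + real (card Ir)) / real (card Il)" using l r by (simp add: pos_less_divide_eq)
  then have s1: "s > 1" using s by simp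
  have s2: "real (card Il + card Ir) \<le> s * real (card Il)" using s l by (simp add: pos_divide_le_eq)
  show "radial_counterexample s \<in> Lp_funs s (affine_grass_measure (card (Ip \<union> Iq)))"
    by (rule radial_counterexample_Lp[OF s1])
  show "\<not> (AE \<zeta> in affine_grass_measure (card (Ip \<union> Il)). strichartz_exists (card Ip) (card Iq) (radial_counterexample s) \<zeta>)"
  proof
    assume "AE \<zeta> in affine_grass_measure (card (Ip \<union> Il)). strichartz_exists (card Ip) (card Iq) (radial_counterexample s) \<zeta>"
    then have "AE \<zeta> in (affine_grass_measure (card (Ip \<union> Il)) :: (real^'n) set measure). False"
      using AE_space
    proof eventually_elim
      case (elim \<zeta>)
      then show ?case using radial_counterexample_diverges[of s \<zeta>] s1 s2 l by simp
    qed
    then show False using affine_grass_measure_nonzero by simp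
  qed
qed

end

section \<open>Existence and sharpness for both transforms\<close>

lemma obtain_coord_split:
  assumes "p + q + l \<le> CARD('n::finite)"
  obtains Ip Iq Il Ir :: "'n::finite set" where "coord_split Ip Iq Il Ir"
    "card Ip = p" "card Iq = q" "card Il = l" "card Ir = CARD('n) - (p + q + l)"
proof -
  obtain Ip :: "'n set" where Ip: "card Ip = p"
    using obtain_subset_with_card_n[of p "UNIV :: 'n set"] assms by auto
  have "q \<le> card (- Ip)" using assms Ip by (simp add: card_Compl_eq)
  then obtain Iq where Iq: "Iq \<subseteq> - Ip" "card Iq = q" using obtain_subset_with_card_n by metis
  have pq: "card (Ip \<union> Iq) = p + q" using Ip Iq by (subst card_Un_disjoint) auto
  have "l \<le> card (- (Ip \<union> Iq))" unfolding card_Compl_eq pq using assms by simp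
  then obtain Il where Il: "Il \<subseteq> - (Ip \<union> Iq)" "card Il = l" using obtain_subset_with_card_n by metis
  have pql: "card (Ip \<union> Iq \<union> Il) = p + q + l"
    using Il pq by (subst card_Un_disjoint) auto
  show ?thesis
  proof (rule that[of Ip Iq Il "- (Ip \<union> Iq \<union> Il)"])
    show "coord_split Ip Iq Il (- (Ip \<union> Iq \<union> Il))"
      using Iq Il by unfold_locales auto
    show "card (- (Ip \<union> Iq \<union> Il)) = CARD('n) - (p + q + l)" unfolding card_Compl_eq pql ..
  qed (use Ip Iq Il in auto)
qed

text \<open>
  Both parts of the theorem are instances of this statement, with the roles of q and l exchanged.
\<close>

lemma strichartz_transform_sharp_existence:
  fixes p q l :: nat
  assumes "l > 0" "p + q + l < CARD('n::finite)"
  shows "\<And>s (f :: (real^'n) set \<Rightarrow> real). \<lbrakk>1 \<le> s; s < (real CARD('n) - real (p + q)) / real l;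
        f \<in> Lp_funs s (affine_grass_measure (p + q))\<rbrakk> \<Longrightarrow>
        AE \<zeta> in affine_grass_measure (p + l). strichartz_exists p q f \<zeta>"
    and "\<And>s. s \<ge> (real CARD('n) - real (p + q)) / real l \<Longrightarrow>
        \<exists>f :: (real^'n) set \<Rightarrow> real. f \<in> Lp_funs s (affine_grass_measure (p + q)) \<and>
           \<not> (AE \<zeta> in affine_grass_measure (p + l). strichartz_exists p q f \<zeta>)"
proof -
  obtain Ip Iq Il Ir :: "'n set" where I: "coord_split Ip Iq Il Ir" and c: "card Ip = p" "card Iq = q" "card Il = l"
     "card Ir = CARD('n) - (p + q + l)"
    using obtain_coord_split[where ?'n = 'n, OF less_imp_le[OF assms(2)]] by blast
  interpret coord_split Ip Iq Il Ir by (rule I)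
  have e: "real CARD('n) - real (p + q) = real (card Il) + real (card Ir)" using assms c by simp
  have pq: "card (Ip \<union> Iq) = p + q" and pl: "card (Ip \<union> Il) = p + l" using card_pq card_pl c by simp_all
  show "AE \<zeta> in affine_grass_measure (p + l). strichartz_exists p q f \<zeta>"
    if "1 \<le> s" "s < (real CARD('n) - real (p + q)) / real l" "f \<in> Lp_funs s (affine_grass_measure (p + q))"
    for s and f :: "(real^'n) set \<Rightarrow> real"
    using strichartz_exists_AE[of f s] that assms(1) unfolding e pq pl c by simp
  show "\<exists>f :: (real^'n) set \<Rightarrow> real. f \<in> Lp_funs s (affine_grass_measure (p + q)) \<and>
           \<not> (AE \<zeta> in affine_grass_measure (p + l). strichartz_exists p q f \<zeta>)"
    if "s \<ge> (real CARD('n) - real (p + q)) / real l" for s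
    using strichartz_exists_sharp[of s] that assms unfolding e pq pl c by simp
qed

theorem theorem4p3:
  fixes p q l j k n :: nat
  assumes "n = CARD('n::finite)"
    and "p > 0" and "q > 0" and "l > 0" and "p + q + l < n"
    and "j = p + q" and "k = p + l"
  shows
    "(\<forall>(s::real) (f :: (real ^ 'n) set \<Rightarrow> real).
        1 \<le> s \<and> s < (real n - real j) / real l \<and> f \<in> Lp_funs s (affine_grass_measure j) \<longrightarrow>
        (AE \<zeta> in affine_grass_measure k. strichartz_exists p q f \<zeta>)) \<and>
     (\<forall>(r::real) (g :: (real ^ 'n) set \<Rightarrow> real).
        1 \<le> r \<and> r < (real n - real k) / real q \<and> g \<in> Lp_funs r (affine_grass_measure k) \<longrightarrow>
        (AE \<tau> in affine_grass_measure j. strichartz_exists p l g \<tau>)) \<and>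
     (\<forall>s::real. s \<ge> (real n - real j) / real l \<longrightarrow>
        (\<exists>f :: (real ^ 'n) set \<Rightarrow> real. f \<in> Lp_funs s (affine_grass_measure j) \<and>
           \<not> (AE \<zeta> in affine_grass_measure k. strichartz_exists p q f \<zeta>))) \<and>
     (\<forall>r::real. r \<ge> (real n - real k) / real q \<longrightarrow>
        (\<exists>g :: (real ^ 'n) set \<Rightarrow> real. g \<in> Lp_funs r (affine_grass_measure k) \<and>
           \<not> (AE \<tau> in affine_grass_measure j. strichartz_exists p l g \<tau>)))"
proof -
  have n: "p + q + l < CARD('n)" "p + l + q < CARD('n)" using assms by simp_all
  note f = strichartz_transform_sharp_existence[OF \<open>l > 0\<close> n(1)]
  note g = strichartz_transform_sharp_existence[OF \<open>q > 0\<close> n(2)]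
  show ?thesis unfolding assms(1,6,7) using f g by blast
qed

end
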